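(* Let $d\ge 3$, let $Q$ be a positive definite quadratic form on $\mathbb{R}^{d-1}$ with symmetric coefficient matrix $A=(a_{ij})$ (so $Q(\vec{x})=\vec{x}^{T}A\vec{x}$), let $\vec{\beta}\in\mathbb{R}^{d-1}$ and $c>0$, and let \[\mathcal{P}=\{(\vec{x},y)\in\mathbb{R}^{d-1}\times\mathbb{R} : |y|\le c-Q(\vec{x}+\vec{\beta})\}.\] If $a_{12}/a_{11}\in\mathbb{Q}$ and $a_{22}/a_{11}\in\mathbb{Q}$, then $\alpha_{\mathcal{P}}\le d-2$. If moreover $\vec{\beta}=\vec{0}$, $c\in\mathbb{Q}$ and $Q$ is rational (all its coefficients are rational), then $\alpha_{\mathcal{P}}=d-2$.
   Context: For a compact set $\mathcal{K}\subset\mathbb{R}^d$ and $R>0$, $\mathcal{N}(R)=\#\{\vec{n}\in\mathbb{Z}^d : R^{-1}\vec{n}\in\mathcal{K}\}$, and $\alpha_{\mathcal{K}}=\inf\{\alpha>0 : \mathcal{N}(R)=|\mathcal{K}|R^d+O(R^\alpha) \text{ as } R\to\infty\}$, where $|\mathcal{K}|$ is the volume of $\mathcal{K}$. *)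

theory Defs
  imports "HOL-Analysis.Analysis" "HOL-Library.Landau_Symbols"
begin

definition integer_lattice :: "'a::euclidean_space set" where
  "integer_lattice = {v. \<forall>b\<in>Basis. v \<bullet> b \<in> \<int>}"

definition lattice_count :: "'a::euclidean_space set \<Rightarrow> real \<Rightarrow> nat" where
  "lattice_count K R = card {v \<in> integer_lattice. inverse R *\<^sub>R v \<in> K}"

(* Intended for compact K. Then the set below contains DIM('a) and is bounded below by 0,
   so the real-valued Inf is the genuine infimum. The Landau symbol is taken at_top. *)
definition lattice_exponent :: "'a::euclidean_space set \<Rightarrow> real" where
  "lattice_exponent K = Inf {\<alpha>::real. \<alpha> > 0 \<and>
     (\<lambda>R. real (lattice_count K R) - measure lebesgue K * R ^ DIM('a)) \<in> O(\<lambda>R. R powr \<alpha>)}"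

definition quad_form :: "real ^ 'n ^ 'n \<Rightarrow> real ^ 'n \<Rightarrow> real" where
  "quad_form A x = x \<bullet> (A *v x)"

definition positive_definite :: "real ^ 'n ^ 'n \<Rightarrow> bool" where
  "positive_definite A \<longleftrightarrow> (\<forall>x. x \<noteq> 0 \<longrightarrow> quad_form A x > 0)"

definition double_paraboloid ::
    "real ^ 'n ^ 'n \<Rightarrow> real ^ 'n \<Rightarrow> real \<Rightarrow> ((real ^ 'n) \<times> real) set" where
  "double_paraboloid A \<beta> c = {(x, y). \<bar>y\<bar> \<le> c - quad_form A (x + \<beta>)}"

end

theory Submission
  imports Defs "HOL-Analysis.Harmonic_Numbers" "HOL-Number_Theory.Cong"
begin

text \<open>
  Slicing the scaled body over the integer points \<open>m\<close> of the base, at height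
  \<open>h(m) = c R - Q(m + R \<beta>) / R\<close>, the number of lattice points is the sum of
  \<open>2 h(m) - 2 \<psi>(h(m))\<close> over \<open>h(m) \<ge> 0\<close>, where \<open>\<psi>(t) = frac t - 1/2\<close>. With \<open>n = d - 1\<close>, the sum of the
  positive parts of \<open>h\<close> differs from its integral by \<open>O(R^(n-1))\<close>: second differences over symmetric unit
  cells are \<open>O(1/R)\<close>, except in a shell of \<open>O(R^(n-1))\<close> cells where they are bounded.

  The sawtooth \<open>\<psi>\<close>, set to zero for negative arguments and made periodic with an even period \<open>2 L\<close> of order
  \<open>R\<close>, is one-sided Lipschitz. Hence smoothing with a Fejer kernel bounds its sum over \<open>m\<close> by its Fourier
  coefficients times \<open>|\<Sum> e(j h(m) / 2L)|\<close>, up to \<open>O(R^(n-1))\<close>, and there is no need to cut the index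
  set off at \<open>h(m) = 0\<close>; a box in suitable coordinates will do. As \<open>a12 / a11\<close> is rational, shearing the
  first two coordinates splits the exponential sum into a product of two quadratic Weyl sums, and
  \<open>|S1 S2| \<le> (|S1|^2 + |S2|^2) / 2\<close> is estimated by Weyl differencing. On average over \<open>j\<close>, with the
  divisor bound, this is \<open>O(R^(1 + \<epsilon>))\<close> for each choice of the other \<open>n - 2\<close> coordinates.

  In the rational case choose a prime \<open>p\<close> for which the form has an isotropic vector modulo \<open>p\<close>. Then it has at
  least \<open>p^(n-1) / 2\<close> zeros modulo \<open>p\<close>, which yield of the order of \<open>R^(n-1)\<close> lattice points on the
  boundary for \<open>R = \<kappa> p\<close>. So the counting function jumps there by that amount.
\<close>

section \<open>Quadratic exponential sums\<close>

text \<open>With \<open>n = d - 1\<close> the target exponent is \<open>n - 1\<close>, so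
  square-root cancellation in just two of the \<open>n\<close> base variables is enough: the other
  \<open>n - 2\<close> are summed trivially, and the two sheared ones must contribute
  \<open>R powr (1 + \<epsilon>)\<close> instead of about \<open>R^2\<close>. The obstacle is the
  boundary of the ellipsoid. A sum over the ellipsoid does not factor into one-variable sums, while
  a box contains points of negative height, where the fibre is empty and the formula for its
  cardinality fails. Moving the cutoff into the periodic function keeps the product structure, at
  the price of frequencies \<open>j / (2 L)\<close> that need not be integers. The coefficients peak
  near integers, and averaging over the fractional parts is the main analytic work. Weyl
  differencing forgets linear coefficients, which makes its bounds uniform in the shift by
  \<open>R \<beta>\<close> and in the remaining coordinates. In the rational case not every prime is
  suitable, since a binary form may be anisotropic modulo \<open>p\<close>. The primes used are
  those modulo which minus a 2 by 2 minor is a square; they can be taken arbitrarily large.\<close>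

definition ee :: "real \<Rightarrow> complex" where
  "ee x = cis (2 * pi * x)"

definition nint_dist :: "real \<Rightarrow> real" where
  "nint_dist x = \<bar>x - of_int (round x)\<bar>"

text \<open>The minimum of \<open>N\<close> and the inverse of the distance to the nearest integer; written with a maximum
  because \<open>1 / 0 = 0\<close>.\<close>

definition wt :: "nat \<Rightarrow> real \<Rightarrow> real" where
  "wt N x = 1 / max (nint_dist x) (1 / real N)"

lemma norm_ee [simp]: "norm (ee x) = 1"
  by (simp add: ee_def)

lemma ee_0 [simp]: "ee 0 = 1"
  by (simp add: ee_def)

lemma ee_add: "ee (x + y) = ee x * ee y"
  by (simp add: ee_def cis_mult algebra_simps)

lemma ee_diff: "ee (x - y) = ee x * cnj (ee y)"
  by (simp add: ee_def cis_mult cis_cnj algebra_simps)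

lemma cnj_ee: "cnj (ee x) = ee (- x)"
  by (simp add: ee_def cis_cnj)

lemma ee_of_int [simp]: "ee (of_int k) = 1"
  by (simp add: ee_def cis_multiple_2pi)

lemma ee_of_nat_mult: "ee (real k * x) = ee x ^ k"
  by (simp add: ee_def Complex.DeMoivre algebra_simps)

lemma nint_dist_le_half: "nint_dist x \<le> 1 / 2"
  unfolding nint_dist_def using of_int_round_abs_le[of x] by (simp add: abs_minus_commute)

lemma nint_dist_le: "nint_dist x \<le> \<bar>x - of_int k\<bar>"
  unfolding nint_dist_def using round_diff_minimal[of x k] by (simp add: abs_minus_commute)

lemma nint_dist_triangle: "nint_dist (x + y) \<le> nint_dist x + \<bar>y\<bar>"
proof -
  have "nint_dist (x + y) \<le> \<bar>x + y - of_int (round x)\<bar>" by (rule nint_dist_le)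
  then show ?thesis unfolding nint_dist_def by linarith
qed

lemma nint_dist_minus: "nint_dist (- x) = nint_dist x"
proof -
  have "nint_dist (- x) \<le> nint_dist x" for x
    using nint_dist_le[of "-x" "- round x"] by (simp add: nint_dist_def)
  from this[of x] this[of "-x"] show ?thesis by simp
qed

lemma wt_nonneg: "wt N x \<ge> 0"
  by (simp add: wt_def le_max_iff_disj)

lemma wt_le: "N > 0 \<Longrightarrow> wt N x \<le> real N"
  using divide_left_mono[of "1 / real N" "max (nint_dist x) (1 / real N)" 1]
  by (simp add: wt_def less_max_iff_disj)

lemma wt_le_inverse: "0 < t \<Longrightarrow> t \<le> nint_dist x \<Longrightarrow> wt N x \<le> 1 / t"
  unfolding wt_def by (intro divide_left_mono mult_pos_pos) (auto simp: less_max_iff_disj)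

lemma wt_minus: "wt N (- x) = wt N x"
  by (simp add: wt_def nint_dist_minus)

lemma wt_mono: "0 < N \<Longrightarrow> N \<le> N' \<Longrightarrow> wt N x \<le> wt N' x"
  unfolding wt_def by (intro divide_left_mono max.mono mult_pos_pos) (auto simp: divide_simps less_max_iff_disj)

text \<open>Concavity of sine on the quarter period: the graph lies above the chord from
  \<open>0\<close> to \<open>pi / 2\<close>.\<close>

lemma jordan_sin: assumes "0 \<le> x" "x \<le> pi / 2" shows "2 * x / pi \<le> sin x"
proof -
  have c: "convex_on {0..pi/2} (\<lambda>x. - sin x)"
    by (rule f''_ge0_imp_convex[where f' = "\<lambda>x. - cos x" and f'' = "\<lambda>x. sin x"])
       (auto intro!: derivative_eq_intros sin_ge_zero)
  define t where "t = 2 * x / pi"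
  have t: "0 \<le> t" "t \<le> 1" using assms by (auto simp: t_def field_simps)
  have "- sin ((1 - t) *\<^sub>R 0 + t *\<^sub>R (pi/2)) \<le> (1 - t) * (- sin 0) + t * (- sin (pi/2))"
    by (rule convex_onD[OF c]) (use t in auto)
  moreover have "t * (pi/2) = x" by (simp add: t_def)
  ultimately show ?thesis by (simp add: t_def)
qed

text \<open>After reduction modulo one the left side is \<open>2 * \<bar>sin (pi * y)\<bar>\<close>
  with \<open>\<bar>y\<bar> \<le> 1/2\<close>, which is the range of Jordan's inequality.\<close>

lemma norm_one_minus_ee: "norm (1 - ee x) \<ge> 4 * nint_dist x"
proof -
  define y where "y = x - of_int (round x)"
  have "ee x = ee (y + of_int (round x))" by (simp add: y_def)
  then have e: "ee x = ee y" by (simp only: ee_add ee_of_int) simp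
  have y: "\<bar>y\<bar> = nint_dist x" by (simp add: y_def nint_dist_def)
  have "norm (1 - ee y) = 2 * \<bar>sin (pi * y)\<bar>"
  proof -
    have "(norm (1 - ee y))\<^sup>2 = (1 - cos (2*pi*y))\<^sup>2 + (sin (2*pi*y))\<^sup>2"
      by (simp add: cmod_def ee_def)
    also have "\<dots> = 2 - 2 * cos (2 * (pi * y))"
      using sin_cos_squared_add[of "2*pi*y"] by (simp add: power2_eq_square algebra_simps)
    also have "\<dots> = (2 * \<bar>sin (pi * y)\<bar>)\<^sup>2"
      by (simp only: cos_double_sin) (simp add: power_mult_distrib)
    finally show ?thesis by (subst (asm) power2_eq_iff_nonneg) auto
  qed
  moreover have "\<bar>sin (pi * y)\<bar> = sin (pi * \<bar>y\<bar>)"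
  proof -
    have "\<bar>y\<bar> \<le> 1/2" using y nint_dist_le_half by simp
    then have "0 \<le> sin (pi * \<bar>y\<bar>)" by (intro sin_ge_zero) (auto simp: )
    then show ?thesis by (cases "y \<ge> 0") auto
  qed
  moreover have "2 * (pi * \<bar>y\<bar>) / pi \<le> sin (pi * \<bar>y\<bar>)"
    using y nint_dist_le_half[of x] by (intro jordan_sin) auto
  ultimately show ?thesis using e y by simp
qed

text \<open>The trivial bound \<open>N\<close> serves close to an integer, the closed form of the
  geometric sum elsewhere; \<open>wt\<close> is made to record the better of the two.\<close>

lemma norm_geometric_ee_le:
  assumes "N > 0"
  shows "norm (\<Sum>k<N. ee (real k * \<alpha>)) \<le> wt N \<alpha>"
proof (cases "nint_dist \<alpha> \<le> 1 / real N")
  case True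
  have "norm (\<Sum>k<N. ee (real k * \<alpha>)) \<le> (\<Sum>k<N. norm (ee (real k * \<alpha>)))" by (rule norm_sum)
  also have "\<dots> = real N" by simp
  finally show ?thesis using True by (simp add: wt_def max_def)
next
  case False
  then have pos: "nint_dist \<alpha> > 0" using assms by (smt (verit) divide_nonneg_nonneg of_nat_0_le_iff)
  then have ne: "ee \<alpha> \<noteq> 1" unfolding nint_dist_def
    using norm_one_minus_ee[of \<alpha>] pos by auto
  have "(\<Sum>k<N. ee (real k * \<alpha>)) = (1 - ee \<alpha> ^ N) / (1 - ee \<alpha>)"
    using ne by (simp add: ee_of_nat_mult sum_gp_strict)
  also have "norm \<dots> \<le> 2 / (4 * nint_dist \<alpha>)"
    unfolding norm_divide
    using norm_one_minus_ee[of \<alpha>] pos norm_triangle_ineq4[of 1 "ee \<alpha> ^ N"]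
    by (intro frac_le) (auto simp: norm_power)
  also have "\<dots> \<le> 1 / nint_dist \<alpha>" using pos by (simp add: field_simps)
  finally show ?thesis using False by (simp add: wt_def max_def)
qed

text \<open>Weyl differencing. The off-diagonal pairs of the square are grouped by their difference
  \<open>h\<close>; there the quadratic phase becomes linear with slope
  \<open>2 * \<alpha> * h\<close>, and \<open>\<beta>\<close> survives only in a factor of modulus
  one. Hence the bound is uniform in \<open>\<beta>\<close>.\<close>

lemma weyl_square:
  assumes "N > 0"
  shows "(norm (\<Sum>u<N. ee (\<alpha> * (real u)\<^sup>2 + \<beta> * real u)))\<^sup>2
     \<le> real N + 2 * (\<Sum>h=1..N. wt N (2 * \<alpha> * real h))"
proof -
  define f where "f u = ee (\<alpha> * (real u)\<^sup>2 + \<beta> * real u)" for u :: nat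
  define S where "S = (\<Sum>u<N. f u)"
  define T where "T = (\<Sum>h=1..<N. \<Sum>v<N - h. f (v + h) * cnj (f v))"
  have fin: "finite {(u, v). v < u \<and> u < (N::nat)}"
    by (rule finite_subset[of _ "{..<N} \<times> {..<N}"]) auto
  have "S * cnj S = (\<Sum>(u,v)\<in>{..<N} \<times> {..<N}. f u * cnj (f v))"
    by (simp add: S_def sum_product sum.cartesian_product)
  also have "{..<N} \<times> {..<N} = {(u, v). u = v \<and> u < N} \<union> ({(u, v). v < u \<and> u < N} \<union> {(u, v). u < v \<and> v < N})"
    by auto
  also have "(\<Sum>(u,v)\<in>\<dots>. f u * cnj (f v)) = (\<Sum>(u,v)\<in>{(u, v). u = v \<and> u < N}. f u * cnj (f v))
     + ((\<Sum>(u,v)\<in>{(u, v). v < u \<and> u < N}. f u * cnj (f v)) + (\<Sum>(u,v)\<in>{(u, v). u < v \<and> v < N}. f u * cnj (f v)))"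
    by (subst sum.union_disjoint; (subst sum.union_disjoint)?)
       (auto intro: finite_subset[of _ "{..<N} \<times> {..<N}"])
  also have "(\<Sum>(u,v)\<in>{(u, v). u = v \<and> u < N}. f u * cnj (f v)) = (\<Sum>u<N. f u * cnj (f u))"
    by (rule sum.reindex_bij_witness[where i = "\<lambda>u. (u,u)" and j = fst]) auto
  also have "\<dots> = of_nat N" by (simp add: f_def complex_norm_square[symmetric])
  also have "(\<Sum>(u,v)\<in>{(u, v). v < u \<and> u < N}. f u * cnj (f v)) = T"
    unfolding T_def by (subst sum.Sigma, simp, simp,
        rule sum.reindex_bij_witness[where i = "\<lambda>(h,v). (v+h,v)" and j = "\<lambda>(u,v). (u-v,v)"]) auto
  also have "(\<Sum>(u,v)\<in>{(u, v). u < v \<and> v < N}. f u * cnj (f v)) = cnj (\<Sum>(u,v)\<in>{(u, v). v < u \<and> u < N}. f u * cnj (f v))"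
    unfolding cnj_sum
    by (rule sum.reindex_bij_witness[where i = "\<lambda>(u,v). (v,u)" and j = "\<lambda>(u,v). (v,u)"]) auto
  also have "(\<Sum>(u,v)\<in>{(u, v). v < u \<and> u < N}. f u * cnj (f v)) = T"
    unfolding T_def by (subst sum.Sigma, simp, simp,
        rule sum.reindex_bij_witness[where i = "\<lambda>(h,v). (v+h,v)" and j = "\<lambda>(u,v). (u-v,v)"]) auto
  finally have eq: "S * cnj S = of_nat N + (T + cnj T)" .
  have "norm (S * cnj S) = (norm S)\<^sup>2" by (simp add: norm_mult power2_eq_square)
  then have "(norm S)\<^sup>2 \<le> real N + (norm T + norm (cnj T))"
    unfolding eq using norm_triangle_ineq[of "of_nat N" "T + cnj T"] norm_triangle_ineq[of T "cnj T"]
    by simp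
  then have 1: "(norm S)\<^sup>2 \<le> real N + 2 * norm T" by simp
  have "norm T \<le> (\<Sum>h=1..<N. norm (\<Sum>v<N - h. f (v + h) * cnj (f v)))"
    unfolding T_def by (rule norm_sum)
  also have "\<dots> \<le> (\<Sum>h=1..<N. wt N (2 * \<alpha> * real h))"
  proof (rule sum_mono)
    fix h assume h: "h \<in> {1..<N}"
    have "f (v + h) * cnj (f v) = ee (\<alpha> * (real h)\<^sup>2 + \<beta> * real h) * ee (real v * (2 * \<alpha> * real h))" for v
      unfolding f_def cnj_ee ee_add[symmetric]
      by (rule arg_cong[where f = ee]) (simp add: power2_eq_square algebra_simps)
    then have "norm (\<Sum>v<N - h. f (v + h) * cnj (f v)) = norm (\<Sum>v<N - h. ee (real v * (2 * \<alpha> * real h)))"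
      by (simp add: sum_distrib_left[symmetric] norm_mult)
    also have "\<dots> \<le> wt (N - h) (2 * \<alpha> * real h)" using h by (intro norm_geometric_ee_le) auto
    also have "\<dots> \<le> wt N (2 * \<alpha> * real h)" using h by (intro wt_mono) auto
    finally show "norm (\<Sum>v<N - h. f (v + h) * cnj (f v)) \<le> wt N (2 * \<alpha> * real h)" .
  qed
  also have "\<dots> \<le> (\<Sum>h=1..N. wt N (2 * \<alpha> * real h))"
    by (intro sum_mono2) (auto simp: wt_nonneg)
  finally show ?thesis using 1 by (simp add: S_def f_def)
qed


section \<open>Averages over frequencies\<close>

text \<open>Each term is located by three data: the nearest integer, the side of it on which the
  point lies, and the number of whole steps \<open>\<sigma>\<close> in between. Distinct terms have
  distinct data because the points are at least \<open>\<sigma>\<close> apart. At most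
  \<open>B * \<sigma> + 2\<close> integers occur, and around each of them the distances dominate the
  multiples of \<open>\<sigma>\<close>, whose inverses sum to a harmonic number.\<close>

lemma sum_wt_arith_progression:
  assumes \<sigma>: "\<sigma> > 0" and N: "N > 0"
  shows "(\<Sum>b<B. wt N (c + real b * \<sigma>))
     \<le> (real B * \<sigma> + 2) * 2 * (real N + harm (nat \<lfloor>1 / \<sigma>\<rfloor>) / \<sigma>)"
proof -
  define a where "a b = round (c + real b * \<sigma>)" for b :: nat
  define z where "z b = c + real b * \<sigma> - of_int (a b)" for b
  define i where "i b = nat \<lfloor>\<bar>z b\<bar> / \<sigma>\<rfloor>" for b
  define g where "g b = (a b, z b \<ge> 0, i b)" for b
  define I where "I = nat \<lfloor>1 / \<sigma>\<rfloor>"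
  \<comment> \<open>In the cell \<open>j = 0\<close> the distance may be arbitrarily small, so only
    the trivial bound \<open>N\<close> is left.\<close>
  define w where "w j = (if j = 0 then real N else 1 / (real j * \<sigma>))" for j :: nat
  define A where "A = {a 0..a B}"
  have zh: "\<bar>z b\<bar> \<le> 1/2" for b
    unfolding z_def a_def using of_int_round_abs_le[of "c + real b * \<sigma>"] by (simp add: abs_minus_commute)
  have zn: "\<bar>z b\<bar> = nint_dist (c + real b * \<sigma>)" for b by (simp add: z_def a_def nint_dist_def)
  have ib: "real (i b) * \<sigma> \<le> \<bar>z b\<bar>" "\<bar>z b\<bar> < (real (i b) + 1) * \<sigma>" for b
  proof -
    have "real (i b) = of_int \<lfloor>\<bar>z b\<bar> / \<sigma>\<rfloor>" unfolding i_def using \<sigma> by simp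
    then have "real (i b) \<le> \<bar>z b\<bar> / \<sigma>" "\<bar>z b\<bar> / \<sigma> < real (i b) + 1" by linarith+
    then show "real (i b) * \<sigma> \<le> \<bar>z b\<bar>" "\<bar>z b\<bar> < (real (i b) + 1) * \<sigma>"
      using \<sigma> by (simp_all add: field_simps)
  qed
  have inj: "inj_on g {..<B}"
  proof (rule inj_onI)
    fix b b' assume "g b = g b'"
    then have eq: "a b = a b'" "(z b \<ge> 0) = (z b' \<ge> 0)" "i b = i b'" by (auto simp: g_def)
    have "\<bar>z b - z b'\<bar> < \<sigma>"
      using ib[of b] ib[of b'] eq(2) unfolding eq(3) by (cases "z b \<ge> 0") (auto simp: algebra_simps)
    moreover have "z b - z b' = (real b - real b') * \<sigma>" using eq(1) by (simp add: z_def algebra_simps)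
    ultimately have "\<bar>real b - real b'\<bar> < 1" using \<sigma> by (simp add: abs_mult)
    then show "b = b'" by linarith
  qed
  have iI: "i b \<le> I" for b
  proof -
    have "\<bar>z b\<bar> / \<sigma> \<le> 1 / \<sigma>" using zh[of b] \<sigma> by (intro divide_right_mono) auto
    then show ?thesis unfolding i_def I_def by (intro nat_mono floor_mono)
  qed
  have aA: "a b \<in> A" if "b < B" for b
    unfolding A_def a_def using that \<sigma> by (auto intro!: round_mono)
  have wtw: "wt N (c + real b * \<sigma>) \<le> w (i b)" for b
  proof (cases "i b = 0")
    case True then show ?thesis using wt_le[OF N] by (simp add: w_def)
  next
    case False then show ?thesis using ib(1)[of b] \<sigma> unfolding zn w_def by (simp add: wt_le_inverse)
  qed
  have wpos: "w j \<ge> 0" for j using \<sigma> by (simp add: w_def)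
  have "(\<Sum>b<B. wt N (c + real b * \<sigma>)) \<le> (\<Sum>b<B. w (snd (snd (g b))))"
    by (intro sum_mono) (use wtw in \<open>simp add: g_def\<close>)
  also have "\<dots> = (\<Sum>(x::int \<times> bool \<times> nat)\<in>g ` {..<B}. w (snd (snd x)))"
    by (simp add: sum.reindex[OF inj])
  also have "\<dots> \<le> (\<Sum>x\<in>A \<times> (UNIV :: bool set) \<times> {0..I}. w (snd (snd x)))"
    using aA iI by (intro sum_mono2) (auto simp: g_def A_def wpos)
  also have "\<dots> = real (card A) * (2 * (\<Sum>j=0..I. w j))"
    by (simp add: sum.cartesian_product' sum.swap)
  also have "(\<Sum>j=0..I. w j) = real N + harm I / \<sigma>"
    by (simp add: sum.atLeast_Suc_atMost w_def harm_def sum_divide_distrib field_simps)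
  also have "real (card A) * (2 * (real N + harm I / \<sigma>)) \<le> (real B * \<sigma> + 2) * (2 * (real N + harm I / \<sigma>))"
  proof (rule mult_right_mono)
    have "of_int (a B) \<le> c + real B * \<sigma> + 1/2" "c - 1/2 \<le> of_int (a 0)"
      using of_int_round_le[of "c + real B * \<sigma>"] of_int_round_ge[of c] by (auto simp: a_def)
    then have "of_int (a B) - of_int (a 0) \<le> real B * \<sigma> + 1" by linarith
    moreover have "a 0 \<le> a B" unfolding a_def using \<sigma> by (intro round_mono) auto
    ultimately show "real (card A) \<le> real B * \<sigma> + 2" unfolding A_def by simp
  qed (use \<sigma> in \<open>simp add: harm_nonneg\<close>)
  finally show ?thesis by (simp only: I_def mult.assoc)
qed

lemma harm_le_one_plus_ln:
  assumes "n > 0"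
  shows "harm n \<le> 1 + ln (real n)"
proof -
  obtain m where n: "n = Suc m" using assms by (cases n) auto
  show ?thesis using decseqD[OF decseq_harm_diff_ln, of 0 m] by (simp add: n harm_def)
qed

lemma harm_nat_floor_le:
  assumes "x \<le> C * real N ^ q" "C \<ge> 1" "N \<ge> 1"
  shows "harm (nat \<lfloor>x\<rfloor>) \<le> (1 + ln C + real q) * (1 + ln (real N))"
proof (cases "nat \<lfloor>x\<rfloor> = 0")
  case True
  have "ln C \<ge> 0" "ln (real N) \<ge> 0" using assms by auto
  then show ?thesis using True by (simp add: harm_def)
next
  case False
  then have x: "x \<ge> 1" by linarith
  have l: "ln C \<ge> 0" "ln (real N) \<ge> 0" using assms by auto
  have "harm (nat \<lfloor>x\<rfloor>) \<le> ln (real (nat \<lfloor>x\<rfloor>)) + 1" using False using harm_le_one_plus_ln[of "nat \<lfloor>x\<rfloor>"] by simp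
  also have "ln (real (nat \<lfloor>x\<rfloor>)) \<le> ln (C * real N ^ q)"
    using False assms(1) x by (intro ln_mono) (auto, linarith)
  also have "\<dots> = ln C + real q * ln (real N)" using assms by (simp add: ln_mult ln_realpow)
  also have "ln C + real q * ln (real N) + 1 \<le> (1 + ln C + real q) * (1 + ln (real N))"
    using l by (simp add: algebra_simps)
  finally show ?thesis by simp
qed

text \<open>\<open>\<kappa>\<close> bounds the number of turns around the circle, and
  \<open>Y\<close> is the size of the sum up to a logarithm. The condition
  \<open>Y \<le> N^2\<close> keeps the harmonic number at order \<open>ln N\<close>, so the constant
  depends on \<open>\<kappa>\<close> and \<open>C0\<close> alone.\<close>

lemma sum_wt_arith_progression':
  assumes "\<kappa> \<ge> 0" "C0 \<ge> 1"
  obtains C where "C > 0"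
    "\<And>N B \<sigma> c Y. N \<ge> 1 \<Longrightarrow> \<sigma> > 0 \<Longrightarrow> real B * \<sigma> \<le> \<kappa> \<Longrightarrow> 1 / \<sigma> \<le> C0 * Y \<Longrightarrow> real N \<le> Y \<Longrightarrow> Y \<le> real N ^ 2 \<Longrightarrow>
       (\<Sum>b<B. wt N (c + real b * \<sigma>)) \<le> C * Y * (1 + ln (real N))"
proof
  define C where "C = (\<kappa> + 2) * 2 * (1 + C0 * (1 + ln C0 + 2))"
  have l0: "ln C0 \<ge> 0" using assms by simp
  show "C > 0" unfolding C_def using assms l0 by (simp add: add_nonneg_pos add_pos_nonneg)
  fix N B :: nat and \<sigma> c Y :: real
  assume h: "N \<ge> 1" "\<sigma> > 0" "real B * \<sigma> \<le> \<kappa>" "1 / \<sigma> \<le> C0 * Y" "real N \<le> Y" "Y \<le> real N ^ 2"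
  define \<Lambda> where "\<Lambda> = 1 + ln (real N)"
  have \<Lambda>: "\<Lambda> \<ge> 1" using h by (simp add: \<Lambda>_def)
  have Y: "Y > 0" using h by linarith
  have "1 / \<sigma> \<le> C0 * real N ^ 2"
    using h(4) mult_left_mono[OF h(6), of C0] assms by linarith
  then have hm: "harm (nat \<lfloor>1 / \<sigma>\<rfloor>) \<le> (1 + ln C0 + 2) * \<Lambda>"
    using harm_nat_floor_le[of "1/\<sigma>" C0 N 2] assms h by (simp add: \<Lambda>_def)
  have "(\<Sum>b<B. wt N (c + real b * \<sigma>)) \<le> (real B * \<sigma> + 2) * 2 * (real N + harm (nat \<lfloor>1 / \<sigma>\<rfloor>) * (1 / \<sigma>))"
    using sum_wt_arith_progression[OF h(2), where N = N and B = B and c = c] h(1) by simp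
  also have "\<dots> \<le> (\<kappa> + 2) * 2 * (Y * \<Lambda> + ((1 + ln C0 + 2) * \<Lambda>) * (C0 * Y))"
  proof (rule mult_mono)
    have "real N \<le> Y * \<Lambda>" using h(5) mult_left_mono[OF \<Lambda>, of Y] Y by linarith
    then show "real N + harm (nat \<lfloor>1 / \<sigma>\<rfloor>) * (1 / \<sigma>) \<le> Y * \<Lambda> + ((1 + ln C0 + 2) * \<Lambda>) * (C0 * Y)"
      using hm h \<Lambda> l0 by (intro add_mono mult_mono) (auto simp: harm_nonneg)
  qed (use h assms in \<open>auto simp: harm_nonneg\<close>)
  also have "\<dots> = C * Y * \<Lambda>" by (simp add: C_def algebra_simps)
  finally show "(\<Sum>b<B. wt N (c + real b * \<sigma>)) \<le> C * Y * (1 + ln (real N))" by (simp add: \<Lambda>_def)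
qed

section \<open>The divisor bound\<close>

lemma card_divisors_prime_power_mult:
  fixes p m a :: nat
  assumes "prime p" "m > 0" "\<not> p dvd m"
  shows "card {d. d dvd p ^ a * m} \<le> (a + 1) * card {d. d dvd m}"
proof -
  have fin: "finite {d. d dvd m}" using assms by simp
  have "{d. d dvd p ^ a * m} \<subseteq> (\<lambda>(i, e). p ^ i * e) ` ({..a} \<times> {d. d dvd m})"
  proof
    fix d assume "d \<in> {d. d dvd p ^ a * m}"
    then have "d dvd p ^ a * m" by simp
    then obtain x y where d: "d = x * y" "x dvd p ^ a" "y dvd m" by (rule division_decomp[THEN exE]) blast
    from d(2) obtain i where "i \<le> a" "x = p ^ i" using divides_primepow_nat[OF assms(1)] by blast
    then show "d \<in> (\<lambda>(i, e). p ^ i * e) ` ({..a} \<times> {d. d dvd m})" using d by (auto intro!: image_eqI[of _ _ "(i, y)"])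
  qed
  then have "card {d. d dvd p ^ a * m} \<le> card ({..a} \<times> {d. d dvd m})"
    using fin by (meson card_image_le card_mono finite_SigmaI finite_atMost finite_imageI le_trans)
  then show ?thesis by (simp add: card_cartesian_product)
qed

lemma add_one_le_powr:
  assumes "\<epsilon> > 0" "p \<ge> 2"
  shows "real a + 1 \<le> (1 + 2 / \<epsilon>) * (p ^ a) powr \<epsilon>"
proof -
  have "1 + \<epsilon> * real a / 2 \<le> 1 + \<epsilon> * real a * ln 2"
    using ln2_ge_two_thirds assms mult_left_mono[of "1/2" "ln 2" "\<epsilon> * real a"] by simp
  also have "\<dots> \<le> exp (\<epsilon> * real a * ln 2)" by (rule exp_ge_add_one_self)
  also have "\<dots> = 2 powr (\<epsilon> * real a)" by (simp add: powr_def)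
  also have "\<dots> \<le> p powr (\<epsilon> * real a)" using assms by (intro powr_mono2) auto
  also have "\<dots> = (p ^ a) powr \<epsilon>" using assms
    by (simp add: powr_powr powr_realpow[symmetric] mult.commute)
  finally have 1: "1 + \<epsilon> * real a / 2 \<le> (p ^ a) powr \<epsilon>" .
  have "real a + 1 \<le> (1 + 2 / \<epsilon>) * (1 + \<epsilon> * real a / 2)" using assms by (simp add: field_simps)
  also have "\<dots> \<le> (1 + 2 / \<epsilon>) * (p ^ a) powr \<epsilon>" using 1 assms by (intro mult_left_mono) auto
  finally show ?thesis .
qed

lemma add_one_le_powr_large:
  assumes "\<epsilon> > 0" "p \<ge> 2 powr (1 / \<epsilon>)"
  shows "real a + 1 \<le> (p ^ a) powr \<epsilon>"
proof -
  have p: "p > 0" using assms(2) by (smt (verit) powr_gt_zero)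
  have "real a + 1 \<le> 2 ^ a" using of_nat_mono[OF less_exp[THEN Suc_leI, of a], where 'a = real] by simp
  also have "\<dots> = ((2 powr (1/\<epsilon>)) powr \<epsilon>) ^ a" using assms by (simp add: powr_powr)
  also have "\<dots> \<le> (p powr \<epsilon>) ^ a" using assms by (intro power_mono powr_mono2) auto
  also have "\<dots> = (p ^ a) powr \<epsilon>" using p by (simp add: powr_power powr_powr powr_realpow[symmetric] mult.commute)
  finally show ?thesis .
qed

text \<open>The number of divisors divided by \<open>l powr \<epsilon>\<close> is multiplicative,
  with local factor \<open>(a + 1) / (p ^ a) powr \<epsilon>\<close>. This can exceed one only for
  the finitely many primes below \<open>2 powr (1 / \<epsilon>)\<close>, and there it is at most
  \<open>K\<close>.\<close>

lemma divisor_bound: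
  assumes "\<epsilon> > 0"
  obtains C where "C \<ge> 1" "\<And>l::nat. l > 0 \<Longrightarrow> real (card {d. d dvd l}) \<le> C * real l powr \<epsilon>"
proof -
  define P where "P = {p::nat. prime p \<and> real p < 2 powr (1 / \<epsilon>)}"
  have finP: "finite P"
    by (rule finite_subset[of _ "{..nat \<lceil>2 powr (1 / \<epsilon>)\<rceil>}"]) (auto simp: P_def, linarith)
  define K where "K = 1 + 2 / \<epsilon>"
  have K: "K \<ge> 1" using assms by (simp add: K_def)
  \<comment> \<open>The exponent counts the small primes that divide \<open>l\<close>, not all of
    \<open>P\<close>: the induction splits off one prime power at a time and has to pay
    \<open>K\<close> just once for each small prime.\<close>
  have main: "real (card {d. d dvd l}) \<le> K ^ card {p\<in>P. p dvd l} * real l powr \<epsilon>" if "l > 0" for l :: nat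
    using that
  proof (induction l rule: less_induct)
    case (less l)
    show ?case
    proof (cases "l = 1")
      case True then show ?thesis using K by simp
    next
      case False
      then obtain p where p: "prime p" "p dvd l" using prime_factor_nat by blast
      define a where "a = multiplicity p l"
      obtain m where m: "l = p ^ a * m" "\<not> p dvd m"
        using multiplicity_decompose'[of l p] p less.prems not_prime_unit[of p] unfolding a_def by blast
      have a: "a > 0"
      proof (rule ccontr)
        assume "\<not> a > 0"
        then have "l = m" using m(1) by simp
        then show False using m(2) p(2) by simp
      qed
      have m0: "m > 0" using m(2) by (intro Nat.gr0I) auto
      have "1 < p ^ a" using one_less_power[OF prime_gt_1_nat[OF p(1)] a] .
      then have "m < l" using m0 m(1) by (metis mult_less_cancel2 mult_1)
      note IH = less.IH[OF this m0]
      have sub: "{q\<in>P. q dvd m} \<subseteq> {q\<in>P. q dvd l} - {p}" unfolding m(1) using m(2) by auto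
      have "real (card {d. d dvd l}) \<le> (real a + 1) * real (card {d. d dvd m})"
        using of_nat_mono[OF card_divisors_prime_power_mult[OF p(1) m0 m(2), of a], where 'a = real] m(1) by (simp add: algebra_simps)
      also have "\<dots> \<le> (real a + 1) * (K ^ card {q\<in>P. q dvd m} * real m powr \<epsilon>)"
        using IH by (intro mult_left_mono) auto
      also have "\<dots> \<le> (K ^ card {q\<in>P. q dvd l} * real l powr \<epsilon>)"
      proof (cases "p \<in> P")
        case True
        have "Suc (card {q\<in>P. q dvd m}) \<le> Suc (card ({q\<in>P. q dvd l} - {p}))"
          using sub finP by (intro Suc_le_mono[THEN iffD2] card_mono) auto
        also have "\<dots> = card {q\<in>P. q dvd l}" using True p finP by (intro card_Suc_Diff1) auto
        finally have c: "K * K ^ card {q\<in>P. q dvd m} \<le> K ^ card {q\<in>P. q dvd l}"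
          using K power_increasing by (metis power_Suc)
        have "(real a + 1) * (K ^ card {q\<in>P. q dvd m} * real m powr \<epsilon>)
           \<le> (K * (real p ^ a) powr \<epsilon>) * (K ^ card {q\<in>P. q dvd m} * real m powr \<epsilon>)"
          using add_one_le_powr[OF assms, of "real p" a] prime_ge_2_nat[OF p(1)] K
          by (intro mult_right_mono) (auto simp: K_def)
        also have "\<dots> = (K * K ^ card {q\<in>P. q dvd m}) * real l powr \<epsilon>"
          unfolding m(1) by (simp add: powr_mult mult_ac)
        also have "\<dots> \<le> K ^ card {q\<in>P. q dvd l} * real l powr \<epsilon>" using c by (intro mult_right_mono) auto
        finally show ?thesis .
      next
        case False
        then have "2 powr (1/\<epsilon>) \<le> real p" using p by (auto simp: P_def)
        then have "(real a + 1) * (K ^ card {q\<in>P. q dvd m} * real m powr \<epsilon>)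
           \<le> (real p ^ a) powr \<epsilon> * (K ^ card {q\<in>P. q dvd l} * real m powr \<epsilon>)"
          using add_one_le_powr_large[OF assms, of "real p" a] sub K finP
          by (intro mult_mono mult_right_mono power_increasing card_mono) auto
        also have "\<dots> = K ^ card {q\<in>P. q dvd l} * real l powr \<epsilon>"
          unfolding m(1) by (simp add: powr_mult mult_ac)
        finally show ?thesis .
      qed
      finally show ?thesis .
    qed
  qed
  show ?thesis
  proof
    show "K ^ card P \<ge> 1" using K by simp
    fix l :: nat assume "l > 0"
    have "K ^ card {p\<in>P. p dvd l} \<le> K ^ card P" using finP K by (intro power_increasing card_mono) auto
    then show "real (card {d. d dvd l}) \<le> K ^ card P * real l powr \<epsilon>"
      using main[OF \<open>l > 0\<close>] by (meson mult_right_mono order_trans powr_ge_zero)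
  qed
qed


text \<open>The range is cut into blocks of length \<open>N\<close>. On a block
  \<open>l * \<tau>\<close> makes a bounded number of turns, so the weights sum to
  \<open>O(N ln N)\<close>, while \<open>1 / l\<close> is \<open>O(1 / (N * (i + 1)))\<close> on
  block \<open>i\<close>; the sum over blocks is harmonic and yields the second logarithm. The
  restriction \<open>l \<ge> c * N\<close> protects the initial block, where \<open>1 / l\<close>
  would be too large.\<close>

lemma sum_wt_divide_le:
  assumes "\<kappa>1 > 0" "\<kappa>2 > 0" "c > 0"
  obtains C where "C > 0"
    "\<And>N X \<tau>. N \<ge> 1 \<Longrightarrow> \<kappa>1 \<le> real N * \<tau> \<Longrightarrow> real N * \<tau> \<le> \<kappa>2 \<Longrightarrow> X \<le> N ^ q \<Longrightarrow>
       (\<Sum>l=1..X. if c * real N \<le> real l then wt N (real l * \<tau>) / real l else 0) \<le> C * (1 + ln (real N)) ^ 2"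
proof -
  define C0 where "C0 = max 1 (1 / \<kappa>1)"
  obtain C1 where C1: "C1 > 0"
    "\<And>N B \<sigma> c Y. N \<ge> 1 \<Longrightarrow> \<sigma> > 0 \<Longrightarrow> real B * \<sigma> \<le> \<kappa>2 \<Longrightarrow> 1 / \<sigma> \<le> C0 * Y \<Longrightarrow> real N \<le> Y \<Longrightarrow> Y \<le> real N ^ 2 \<Longrightarrow>
       (\<Sum>b<B. wt N (c + real b * \<sigma>)) \<le> C1 * Y * (1 + ln (real N))"
    using sum_wt_arith_progression'[of \<kappa>2 C0] assms by (auto simp: C0_def)
  \<comment> \<open>\<open>1 / c\<close> serves block \<open>0\<close>, by the lower restriction on
    \<open>l\<close>; the \<open>2\<close> serves the later blocks, where
    \<open>i + 1 \<le> 2 * i\<close>.\<close>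
  define c' where "c' = max (1 / c) 2"
  have c': "c' > 0" "1 / c \<le> c'" "2 \<le> c'" by (auto simp: c'_def)
  define C2 where "C2 = 1 + ln 2 + real q"
  have C2: "C2 > 0" by (simp add: C2_def add_pos_nonneg)
  show ?thesis
  proof
    show "c' * C1 * C2 > 0" using c' C1 C2 by simp
    fix N X :: nat and \<tau> :: real
    assume h: "N \<ge> 1" "\<kappa>1 \<le> real N * \<tau>" "real N * \<tau> \<le> \<kappa>2" "X \<le> N ^ q"
    define \<Lambda> where "\<Lambda> = 1 + ln (real N)"
    have \<Lambda>: "\<Lambda> \<ge> 1" using h by (simp add: \<Lambda>_def)
    have \<tau>: "\<tau> > 0" using h assms by (smt (verit) mult_nonneg_nonpos of_nat_0_le_iff)
    have N: "real N > 0" using h by simp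
    define g where "g l = (if c * real N \<le> real l then wt N (real l * \<tau>) / real l else 0)" for l :: nat
    have g0: "g l \<ge> 0" for l by (simp add: g_def wt_nonneg)
    have ap: "(\<Sum>b<N. wt N (x + real b * \<tau>)) \<le> C1 * real N * \<Lambda>" for x
    proof -
      have "1 / \<tau> \<le> real N / \<kappa>1" using h(2) \<tau> assms(1) by (simp add: field_simps)
      also have "\<dots> \<le> C0 * real N" using mult_right_mono[of "1/\<kappa>1" C0 "real N"] by (simp add: C0_def)
      finally show ?thesis unfolding \<Lambda>_def using h \<tau> by (intro C1) (auto simp: power2_eq_square)
    qed
    have gb: "g (b + i * N) \<le> c' / (real N * real (i + 1)) * wt N (real (i * N) * \<tau> + real b * \<tau>)" for b i
    proof (cases "c * real N \<le> real (b + i * N)")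
      case True
      define l where "l = b + i * N"
      have l0: "real l > 0" using True N assms(3) unfolding l_def by (smt (verit) mult_pos_pos)
      have "real N * real (i + 1) \<le> c' * real l"
      proof (cases "i = 0")
        case True
        have "real N = 1 / c * (c * real N)" using assms by simp
        also have "\<dots> \<le> c' * real l"
          using \<open>c * real N \<le> real (b + i * N)\<close> c' l0 N assms unfolding l_def by (intro mult_mono) auto
        finally show ?thesis using True by simp
      next
        case False
        have "real N * real (i + 1) \<le> 2 * (real i * real N)" using False N by (simp add: algebra_simps)
        also have "\<dots> \<le> c' * real l" using c' by (intro mult_mono) (auto simp: l_def)
        finally show ?thesis .
      qed
      then have "1 / real l \<le> c' / (real N * real (i + 1))"
        using l0 N by (subst pos_le_divide_eq) (auto simp: pos_divide_le_eq mult.commute)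
      then have "1 / real l * wt N (real l * \<tau>) \<le> c' / (real N * real (i + 1)) * wt N (real l * \<tau>)"
        by (intro mult_right_mono) (auto simp: wt_nonneg)
      moreover have "real l * \<tau> = real (i * N) * \<tau> + real b * \<tau>" by (simp add: l_def algebra_simps)
      ultimately show ?thesis using True by (simp add: g_def l_def)
    next
      case False
      then show ?thesis using c' by (simp add: g_def wt_nonneg)
    qed
    have "(\<Sum>l=1..X. g l) \<le> (\<Sum>l<(X+1)*N. g l)"
    proof (intro sum_mono2)
      have "X < (X+1)*N" using h(1) by (cases N) auto
      then show "{1..X} \<subseteq> {..<(X+1)*N}" by auto
    qed (auto simp: g0)
    also have "\<dots> = (\<Sum>i<X+1. \<Sum>l\<in>{i*N..<i*N+N}. g l)" by (rule sum.nat_group[symmetric])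
    also have "\<dots> = (\<Sum>i<X+1. \<Sum>b<N. g (b + i*N))"
    proof (rule sum.cong[OF refl])
      fix i
      show "(\<Sum>l\<in>{i*N..<i*N+N}. g l) = (\<Sum>b<N. g (b + i*N))"
        by (rule sum.reindex_bij_witness[where i = "\<lambda>b. b + i * N" and j = "\<lambda>l. l - i * N"]) auto
    qed
    also have "\<dots> \<le> (\<Sum>i<X+1. \<Sum>b<N. c' / (real N * real (i + 1)) * wt N (real (i * N) * \<tau> + real b * \<tau>))"
      by (intro sum_mono gb)
    also have "\<dots> \<le> (\<Sum>i<X+1. c' / (real N * real (i + 1)) * (C1 * real N * \<Lambda>))"
      unfolding sum_distrib_left[symmetric] using c' by (intro sum_mono mult_left_mono ap) auto
    also have "\<dots> = (\<Sum>i<X+1. c' * C1 * \<Lambda> * inverse (real (Suc i)))"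
    proof (rule sum.cong[OF refl])
      fix i
      have "c' / (real N * y) * (C1 * real N * \<Lambda>) = c' * C1 * \<Lambda> * inverse y" if "y > 0" for y
        using N that by (simp add: field_simps)
      then show "c' / (real N * real (i + 1)) * (C1 * real N * \<Lambda>) = c' * C1 * \<Lambda> * inverse (real (Suc i))" by simp
    qed
    also have "\<dots> = c' * C1 * \<Lambda> * harm (X+1)"
      by (simp only: harm_altdef sum_distrib_left)
    also have "\<dots> \<le> c' * C1 * \<Lambda> * (C2 * \<Lambda>)"
    proof -
      have "real (X + 1) \<le> 2 * real N ^ q"
      proof -
        have "1 \<le> N ^ q" using h(1) by simp
        then have "X + 1 \<le> 2 * N ^ q" using h(4) by linarith
        then have "real (X + 1) \<le> real (2 * N ^ q)" by (rule of_nat_mono)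
        then show ?thesis by simp
      qed
      from harm_nat_floor_le[OF this, of] h(1) have "harm (X + 1) \<le> C2 * \<Lambda>"
        by (simp add: C2_def \<Lambda>_def nat_add_distrib)
      then show ?thesis using c' C1 \<Lambda> by (intro mult_left_mono) auto
    qed
    also have "\<dots> = c' * C1 * C2 * \<Lambda> ^ 2" by (simp add: power2_eq_square)
    finally show "(\<Sum>l=1..X. if c * real N \<le> real l then wt N (real l * \<tau>) / real l else 0)
       \<le> c' * C1 * C2 * (1 + ln (real N)) ^ 2" by (simp add: g_def \<Lambda>_def)
  qed
qed

text \<open>The summand depends on the product \<open>l = h * k\<close> only, and \<open>l\<close>
  arises from at most as many pairs as it has divisors.\<close>

lemma sum_wt_pairs_le:
  assumes "\<kappa>1 > 0" "\<kappa>2 > 0" "c > 0" "\<epsilon> > 0"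
  obtains C where "C > 0"
    "\<And>N K \<tau>. N \<ge> 1 \<Longrightarrow> \<kappa>1 \<le> real N * \<tau> \<Longrightarrow> real N * \<tau> \<le> \<kappa>2 \<Longrightarrow> K \<le> N ^ q \<Longrightarrow>
       (\<Sum>h=1..N. \<Sum>k=1..K. if c * real N \<le> real (h * k) then wt N (real (h * k) * \<tau>) / real (h * k) else 0)
         \<le> C * real N powr \<epsilon> * (1 + ln (real N)) ^ 2"
proof -
  \<comment> \<open>Products \<open>h * k\<close> are at most \<open>N ^ (q + 1)\<close>, so the
    divisor bound with this exponent costs \<open>N powr \<epsilon>\<close>.\<close>
  define \<delta> where "\<delta> = \<epsilon> / real (q + 1)"
  have \<delta>: "\<delta> > 0" using assms by (simp add: \<delta>_def)
  obtain D where D: "D \<ge> 1" "\<And>l::nat. l > 0 \<Longrightarrow> real (card {d. d dvd l}) \<le> D * real l powr \<delta>"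
    using divisor_bound[OF \<delta>] by blast
  obtain C1 where C1: "C1 > 0"
    "\<And>N X \<tau>. N \<ge> 1 \<Longrightarrow> \<kappa>1 \<le> real N * \<tau> \<Longrightarrow> real N * \<tau> \<le> \<kappa>2 \<Longrightarrow> X \<le> N ^ (q+1) \<Longrightarrow>
       (\<Sum>l=1..X. if c * real N \<le> real l then wt N (real l * \<tau>) / real l else 0) \<le> C1 * (1 + ln (real N)) ^ 2"
    using sum_wt_divide_le[OF assms(1-3), of "q+1"] by blast
  show ?thesis
  proof
    show "D * C1 > 0" using D C1 by simp
    fix N K :: nat and \<tau> :: real
    assume h: "N \<ge> 1" "\<kappa>1 \<le> real N * \<tau>" "real N * \<tau> \<le> \<kappa>2" "K \<le> N ^ q"
    define g where "g l = (if c * real N \<le> real l then wt N (real l * \<tau>) / real l else 0)" for l :: nat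
    have g0: "g l \<ge> 0" for l by (simp add: g_def wt_nonneg)
    define S where "S = {1..N} \<times> {1..K}"
    have NK: "N * K \<le> N ^ (q+1)" using h(4) by simp
    have "(\<Sum>h=1..N. \<Sum>k=1..K. g (h * k)) = (\<Sum>x\<in>S. g (fst x * snd x))"
      by (simp add: S_def sum.cartesian_product case_prod_unfold)
    also have "\<dots> = (\<Sum>l\<in>{1..N*K}. \<Sum>x\<in>{x\<in>S. fst x * snd x = l}. g (fst x * snd x))"
    proof (rule sum.group[symmetric])
      show "(\<lambda>x. fst x * snd x) ` S \<subseteq> {1..N * K}"
        by (auto simp: S_def intro: mult_le_mono)
    qed (auto simp: S_def)
    also have "\<dots> = (\<Sum>l\<in>{1..N*K}. real (card {x\<in>S. fst x * snd x = l}) * g l)"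
      by (intro sum.cong refl) simp
    also have "\<dots> \<le> (\<Sum>l\<in>{1..N*K}. (D * real N powr \<epsilon>) * g l)"
    proof (intro sum_mono mult_right_mono g0)
      fix l assume l: "l \<in> {1..N*K}"
      have "card {x\<in>S. fst x * snd x = l} \<le> card {d. d dvd l}"
      proof (rule card_inj_on_le[where f = fst])
        show "inj_on fst {x\<in>S. fst x * snd x = l}" using l by (auto simp: inj_on_def)
        show "fst ` {x \<in> S. fst x * snd x = l} \<subseteq> {d. d dvd l}" by auto
        show "finite {d. d dvd l}" using l by simp
      qed
      then have "real (card {x\<in>S. fst x * snd x = l}) \<le> D * real l powr \<delta>"
        using D(2)[of l] l by auto
      also have "\<dots> \<le> D * (real N ^ (q+1)) powr \<delta>"
      proof -
        have "l \<le> N ^ (q+1)" using l NK by (meson atLeastAtMost_iff le_trans)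
        then have "real l \<le> real N ^ (q+1)" using of_nat_mono[of l "N^(q+1)", where 'a=real] by simp
        then show ?thesis using D(1) \<delta> by (intro mult_left_mono powr_mono2) auto
      qed
      also have "(real N ^ (q+1)) powr \<delta> = real N powr \<epsilon>"
        using h(1) by (simp add: powr_realpow[symmetric] powr_powr \<delta>_def del: power_Suc)
      finally show "real (card {x\<in>S. fst x * snd x = l}) \<le> D * real N powr \<epsilon>" .
    qed
    also have "\<dots> = (D * real N powr \<epsilon>) * (\<Sum>l\<in>{1..N*K}. g l)" by (simp add: sum_distrib_left)
    also have "\<dots> \<le> (D * real N powr \<epsilon>) * (C1 * (1 + ln (real N)) ^ 2)"
      using C1(2)[OF h(1-3) NK] D(1) by (intro mult_left_mono) (auto simp: g_def)
    finally show "(\<Sum>h=1..N. \<Sum>k=1..K. if c * real N \<le> real (h * k) then wt N (real (h * k) * \<tau>) / real (h * k) else 0)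
         \<le> D * C1 * real N powr \<epsilon> * (1 + ln (real N)) ^ 2" by (simp add: g_def mult_ac)
  qed
qed


section \<open>The average of the Weyl bounds over the frequencies \<open>j / (2 N)\<close>\<close>

lemma nint_dist_eq_abs:
  assumes "\<bar>y\<bar> \<le> 1/2"
  shows "nint_dist (of_int k + y) = \<bar>y\<bar>"
proof (rule antisym)
  show "nint_dist (of_int k + y) \<le> \<bar>y\<bar>" using nint_dist_le[of "of_int k + y" k] by simp
  define m where "m = round (of_int k + y)"
  have "\<bar>y\<bar> \<le> \<bar>of_int k + y - of_int m\<bar>"
  proof (cases "m = k")
    case False
    then have "\<bar>k - m\<bar> \<ge> 1" by linarith
    then have "\<bar>of_int k - of_int m :: real\<bar> \<ge> 1" by (metis of_int_1_le_iff of_int_abs of_int_diff)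
    then show ?thesis using assms by linarith
  qed simp
  then show "\<bar>y\<bar> \<le> nint_dist (of_int k + y)" by (simp add: nint_dist_def m_def)
qed

text \<open>From \<open>1 / (a * b) = (1 / a + 1 / b) / (a + b)\<close>: the hypothesis bounds
  \<open>a + b\<close> from below by a multiple of the distance of \<open>k * t\<close>. In the
  application \<open>k\<close> is an integer nearest to \<open>g\<close>, so the new weight is
  constant while \<open>g\<close> runs over a unit interval, and the two old weights are no longer
  multiplied.\<close>

lemma wt_mult_wt_le:
  assumes "N \<ge> 1" "t \<ge> 0" "nint_dist (k * t) \<le> nint_dist (g * t) + t * nint_dist g"
  shows "wt N g * wt N (g * t) \<le> (1 + t) * wt N (k * t) * (wt N g + wt N (g * t))"
proof -
  define a where "a = max (nint_dist g) (1 / real N)"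
  define b where "b = max (nint_dist (g * t)) (1 / real N)"
  define d where "d = max (nint_dist (k * t)) (1 / real N)"
  have pos: "a > 0" "b > 0" "d > 0" using assms(1) by (auto simp: a_def b_def d_def less_max_iff_disj)
  have "nint_dist (k * t) \<le> b + t * a"
    using assms(3) mult_left_mono[OF _ assms(2), of "nint_dist g" a] unfolding a_def b_def by linarith
  moreover have "b + t * a \<le> (1 + t) * (a + b)" using assms(2) pos by (simp add: algebra_simps)
  moreover have "1 / real N \<le> b" by (simp add: b_def)
  moreover have "b \<le> b + t * a" using pos assms(2) by simp
  ultimately have "d \<le> (1 + t) * (a + b)" by (simp add: d_def)
  then have "1 \<le> (1 + t) * (a + b) / d" using pos by simp
  then have "1 * (1 / (a * b)) \<le> (1 + t) * (a + b) / d * (1 / (a * b))"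
    using pos by (intro mult_right_mono) auto
  then have "1 / (a * b) \<le> (1 + t) * (a + b) / d * (1 / (a * b))" by simp
  also have "\<dots> = (1 + t) * (1 / d) * (1 / a + 1 / b)" using pos by (simp add: field_simps)
  finally show ?thesis by (simp add: wt_def a_def b_def d_def)
qed

lemma one_plus_ln_le_powr:
  assumes "\<delta> > 0" "N \<ge> (1::nat)"
  shows "1 + ln (real N) \<le> (1 + 1 / \<delta>) * real N powr \<delta>"
proof -
  have "1 \<le> real N powr \<delta>" using assms by (simp add: ge_one_powr_ge_zero)
  then show ?thesis using ln_powr_bound[of "real N" \<delta>] assms by (simp add: algebra_simps)
qed

text \<open>The weights are bounds for the Fourier coefficients of the truncated sawtooth. Write
  \<open>j / (2 N) = k + \<theta>\<close> with \<open>k\<close> the nearest integer. If \<open>h k \<tau>\<close> is not small, the product of the distances of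
  \<open>j / (2 N)\<close> and \<open>h j \<tau> / (2 N)\<close> to the integers is controlled by the distance of \<open>h k \<tau>\<close>, after which the sum
  over \<open>\<theta>\<close> is a sum over an arithmetic progression and \<open>h k\<close> is collected with the divisor bound.\<close>

lemma weighted_weyl_sum_log:
  assumes "\<kappa>1 > 0" "\<kappa>2 > 0" "\<epsilon> > 0"
  obtains C where "C > 0"
    "\<And>N \<tau>. N \<ge> 1 \<Longrightarrow> \<kappa>1 \<le> real N * \<tau> \<Longrightarrow> real N * \<tau> \<le> \<kappa>2 \<Longrightarrow>
       (\<Sum>j=1..N^q. wt N (real j / real (2*N)) * min (real j / real (2*N)) (real (2*N) / real j) / real N
          * (real N + 2 * (\<Sum>h=1..N. wt N (real h * (real j / real (2*N)) * \<tau>))))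
         \<le> C * real N * real N powr \<epsilon> * (1 + ln (real N)) ^ 3"
proof -
  \<comment> \<open>Serves two progressions: step \<open>1 / (2 N)\<close> with \<open>Y = N\<close>
    needs the \<open>2\<close>, and step \<open>h * \<tau> / (2 N)\<close> with
    \<open>Y = N^2 / h\<close> needs \<open>2 / \<kappa>1\<close>.\<close>
  define C0 where "C0 = max 2 (2 / \<kappa>1)"
  define \<kappa> where "\<kappa> = max 1 \<kappa>2"
  \<comment> \<open>If \<open>h * k * \<tau> > 1/4\<close>, then
    \<open>N * \<tau> \<le> \<kappa>2\<close> forces \<open>h * k \<ge> c * N\<close>.\<close>
  define c where "c = 1 / (4 * \<kappa>2)"
  have c: "c > 0" using assms by (simp add: c_def)
  obtain C1 where C1: "C1 > 0"
    "\<And>N B \<sigma> c Y. N \<ge> 1 \<Longrightarrow> \<sigma> > 0 \<Longrightarrow> real B * \<sigma> \<le> \<kappa> \<Longrightarrow> 1 / \<sigma> \<le> C0 * Y \<Longrightarrow> real N \<le> Y \<Longrightarrow> Y \<le> real N ^ 2 \<Longrightarrow>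
       (\<Sum>b<B. wt N (c + real b * \<sigma>)) \<le> C1 * Y * (1 + ln (real N))"
  proof -
    have "\<kappa> \<ge> 0" "C0 \<ge> 1" by (auto simp: C0_def \<kappa>_def)
    then show ?thesis using sum_wt_arith_progression'[of \<kappa> C0] that by blast
  qed
  obtain C5 where C5: "C5 > 0"
    "\<And>N K \<tau>. N \<ge> 1 \<Longrightarrow> \<kappa>1 \<le> real N * \<tau> \<Longrightarrow> real N * \<tau> \<le> \<kappa>2 \<Longrightarrow> K \<le> N ^ q \<Longrightarrow>
       (\<Sum>h=1..N. \<Sum>k=1..K. if c * real N \<le> real (h * k) then wt N (real (h * k) * \<tau>) / real (h * k) else 0)
         \<le> C5 * real N powr \<epsilon> * (1 + ln (real N)) ^ 2"
    using sum_wt_pairs_le[OF assms(1,2) c assms(3), of q] by blast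
  define C4 where "C4 = 2 * C1 / \<kappa>1 + 2 * (1 + \<kappa>2) * C1"
  have C4: "C4 > 0" "2 * C1 / \<kappa>1 \<le> C4" "2 * (1 + \<kappa>2) * C1 \<le> C4" using C1 assms by (auto simp: C4_def add_pos_pos)
  define Q where "Q = 1 + real q"
  have Q: "Q \<ge> 1" by (simp add: Q_def)
  define C where "C = 1 + 2 * C1 + 2 * C1 * Q + 4 * C4 * (Q + C5)"
  show ?thesis
  proof
    show "C > 0" unfolding C_def using C1 C4 C5 Q by (intro add_pos_pos mult_pos_pos) auto
    fix N :: nat and \<tau> :: real
    assume h: "N \<ge> 1" "\<kappa>1 \<le> real N * \<tau>" "real N * \<tau> \<le> \<kappa>2"
    define \<Lambda> where "\<Lambda> = 1 + ln (real N)"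
    have \<Lambda>: "\<Lambda> \<ge> 1" using h by (simp add: \<Lambda>_def)
    have \<tau>: "\<tau> > 0" using h assms by (smt (verit) mult_nonneg_nonpos of_nat_0_le_iff)
    have N: "real N > 0" "real N \<ge> 1" using h by auto
    define K where "K = N ^ q"
    define \<gamma> where "\<gamma> j = real j / real (2*N)" for j :: nat
    define u where "u j = wt N (\<gamma> j) * min (\<gamma> j) (1 / \<gamma> j) / real N" for j
    define T where "T j = (\<Sum>h=1..N. wt N (real h * \<gamma> j * \<tau>))" for j
    define f where "f j = u j * (real N + 2 * T j)" for j
    have T0: "T j \<ge> 0" for j by (simp add: T_def sum_nonneg wt_nonneg)
    have \<gamma>0: "\<gamma> j \<ge> 0" for j by (simp add: \<gamma>_def)
    have u0: "u j \<ge> 0" for j by (simp add: u_def wt_nonneg \<gamma>0)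
    have f0: "f j \<ge> 0" for j by (simp add: f_def u0 T0)
    have harmN: "harm N \<le> \<Lambda>" using harm_le_one_plus_ln[of N] h by (simp add: \<Lambda>_def)
    have harmK: "harm K \<le> Q * \<Lambda>"
    proof -
      have "real K \<le> 1 * real N ^ q" by (simp add: K_def)
      from harm_nat_floor_le[OF this] h(1) show ?thesis by (simp add: Q_def \<Lambda>_def)
    qed
    have harm1: "(\<Sum>h=1..n. a / real h) = a * harm n" for a :: real and n
      by (simp add: harm_def sum_distrib_left divide_inverse)
    have ap_h: "(\<Sum>b<B. wt N (x + real b * (real h * \<tau> / real (2*N)))) \<le> C1 * (real N ^ 2 / real h) * \<Lambda>"
      if "h \<in> {1..N}" "B \<le> 2 * N" for h x B
      unfolding \<Lambda>_def
    proof (rule C1(2)[OF h(1)])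
      have hh: "real h \<ge> 1" "real h \<le> real N" using that by auto
      show "real h * \<tau> / real (2*N) > 0" using hh \<tau> N by simp
      have "real B * (real h * \<tau> / real (2*N)) \<le> real (2*N) * (real N * \<tau> / real (2*N))"
        using that hh \<tau> N by (intro mult_mono divide_right_mono) auto
      also have "\<dots> = real N * \<tau>" using N by simp
      finally show "real B * (real h * \<tau> / real (2*N)) \<le> \<kappa>" using h by (simp add: \<kappa>_def)
      have "1 / \<tau> \<le> real N / \<kappa>1" using h(2) \<tau> assms(1) by (simp add: field_simps)
      then have "(1 / \<tau>) * (real (2*N) / real h) \<le> (real N / \<kappa>1) * (real (2*N) / real h)"
        by (intro mult_right_mono) auto
      also have "\<dots> = 2 / \<kappa>1 * (real N ^ 2 / real h)" by (simp add: power2_eq_square)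
      also have "\<dots> \<le> C0 * (real N ^ 2 / real h)" by (intro mult_right_mono) (auto simp: C0_def)
      finally show "1 / (real h * \<tau> / real (2*N)) \<le> C0 * (real N ^ 2 / real h)" by (simp add: mult.commute)
      show "real N \<le> real N ^ 2 / real h" using hh by (simp add: field_simps power2_eq_square mult_left_mono)
      show "real N ^ 2 / real h \<le> real N ^ 2" using hh by (simp add: field_simps mult_left_mono[of 1])
    qed
    have ap_1: "(\<Sum>b<2*N. wt N (x + real b * (1 / real (2*N)))) \<le> C1 * real N * \<Lambda>" for x
      unfolding \<Lambda>_def
    proof (rule C1(2)[OF h(1)])
      show "1 / (1 / real (2*N)) \<le> C0 * real N" by (simp add: C0_def mult_right_mono)
      show "real N \<le> (real N)\<^sup>2" using N by (simp add: power2_eq_square)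
    qed (use N in \<open>auto simp: \<kappa>_def\<close>)
    \<comment> \<open>Frequencies below \<open>1/2\<close>: the nearest integer is \<open>0\<close>
      and offers no multiple of \<open>\<tau>\<close> to exploit, but the factors \<open>wt\<close>
      and \<open>min\<close> multiply to at most one.\<close>
    have low: "(\<Sum>j=1..<N. f j) \<le> real N + 2 * C1 * real N * \<Lambda> ^ 2"
    proof -
      have "f j \<le> 1 / real N * (real N + 2 * T j)" if "j \<in> {1..<N}" for j
      proof -
        have g: "0 < \<gamma> j" "\<gamma> j \<le> 1/2" using that N by (auto simp: \<gamma>_def field_simps)
        then have "wt N (\<gamma> j) \<le> 1 / \<gamma> j" using nint_dist_eq_abs[of "\<gamma> j" 0] by (intro wt_le_inverse) auto
        then have "wt N (\<gamma> j) * min (\<gamma> j) (1 / \<gamma> j) \<le> (1 / \<gamma> j) * \<gamma> j"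
          using g by (intro mult_mono) auto
        then have "u j \<le> 1 / real N" using g N unfolding u_def by (intro divide_right_mono) auto
        then show ?thesis unfolding f_def using T0 by (intro mult_right_mono) auto
      qed
      then have "(\<Sum>j=1..<N. f j) \<le> (\<Sum>j=1..<N. 1 / real N * (real N + 2 * T j))" by (intro sum_mono) auto
      also have "\<dots> \<le> (\<Sum>j<N. 1 / real N * (real N + 2 * T j))"
        using T0 by (intro sum_mono2) auto
      also have "\<dots> = real N + 2 / real N * (\<Sum>j<N. T j)"
        using N by (simp add: sum.distrib sum_distrib_left algebra_simps sum_divide_distrib)
      also have "\<dots> \<le> real N + 2 / real N * (C1 * real N ^ 2 * \<Lambda> * \<Lambda>)"
      proof -
        have "(\<Sum>j<N. T j) = (\<Sum>h=1..N. \<Sum>j<N. wt N (0 + real j * (real h * \<tau> / real (2*N))))"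
          unfolding T_def \<gamma>_def by (subst sum.swap) (simp add: field_simps)
        also have "\<dots> \<le> (\<Sum>h=1..N. C1 * (real N ^ 2 / real h) * \<Lambda>)"
          by (intro sum_mono ap_h) auto
        also have "\<dots> = C1 * real N ^ 2 * \<Lambda> * harm N"
          unfolding harm1[symmetric] by (simp add: mult_ac)
        also have "\<dots> \<le> C1 * real N ^ 2 * \<Lambda> * \<Lambda>" using harmN C1 \<Lambda> by (intro mult_left_mono) auto
        finally show ?thesis by (intro add_left_mono mult_left_mono) auto
      qed
      also have "\<dots> = real N + 2 * C1 * real N * \<Lambda> ^ 2"
        using N by (simp add: power2_eq_square)
      finally show ?thesis .
    qed
    \<comment> \<open>The \<open>2 * N\<close> frequencies starting at
      \<open>j = (2 * i + 1) * N\<close> are those with \<open>\<gamma>\<close> in the unit interval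
      centred at the integer \<open>i + 1\<close>.\<close>
    have Z: "(\<Sum>b<2*N. wt N (\<gamma> (b + (2*i+1)*N)) * wt N (real h * \<gamma> (b + (2*i+1)*N) * \<tau>))
       \<le> C4 * (real N ^ 2 / real h) * \<Lambda> * (1 + (if c * real N \<le> real (h * (i+1)) then wt N (real (h * (i+1)) * \<tau>) else 0))"
      if hN: "h \<in> {1..N}" for h i
    proof -
      define k where "k = real (i + 1)"
      have k: "k \<ge> 1" by (simp add: k_def)
      define g where "g b = \<gamma> (b + (2*i+1)*N)" for b
      have g_eq: "g b = (k - 1/2) + real b * (1 / real (2*N))" for b
        using N by (simp add: g_def \<gamma>_def k_def field_simps)
      have g_eq2: "real h * g b * \<tau> = real h * (k - 1/2) * \<tau> + real b * (real h * \<tau> / real (2*N))" for b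
        unfolding g_eq by (simp add: field_simps)
      have hh: "real h \<ge> 1" "real h \<le> real N" using hN by auto
      have gk: "\<bar>g b - k\<bar> \<le> 1/2" if "b < 2 * N" for b
      proof -
        have "real b * (1 / real (2*N)) \<le> 1" using that N by (simp add: field_simps)
        moreover have "real b * (1 / real (2*N)) \<ge> 0" by simp
        ultimately show ?thesis unfolding g_eq by linarith
      qed
      have hk: "real (h * (i+1)) = real h * k" by (simp add: k_def algebra_simps)
      have htk: "real h * \<tau> \<le> \<kappa>2" using hh h(3) \<tau> by (smt (verit) mult_right_mono)
      have sg: "(\<Sum>b<2*N. wt N (g b)) \<le> C1 * real N * \<Lambda>" unfolding g_eq by (rule ap_1)
      show ?thesis
      proof (cases "real h * k * \<tau> \<le> 1/4")
        case True
        \<comment> \<open>Here \<open>h * g * \<tau>\<close> stays in \<open>[0, 1/2]\<close>, so it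
          equals its own distance to the integers and is at least \<open>h * \<tau> / 2\<close>. The
          second weight is then bounded uniformly on the block.\<close>
        have "wt N (real h * g b * \<tau>) \<le> 2 * real N / (\<kappa>1 * real h)" if b: "b < 2*N" for b
        proof -
          have gb: "k / 2 \<le> g b" "g b \<le> 3 / 2 * k" using gk[OF b] k by linarith+
          have t: "0 < real h * \<tau>" using hh \<tau> by simp
          have "real h * g b * \<tau> = real h * \<tau> * g b" by simp
          also have "\<dots> \<le> real h * \<tau> * (3 / 2 * k)" using gb t by (intro mult_left_mono) auto
          also have "\<dots> \<le> 1/2" using True by (simp add: mult_ac)
          finally have le: "real h * g b * \<tau> \<le> 1/2" .
          have ge: "real h * \<tau> * (1 / 2) \<le> real h * g b * \<tau>"
            using mult_left_mono[of "1/2" "g b" "real h * \<tau>"] gb k t by (simp add: mult_ac)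
          then have "nint_dist (real h * g b * \<tau>) = real h * g b * \<tau>"
            using nint_dist_eq_abs[of "real h * g b * \<tau>" 0] le t by simp
          then have "wt N (real h * g b * \<tau>) \<le> 1 / (real h * \<tau> * (1/2))"
            using ge t by (intro wt_le_inverse) auto
          also have "\<dots> = 2 / real h * (1 / \<tau>)" by simp
          also have "\<dots> \<le> 2 / real h * (real N / \<kappa>1)"
            using h(2) \<tau> assms(1) by (intro mult_left_mono) (auto simp: field_simps)
          finally show ?thesis by (simp add: mult_ac)
        qed
        then have "(\<Sum>b<2*N. wt N (g b) * wt N (real h * g b * \<tau>)) \<le> (\<Sum>b<2*N. wt N (g b) * (2 * real N / (\<kappa>1 * real h)))"
          by (intro sum_mono mult_left_mono) (auto simp: wt_nonneg)
        also have "\<dots> = (\<Sum>b<2*N. wt N (g b)) * (2 * real N / (\<kappa>1 * real h))" by (simp only: sum_distrib_right)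
        also have "\<dots> \<le> C1 * real N * \<Lambda> * (2 * real N / (\<kappa>1 * real h))"
          using sg assms by (intro mult_right_mono) auto
        also have "\<dots> = 2 * C1 / \<kappa>1 * (real N ^ 2 / real h * \<Lambda>)" by (simp add: power2_eq_square mult_ac)
        also have "\<dots> \<le> C4 * (real N ^ 2 / real h * \<Lambda>)" using C4 \<Lambda> by (intro mult_right_mono) auto
        also have "\<dots> \<le> C4 * (real N ^ 2 / real h * \<Lambda>) * (1 + (if c * real N \<le> real (h * (i+1)) then wt N (real (h * (i+1)) * \<tau>) else 0))"
        proof -
          have aux: "a \<le> a * (1 + b)" if "a \<ge> 0" "b \<ge> 0" for a b :: real
            using that mult_left_mono[of 1 "1 + b" a] by simp
          show ?thesis by (rule aux) (use C4 \<Lambda> in \<open>auto simp: wt_nonneg\<close>)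
        qed
        finally show ?thesis by (simp add: g_def mult.assoc)
      next
        case False
        have "c * real N \<le> real h * k"
        proof -
          have "1/4 * real N \<le> (real h * k) * (real N * \<tau>)" using False N by simp
          also have "\<dots> \<le> (real h * k) * \<kappa>2" using h(3) hh k by (intro mult_left_mono) auto
          finally show ?thesis using assms by (simp add: c_def field_simps)
        qed
        then have cN: "c * real N \<le> real (h * (i+1))" by (simp only: hk)
        define W where "W = wt N (real (h * (i+1)) * \<tau>)"
        have W0: "W \<ge> 0" by (simp add: W_def wt_nonneg)
        \<comment> \<open>The factor \<open>W\<close> depends on \<open>h\<close> and the block
          only. What is left is a sum of two weights, each taken over an arithmetic
          progression.\<close>
        have "wt N (g b) * wt N (real h * g b * \<tau>) \<le> (1 + \<kappa>2) * W * (wt N (g b) + wt N (real h * g b * \<tau>))"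
          if b: "b < 2 * N" for b
        proof -
          have t: "0 \<le> real h * \<tau>" using hh \<tau> by simp
          have "nint_dist (g b) = \<bar>g b - k\<bar>"
            using nint_dist_eq_abs[of "g b - k" "int (i+1)"] gk[OF b] by (simp add: k_def)
          then have "nint_dist (g b) * (real h * \<tau>) = \<bar>k - g b\<bar> * \<bar>real h * \<tau>\<bar>"
            using t by (simp only: abs_minus_commute abs_of_nonneg)
          then have "real h * \<tau> * nint_dist (g b) = \<bar>k * (real h * \<tau>) - g b * (real h * \<tau>)\<bar>"
            by (simp only: abs_mult[symmetric] left_diff_distrib mult.commute)
          then have "nint_dist (k * (real h * \<tau>)) \<le> nint_dist (g b * (real h * \<tau>)) + real h * \<tau> * nint_dist (g b)"
            using nint_dist_triangle[of "g b * (real h * \<tau>)" "k * (real h * \<tau>) - g b * (real h * \<tau>)"] by simp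
          have e: "real (h * (i+1)) * \<tau> = k * (real h * \<tau>)" "real h * g b * \<tau> = g b * (real h * \<tau>)"
            by (simp_all only: hk mult_ac)
          from wt_mult_wt_le[OF h(1) t \<open>nint_dist (k * (real h * \<tau>)) \<le> _\<close>]
          have "wt N (g b) * wt N (real h * g b * \<tau>) \<le> (1 + real h * \<tau>) * W * (wt N (g b) + wt N (real h * g b * \<tau>))"
            unfolding W_def e .
          also have "\<dots> \<le> (1 + \<kappa>2) * W * (wt N (g b) + wt N (real h * g b * \<tau>))"
            using htk W0 by (intro mult_right_mono) (auto simp: wt_nonneg add_nonneg_nonneg)
          finally show ?thesis .
        qed
        then have "(\<Sum>b<2*N. wt N (g b) * wt N (real h * g b * \<tau>)) \<le> (\<Sum>b<2*N. (1 + \<kappa>2) * W * (wt N (g b) + wt N (real h * g b * \<tau>)))"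
          by (intro sum_mono) auto
        also have "\<dots> = (1 + \<kappa>2) * W * ((\<Sum>b<2*N. wt N (g b)) + (\<Sum>b<2*N. wt N (real h * g b * \<tau>)))"
          by (simp only: sum_distrib_left[symmetric] sum.distrib)
        also have "\<dots> \<le> (1 + \<kappa>2) * W * (C1 * (real N ^ 2 / real h) * \<Lambda> + C1 * (real N ^ 2 / real h) * \<Lambda>)"
        proof (intro mult_left_mono add_mono)
          have "real N \<le> real N ^ 2 / real h" using hh by (simp add: field_simps power2_eq_square mult_left_mono)
          then have "C1 * real N * \<Lambda> \<le> C1 * (real N ^ 2 / real h) * \<Lambda>" using C1 \<Lambda> by (intro mult_right_mono mult_left_mono) auto
          then show "(\<Sum>b<2*N. wt N (g b)) \<le> C1 * (real N ^ 2 / real h) * \<Lambda>" using sg by linarith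
          show "(\<Sum>b<2*N. wt N (real h * g b * \<tau>)) \<le> C1 * (real N ^ 2 / real h) * \<Lambda>"
            unfolding g_eq2 using hN by (intro ap_h) auto
        qed (use assms W0 in auto)
        also have "\<dots> = (2 * (1 + \<kappa>2) * C1) * (real N ^ 2 / real h * \<Lambda> * W)" by (simp add: algebra_simps)
        also have "\<dots> \<le> C4 * (real N ^ 2 / real h * \<Lambda> * W)" using C4 \<Lambda> W0 by (intro mult_right_mono) auto
        also have "\<dots> \<le> C4 * (real N ^ 2 / real h * \<Lambda> * (1 + W))" using C4 \<Lambda> by (intro mult_left_mono) auto
        finally show ?thesis using cN by (simp add: g_def W_def mult.assoc)
      qed
    qed
    have high: "(\<Sum>i<K. \<Sum>b<2*N. f (b + (2*i+1)*N)) \<le> 2 * C1 * Q * real N * \<Lambda> ^ 2 + 4 * C4 * real N * \<Lambda> * (Q * \<Lambda>^2 + C5 * real N powr \<epsilon> * \<Lambda> ^ 2)"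
    proof -
      define F where "F l = (if c * real N \<le> real l then wt N (real l * \<tau>) / real l else 0)" for l :: nat
      have inner: "(\<Sum>b<2*N. f (b + (2*i+1)*N)) \<le> 2 * C1 * real N * \<Lambda> / real (i+1) +
          4 * C4 * real N * \<Lambda> * (\<Sum>h=1..N. 1 / (real h * real (i+1)) + F (h * (i+1)))" for i
      proof -
        define k where "k = real (i + 1)"
        have k: "k \<ge> 1" by (simp add: k_def)
        define g where "g b = \<gamma> (b + (2*i+1)*N)" for b
        have g_eq: "g b = (k - 1/2) + real b * (1 / real (2*N))" for b
          using N by (simp add: g_def \<gamma>_def k_def field_simps)
        have gb: "g b \<ge> k / 2" for b
        proof -
          have "real b * (1 / real (2*N)) \<ge> 0" by simp
          then show ?thesis unfolding g_eq using k by linarith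
        qed
        have sg: "(\<Sum>b<2*N. wt N (g b)) \<le> C1 * real N * \<Lambda>" unfolding g_eq by (rule ap_1)
        have ub: "u (b + (2*i+1)*N) \<le> 2 / (k * real N) * wt N (g b)" for b
        proof -
          \<comment> \<open>The decay of the coefficients supplies \<open>1 / k\<close>; together
            with the \<open>1 / h\<close> from the block estimate it gives the denominators
            \<open>h * k\<close> of the divisor sum.\<close>
          have "min (g b) (1 / g b) \<le> 2 / k"
            using frac_le[of 1 1 "k/2" "g b"] gb[of b] k by (simp add: min.coboundedI2)
          then have "wt N (g b) * min (g b) (1 / g b) / real N \<le> wt N (g b) * (2 / k) / real N"
            by (intro divide_right_mono mult_left_mono) (auto simp: wt_nonneg)
          then show ?thesis by (simp add: u_def g_def mult_ac)
        qed
        have "(\<Sum>b<2*N. f (b + (2*i+1)*N)) \<le> (\<Sum>b<2*N. 2 / (k * real N) * wt N (g b) * (real N + 2 * (\<Sum>h=1..N. wt N (real h * g b * \<tau>))))"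
          unfolding f_def using ub T0 by (intro sum_mono mult_mono) (auto simp: T_def g_def wt_nonneg k_def)
        also have "\<dots> = 2 / k * (\<Sum>b<2*N. wt N (g b)) + 4 / (k * real N) * (\<Sum>b<2*N. \<Sum>h=1..N. wt N (g b) * wt N (real h * g b * \<tau>))"
          using N by (simp add: sum.distrib sum_distrib_left distrib_left mult_ac)
        also have "(\<Sum>b<2*N. \<Sum>h=1..N. wt N (g b) * wt N (real h * g b * \<tau>)) = (\<Sum>h=1..N. \<Sum>b<2*N. wt N (g b) * wt N (real h * g b * \<tau>))"
          by (rule sum.swap)
        also have "2 / k * (\<Sum>b<2*N. wt N (g b)) + 4 / (k * real N) * \<dots> \<le> 2 / k * (C1 * real N * \<Lambda>) +
          4 / (k * real N) * (\<Sum>h=1..N. C4 * (real N ^ 2 / real h) * \<Lambda> * (1 + (if c * real N \<le> real (h * (i+1)) then wt N (real (h * (i+1)) * \<tau>) else 0)))"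
          using sg Z k N unfolding g_def by (intro add_mono mult_left_mono sum_mono) auto
        also have "(\<Sum>h=1..N. C4 * (real N ^ 2 / real h) * \<Lambda> * (1 + (if c * real N \<le> real (h * (i+1)) then wt N (real (h * (i+1)) * \<tau>) else 0)))
           = (\<Sum>h=1..N. (C4 * real N ^ 2 * \<Lambda> * k) * (1 / (real h * real (i+1)) + F (h * (i+1))))"
        proof (rule sum.cong[OF refl])
          fix h assume "h \<in> {1..N}"
          then have x: "real h > 0" by simp
          have hk: "real (h * (i+1)) = real h * k" by (simp only: k_def of_nat_mult)
          have aux: "C4 * (real N ^ 2 / x) * \<Lambda> * (1 + w) = (C4 * real N ^ 2 * \<Lambda> * k) * (1 / (x * k) + w / (x * k))"
            if "x > 0" for x w
            using that k by (simp add: field_simps)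
          have F: "F (h * (i+1)) = (if c * real N \<le> real h * k then wt N (real h * k * \<tau>) else 0) / (real h * k)"
            by (simp only: F_def hk if_distrib[of "\<lambda>z. z / (real h * k)"] div_0)
          show "C4 * (real N ^ 2 / real h) * \<Lambda> * (1 + (if c * real N \<le> real (h * (i+1)) then wt N (real (h * (i+1)) * \<tau>) else 0))
             = (C4 * real N ^ 2 * \<Lambda> * k) * (1 / (real h * real (i+1)) + F (h * (i+1)))"
            unfolding F k_def[symmetric] hk by (rule aux[OF x])
        qed
        also have "\<dots> = (C4 * real N ^ 2 * \<Lambda> * k) * (\<Sum>h=1..N. (1 / (real h * real (i+1)) + F (h * (i+1))))"
          by (simp only: sum_distrib_left)
        also have "2 / k * (C1 * real N * \<Lambda>) + 4 / (k * real N) * \<dots> = 2 * C1 * real N * \<Lambda> / real (i+1) +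
          4 * C4 * real N * \<Lambda> * (\<Sum>h=1..N. 1 / (real h * real (i+1)) + F (h * (i+1)))"
          unfolding k_def[symmetric] using N k by (simp add: power2_eq_square)
        finally show ?thesis .
      qed
      have "(\<Sum>i<K. \<Sum>b<2*N. f (b + (2*i+1)*N)) \<le> (\<Sum>i<K. 2 * C1 * real N * \<Lambda> / real (i+1) +
          4 * C4 * real N * \<Lambda> * (\<Sum>h=1..N. 1 / (real h * real (i+1)) + F (h * (i+1))))"
        by (intro sum_mono inner)
      also have "\<dots> = (\<Sum>k=1..K. 2 * C1 * real N * \<Lambda> / real k +
          4 * C4 * real N * \<Lambda> * (\<Sum>h=1..N. 1 / (real h * real k) + F (h * k)))"
        by (rule sum.reindex_bij_witness[where i = "\<lambda>k. k - 1" and j = "\<lambda>i. i + 1"]) auto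
      also have "\<dots> = 2 * C1 * real N * \<Lambda> * harm K + 4 * C4 * real N * \<Lambda> *
           ((\<Sum>k=1..K. \<Sum>h=1..N. 1 / (real h * real k)) + (\<Sum>k=1..K. \<Sum>h=1..N. F (h * k)))"
        unfolding sum.distrib harm1 sum_distrib_left[symmetric] by simp
      also have "(\<Sum>k=1..K. \<Sum>h=1..N. 1 / (real h * real k)) = harm N * harm K"
        by (subst mult.commute) (simp add: harm_def sum_product divide_inverse mult.commute)
      also have "(\<Sum>k=1..K. \<Sum>h=1..N. F (h * k)) = (\<Sum>h=1..N. \<Sum>k=1..K. F (h * k))" by (rule sum.swap)
      also have "2 * C1 * real N * \<Lambda> * harm K + 4 * C4 * real N * \<Lambda> * (harm N * harm K + \<dots>)
         \<le> 2 * C1 * real N * \<Lambda> * (Q * \<Lambda>) + 4 * C4 * real N * \<Lambda> * (\<Lambda> * (Q * \<Lambda>) + C5 * real N powr \<epsilon> * \<Lambda> ^ 2)"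
      proof (intro add_mono mult_left_mono)
        show "harm N * harm K \<le> \<Lambda> * (Q * \<Lambda>)" using harmN harmK \<Lambda> by (intro mult_mono) (auto simp: harm_nonneg)
        show "(\<Sum>h=1..N. \<Sum>k=1..K. F (h * k)) \<le> C5 * real N powr \<epsilon> * \<Lambda> ^ 2"
          unfolding F_def \<Lambda>_def by (intro C5 h) (simp add: K_def)
      qed (use harmK C1 C4 \<Lambda> in auto)
      finally show ?thesis by (simp add: power2_eq_square mult_ac)
    qed
    have "(\<Sum>j=1..N^q. f j) \<le> (\<Sum>j\<in>{1..<N} \<union> {N..<K*(2*N)+N}. f j)"
    proof (intro sum_mono2)
      \<comment> \<open>\<open>K\<close> blocks reach far beyond the last frequency; this does no
        harm, as all terms are nonnegative.\<close>
      have "K \<le> K * (2*N)" using h(1) by simp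
      then have "K < K * (2*N) + N" using h(1) by linarith
      then show "{1..N^q} \<subseteq> {1..<N} \<union> {N..<K*(2*N)+N}" unfolding K_def[symmetric] by fastforce
    qed (auto simp: f0)
    also have "\<dots> = (\<Sum>j=1..<N. f j) + (\<Sum>j=N..<K*(2*N)+N. f j)"
      by (intro sum.union_disjoint) auto
    also have "(\<Sum>j=N..<K*(2*N)+N. f j) = (\<Sum>l<K*(2*N). f (l + N))"
      by (rule sum.reindex_bij_witness[where i = "\<lambda>l. l + N" and j = "\<lambda>l. l - N"]) auto
    also have "\<dots> = (\<Sum>i<K. \<Sum>l\<in>{i*(2*N)..<i*(2*N)+2*N}. f (l + N))" by (rule sum.nat_group[symmetric])
    also have "\<dots> = (\<Sum>i<K. \<Sum>b<2*N. f (b + (2*i+1)*N))"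
    proof (rule sum.cong[OF refl])
      fix i
      show "(\<Sum>l\<in>{i*(2*N)..<i*(2*N)+2*N}. f (l + N)) = (\<Sum>b<2*N. f (b + (2*i+1)*N))"
        by (rule sum.reindex_bij_witness[where i = "\<lambda>b. b + i*(2*N)" and j = "\<lambda>l. l - i*(2*N)"])
           (auto simp: algebra_simps)
    qed
    finally have "(\<Sum>j=1..N^q. f j) \<le> real N + 2 * C1 * real N * \<Lambda> ^ 2 + (2 * C1 * Q * real N * \<Lambda> ^ 2 + 4 * C4 * real N * \<Lambda> * (Q * \<Lambda>^2 + C5 * real N powr \<epsilon> * \<Lambda> ^ 2))"
      using low high by linarith
    also have "\<dots> \<le> C * (real N * real N powr \<epsilon> * \<Lambda> ^ 3)"
    proof -
      define M where "M = real N * real N powr \<epsilon> * \<Lambda> ^ 3"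
      have p: "real N powr \<epsilon> \<ge> 1" using N assms by (simp add: ge_one_powr_ge_zero)
      have m1: "real N \<le> M"
        unfolding M_def using mult_mono[OF p one_le_power[OF \<Lambda>, of 3]] N p \<Lambda> mult_left_mono[of 1 "real N powr \<epsilon> * \<Lambda> ^ 3" "real N"] by (simp add: mult.assoc)
      have l23: "\<Lambda> ^ 2 \<le> \<Lambda> ^ 3" using \<Lambda> by (intro power_increasing) auto
      have m3: "real N * \<Lambda> ^ 3 \<le> M"
        unfolding M_def using mult_left_mono[OF p, of "real N * \<Lambda> ^ 3"] N \<Lambda> by (simp add: mult_ac)
      have m2: "real N * \<Lambda> ^ 2 \<le> M" using m3 mult_left_mono[OF l23, of "real N"] N by linarith
      have "real N + 2 * C1 * real N * \<Lambda> ^ 2 + (2 * C1 * Q * real N * \<Lambda> ^ 2 + 4 * C4 * real N * \<Lambda> * (Q * \<Lambda>^2 + C5 * real N powr \<epsilon> * \<Lambda> ^ 2))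
         = real N + 2 * C1 * (real N * \<Lambda> ^ 2) + 2 * C1 * Q * (real N * \<Lambda> ^ 2) + 4 * C4 * Q * (real N * \<Lambda> ^ 3) + 4 * C4 * C5 * M"
        by (simp add: M_def algebra_simps power2_eq_square power3_eq_cube)
      also have "\<dots> \<le> M + 2 * C1 * M + 2 * C1 * Q * M + 4 * C4 * Q * M + 4 * C4 * C5 * M"
        using m1 m2 m3 C1 C4 C5 Q by (intro add_mono mult_left_mono) auto
      also have "\<dots> = C * M" by (simp add: C_def algebra_simps)
      finally show ?thesis by (simp add: M_def)
    qed
    finally have "(\<Sum>j=1..N^q. f j) \<le> C * (real N * real N powr \<epsilon> * \<Lambda> ^ 3)" .
    moreover have "1 / \<gamma> j = real (2*N) / real j" for j by (simp add: \<gamma>_def)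
    ultimately show "(\<Sum>j=1..N^q. wt N (real j / real (2*N)) * min (real j / real (2*N)) (real (2*N) / real j) / real N
          * (real N + 2 * (\<Sum>h=1..N. wt N (real h * (real j / real (2*N)) * \<tau>))))
         \<le> C * real N * real N powr \<epsilon> * (1 + ln (real N)) ^ 3"
      by (simp only: f_def u_def T_def \<gamma>_def[symmetric] \<Lambda>_def mult.assoc)
  qed
qed

lemma weighted_weyl_sum:
  assumes "\<kappa>1 > 0" "\<kappa>2 > 0" "\<epsilon> > 0"
  obtains C where "C > 0"
    "\<And>N \<tau>. N \<ge> 1 \<Longrightarrow> \<kappa>1 \<le> real N * \<tau> \<Longrightarrow> real N * \<tau> \<le> \<kappa>2 \<Longrightarrow>
       (\<Sum>j=1..N^q. wt N (real j / real (2*N)) * min (real j / real (2*N)) (real (2*N) / real j) / real N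
          * (real N + 2 * (\<Sum>h=1..N. wt N (real h * (real j / real (2*N)) * \<tau>))))
         \<le> C * real N powr (1 + \<epsilon>)"
proof -
  \<comment> \<open>Three logarithms cost \<open>N powr (3 * \<delta>)\<close>, which is the half of
    \<open>\<epsilon>\<close> not yet spent on the divisor bound.\<close>
  define \<delta> where "\<delta> = \<epsilon> / 6"
  have \<delta>: "\<delta> > 0" using assms by (simp add: \<delta>_def)
  have "\<epsilon> / 2 > 0" using assms by simp
  from weighted_weyl_sum_log[OF assms(1,2) this, of q] obtain C where C: "C > 0"
    "\<And>N \<tau>. N \<ge> 1 \<Longrightarrow> \<kappa>1 \<le> real N * \<tau> \<Longrightarrow> real N * \<tau> \<le> \<kappa>2 \<Longrightarrow>
       (\<Sum>j=1..N^q. wt N (real j / real (2*N)) * min (real j / real (2*N)) (real (2*N) / real j) / real N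
          * (real N + 2 * (\<Sum>h=1..N. wt N (real h * (real j / real (2*N)) * \<tau>))))
         \<le> C * real N * real N powr (\<epsilon>/2) * (1 + ln (real N)) ^ 3" by blast
  show ?thesis
  proof
    show "C * (1 + 1/\<delta>)^3 > 0" using C \<delta> by (simp add: add_pos_pos)
    fix N :: nat and \<tau> assume h: "N \<ge> 1" "\<kappa>1 \<le> real N * \<tau>" "real N * \<tau> \<le> \<kappa>2"
    have "C * real N * real N powr (\<epsilon>/2) * (1 + ln (real N)) ^ 3
        \<le> C * real N * real N powr (\<epsilon>/2) * ((1 + 1/\<delta>) * real N powr \<delta>) ^ 3"
      using one_plus_ln_le_powr[OF \<delta> h(1)] h C by (intro mult_left_mono power_mono) auto
    also have "\<dots> = C * (1 + 1/\<delta>)^3 * (real N powr 1 * real N powr (\<epsilon>/2) * real N powr (\<delta> * 3))"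
      using h by (simp add: power_mult_distrib powr_power mult_ac)
    also have "\<dots> = C * (1 + 1/\<delta>)^3 * real N powr (1 + \<epsilon>)"
      unfolding powr_add[symmetric] by (simp add: \<delta>_def add.commute)
    finally show "(\<Sum>j=1..N^q. wt N (real j / real (2*N)) * min (real j / real (2*N)) (real (2*N) / real j) / real N
          * (real N + 2 * (\<Sum>h=1..N. wt N (real h * (real j / real (2*N)) * \<tau>))))
         \<le> C * (1 + 1/\<delta>)^3 * real N powr (1 + \<epsilon>)" using C(2)[OF h] by linarith
  qed
qed


section \<open>The truncated sawtooth\<close>

text \<open>The cutoff at 0 and L is part of the periodic function, and both jumps there go downwards.\<close>

definition saw :: "nat \<Rightarrow> real \<Rightarrow> real" where
  "saw L v = (if \<lfloor>v\<rfloor> mod (2 * int L) < int L then frac v - 1 / 2 else 0)"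

lemma saw_nonneg_arg: "0 \<le> v \<Longrightarrow> v < real L \<Longrightarrow> saw L v = frac v - 1 / 2"
  by (simp add: saw_def floor_less_iff)

lemma saw_neg_arg:
  assumes "- real L \<le> v" "v < 0"
  shows "saw L v = 0"
proof -
  have f: "- int L \<le> \<lfloor>v\<rfloor>" "\<lfloor>v\<rfloor> < 0" using assms by (auto simp: le_floor_iff)
  have "\<lfloor>v\<rfloor> mod (2 * int L) = (\<lfloor>v\<rfloor> + 2 * int L) mod (2 * int L)" by simp
  also have "\<dots> = \<lfloor>v\<rfloor> + 2 * int L" using f by (intro mod_pos_pos_trivial) auto
  finally show ?thesis using f by (simp add: saw_def)
qed

lemma saw_periodic: "saw L (v + of_int n * (2 * real L)) = saw L v"
proof -
  have "saw L (v + of_int m) = saw L v" if "m = n * (2 * int L)" for m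
  proof -
    have "\<lfloor>v + of_int m\<rfloor> = \<lfloor>v\<rfloor> + m" by simp
    then show ?thesis using that by (simp add: saw_def frac_def)
  qed
  from this[OF refl] show ?thesis by simp
qed

lemma abs_saw_le: "\<bar>saw L v\<bar> \<le> 1 / 2"
  using frac_ge_0[of v] frac_lt_1[of v] by (auto simp: saw_def abs_if)

text \<open>If an integer lies between, then \<open>frac (v + u) \<le> u\<close> and
  \<open>frac v + u \<ge> 1\<close>, and these two facts settle all four combinations of active and
  cut-off arguments.\<close>

lemma saw_add_le:
  assumes "u \<ge> 0"
  shows "saw L (v + u) \<le> saw L v + u"
proof (cases "\<lfloor>v + u\<rfloor> = \<lfloor>v\<rfloor>")
  case True
  then show ?thesis using assms by (simp add: saw_def frac_def)
next
  case False
  then have "\<lfloor>v\<rfloor> + 1 \<le> \<lfloor>v + u\<rfloor>" using assms floor_mono[of v "v + u"] by linarith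
  then have l: "of_int \<lfloor>v\<rfloor> + 1 \<le> (of_int \<lfloor>v + u\<rfloor> :: real)" by (metis of_int_1 of_int_add of_int_le_iff)
  have 1: "u \<ge> frac (v + u)" using l by (simp add: frac_def) linarith
  have 2: "frac v + u \<ge> 1" using l by (simp add: frac_def) linarith
  show ?thesis using 1 2 frac_lt_1[of "v + u"] assms by (auto simp: saw_def)
qed

section \<open>Fourier coefficients of the truncated sawtooth\<close>

definition saw_unit_coeff :: "real \<Rightarrow> complex" where
  "saw_unit_coeff \<gamma> = integral {0..1} (\<lambda>v. of_real (v - 1 / 2) * ee (- \<gamma> * v))"

lemma ee_has_vector_derivative:
  "((\<lambda>v. ee (a * v)) has_vector_derivative (2 * pi * a * \<i> * ee (a * v))) (at v within S)"
proof -
  have eq: "ee (a * v) = exp (v *\<^sub>R (2 * pi * a * \<i>))" for v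
    by (simp add: ee_def cis_conv_exp scaleR_conv_of_real mult_ac)
  show ?thesis unfolding eq
    using exp_scaleR_has_vector_derivative_right[of "2 * pi * a * \<i>" v S] by (simp add: mult.commute)
qed

lemma continuous_on_ee [continuous_intros]:
  "continuous_on S f \<Longrightarrow> continuous_on S (\<lambda>x. ee (f x))"
  unfolding ee_def by (intro continuous_intros)

lemma saw_unit_coeff_integral:
  "((\<lambda>v. of_real (v - 1 / 2) * ee (- \<gamma> * v)) has_integral saw_unit_coeff \<gamma>) {0..1}"
  unfolding saw_unit_coeff_def
  by (intro integrable_integral integrable_continuous_interval continuous_intros)

text \<open>For small \<open>\<gamma>\<close> the mean of \<open>v - 1/2\<close> vanishes, so the
  exponential may be replaced by its deviation from the midpoint value, which is
  \<open>O(\<gamma>)\<close>. For large \<open>\<gamma>\<close> one integration by parts gains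
  \<open>1 / \<gamma>\<close>.\<close>

lemma norm_saw_unit_coeff_le:
  assumes "\<gamma> > 0"
  shows "norm (saw_unit_coeff \<gamma>) \<le> 2 * min \<gamma> (1 / \<gamma>)"
proof (cases "\<gamma> \<le> 1")
  case True
  have "((\<lambda>v. (v - 1 / 2)) has_integral ((1^2/2 - 1/2) - (0^2/2 - 0/2))) {0..1::real}"
    by (intro fundamental_theorem_of_calculus)
       (auto intro!: derivative_eq_intros simp: has_real_derivative_iff_has_vector_derivative[symmetric])
  then have "((\<lambda>v. (v - 1 / 2)) has_integral 0) {0..1::real}" by simp
  then have "((\<lambda>v. (of_real (v - 1 / 2))) has_integral (of_real 0 :: complex)) {0..1::real}"
    by (rule has_integral_of_real)
  then have "((\<lambda>v. of_real (v - 1 / 2) * ee (- \<gamma> * (1/2))) has_integral of_real 0 * ee (- \<gamma> * (1/2))) {0..1}"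
    by (rule has_integral_mult_left)
  from has_integral_diff[OF saw_unit_coeff_integral[of \<gamma>] this]
  have 1: "((\<lambda>v. of_real (v - 1 / 2) * (ee (- \<gamma> * v) - ee (- \<gamma> * (1/2)))) has_integral saw_unit_coeff \<gamma>) {0..1}"
    by (simp add: right_diff_distrib)
  have "norm (saw_unit_coeff \<gamma>) \<le> (2 * \<gamma>) * measure lborel {0..1::real}"
  proof (rule has_integral_bound[OF _ 1[unfolded box_real(2)[symmetric]], unfolded box_real])
    fix v :: real assume v: "v \<in> {0..1}"
    have "norm (ee (- \<gamma> * v) - ee (- \<gamma> * (1/2))) \<le> 2 * pi * \<gamma> * \<bar>v - 1/2\<bar>"
    proof -
      have "norm (ee x - ee y) \<le> 2 * pi * \<bar>x - y\<bar>" for x y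
      proof -
        have "norm (ee x - ee y) = norm (ee (x - y) - 1)"
          using norm_mult[of "ee y" "ee (x - y) - 1"] by (simp add: right_diff_distrib ee_add[symmetric])
        also have "\<dots> \<le> \<bar>2 * pi * (x - y)\<bar>"
          using dist_exp_i_1[of "2 * pi * (x - y)"] abs_sin_x_le_abs_x[of "pi * (x - y)"]
          by (simp add: ee_def cis_conv_exp abs_mult)
        finally show ?thesis by (simp add: abs_mult)
      qed
      note this[of "- \<gamma> * v" "- \<gamma> * (1/2)"]
      also have "- \<gamma> * v - - \<gamma> * (1/2) = - \<gamma> * (v - 1/2)" by (simp add: algebra_simps)
      finally show ?thesis using assms by (simp only: abs_mult abs_minus abs_of_pos mult.assoc)
    qed
    moreover have "\<bar>v - 1/2\<bar> \<le> 1/2" using v unfolding atLeastAtMost_iff by linarith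
    ultimately have "norm (of_real (v - 1 / 2) * (ee (- \<gamma> * v) - ee (- \<gamma> * (1/2)))) \<le> 1/2 * (2 * pi * \<gamma> * (1/2))"
      unfolding norm_mult norm_of_real using assms
      by (intro mult_mono) (auto elim!: order_trans)
    also have "\<dots> \<le> 2 * \<gamma>" using pi_less_4 assms by simp
    finally show "norm (of_real (v - 1 / 2) * (ee (- \<gamma> * v) - ee (- \<gamma> * (1/2)))) \<le> 2 * \<gamma>" .
  qed (use assms in auto)
  moreover have "min \<gamma> (1 / \<gamma>) = \<gamma>"
  proof -
    have "\<gamma> * \<gamma> \<le> 1" using True assms mult_le_one[of \<gamma> \<gamma>] by simp
    then show ?thesis using assms by (simp add: min_def field_simps)
  qed
  ultimately show ?thesis by simp
next
  case False
  define c where "c = - (2 * pi * \<gamma>) * \<i>"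
  have c: "c \<noteq> 0" unfolding c_def using assms by simp
  have nc: "norm c = 2 * pi * \<gamma>" using assms by (simp add: c_def norm_mult)
  \<comment> \<open>The antiderivative produced by integration by parts; only its values at the two
    end points enter.\<close>
  define G where "G v = ee (- \<gamma> * v) * (of_real (v - 1/2) / c - 1 / c^2)" for v :: real
  have "((\<lambda>v. of_real (v - 1 / 2) * ee (- \<gamma> * v)) has_integral (G 1 - G 0)) {0..1}"
  proof (rule fundamental_theorem_of_calculus)
    fix v :: real
    have d: "((\<lambda>v. ee (- \<gamma> * v)) has_vector_derivative (c * ee (- \<gamma> * v))) (at v within {0..1})"
      using ee_has_vector_derivative[of "-\<gamma>" v "{0..1}"] by (simp add: c_def)
    have e: "((\<lambda>v. of_real (v - 1/2) / c - 1 / c^2) has_vector_derivative (1 / c)) (at v within {0..1})"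
      by (auto intro!: derivative_eq_intros simp: c has_vector_derivative_def scaleR_conv_of_real)
    have "(G has_vector_derivative (ee (- \<gamma> * v) * (1 / c) + c * ee (- \<gamma> * v) * (of_real (v - 1/2) / c - 1 / c^2))) (at v within {0..1})"
      unfolding G_def by (rule has_vector_derivative_mult[OF d e])
    moreover have "ee (- \<gamma> * v) * (1 / c) + c * ee (- \<gamma> * v) * (of_real (v - 1/2) / c - 1 / c^2) = of_real (v - 1 / 2) * ee (- \<gamma> * v)"
      using c by (simp add: field_simps power2_eq_square)
    ultimately show "(G has_vector_derivative (of_real (v - 1 / 2) * ee (- \<gamma> * v))) (at v within {0..1})" by simp
  qed simp
  then have eq: "saw_unit_coeff \<gamma> = G 1 - G 0" using saw_unit_coeff_integral[of \<gamma>] has_integral_unique by blast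
  have nG: "norm (G v) \<le> 1 / (4 * \<gamma>) + 1 / (16 * \<gamma>)" if "\<bar>v - 1/2\<bar> = 1/2" for v
  proof -
    have "norm (of_real (v - 1/2) / c) \<le> 1 / (4 * \<gamma>)"
      unfolding norm_divide norm_of_real that nc using pi_gt3 assms by (simp add: field_simps)
    moreover have "norm (1 / c^2) \<le> 1 / (16 * \<gamma>)"
    proof -
      have "4 * \<gamma> * (4 * 1) \<le> (2 * pi * \<gamma>) * (2 * pi * \<gamma>)" using pi_gt3 assms False by (intro mult_mono) auto
      then show ?thesis unfolding norm_divide norm_power nc using assms by (simp add: frac_le power2_eq_square)
    qed
    ultimately show ?thesis unfolding G_def norm_mult norm_ee
      using norm_triangle_ineq4[of "of_real (v - 1/2) / c" "1 / c^2"] by simp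
  qed
  have "norm (saw_unit_coeff \<gamma>) \<le> 2 * (1 / (4 * \<gamma>) + 1 / (16 * \<gamma>))"
    unfolding eq using nG[of 1] nG[of 0] norm_triangle_ineq4[of "G 1" "G 0"] by simp
  also have "\<dots> \<le> 2 / \<gamma>" using assms by (simp add: field_simps)
  also have "\<dots> = 2 * min \<gamma> (1 / \<gamma>)"
  proof -
    have "1 / \<gamma> \<le> 1" using False by simp
    then have "min \<gamma> (1 / \<gamma>) = 1 / \<gamma>" using False by linarith
    then show ?thesis by simp
  qed
  finally show ?thesis .
qed

definition saw_term :: "nat \<Rightarrow> real \<Rightarrow> int \<Rightarrow> complex" where
  "saw_term L \<gamma> k = (if k mod (2 * int L) < int L then ee (- \<gamma> * of_int k) * saw_unit_coeff \<gamma> else 0)"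

lemma saw_integral_unit:
  "((\<lambda>v. of_real (saw L v) * ee (- \<gamma> * v)) has_integral saw_term L \<gamma> k) {of_int k..of_int k + 1}"
proof -
  define h where "h v = (if k mod (2 * int L) < int L then of_real (v - of_int k - 1 / 2) * ee (- \<gamma> * v) else 0)" for v :: real
  have "(h has_integral saw_term L \<gamma> k) {of_int k..of_int k + 1}"
  proof (cases "k mod (2 * int L) < int L")
    case True
    have "((\<lambda>v. (of_real (v - 1 / 2) * ee (- \<gamma> * v)) * ee (- \<gamma> * of_int k)) has_integral saw_unit_coeff \<gamma> * ee (- \<gamma> * of_int k)) {0..1}"
      by (intro has_integral_mult_left saw_unit_coeff_integral)
    also have "(\<lambda>v. (of_real (v - 1 / 2) * ee (- \<gamma> * v)) * ee (- \<gamma> * of_int k)) = (\<lambda>v. h (v + of_int k))"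
    proof
      fix v
      have "ee (- \<gamma> * (v + of_int k)) = ee (- \<gamma> * v) * ee (- \<gamma> * of_int k)"
        unfolding ee_add[symmetric] by (rule arg_cong[where f = ee]) (simp add: algebra_simps)
      then show "(of_real (v - 1 / 2) * ee (- \<gamma> * v)) * ee (- \<gamma> * of_int k) = h (v + of_int k)"
        using True by (simp add: h_def)
    qed
    finally show ?thesis using True has_integral_shift_Icc_real[of h "of_int k" _ 0 1]
      by (simp add: saw_term_def mult.commute o_def add.commute)
  qed (simp add: h_def[abs_def] saw_term_def)
  then show ?thesis
  proof (rule has_integral_spike_finite[rotated 2])
    show "finite {of_int k + 1 :: real}" by simp
    fix v :: real assume v: "v \<in> {of_int k..of_int k + 1} - {of_int k + 1}"
    then have "\<lfloor>v\<rfloor> = k" by (intro floor_unique) auto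
    then show "of_real (saw L v) * ee (- \<gamma> * v) = h v" by (simp add: saw_def h_def frac_def)
  qed
qed

lemma saw_integral_int:
  "((\<lambda>v. of_real (saw L v) * ee (- \<gamma> * v)) has_integral (\<Sum>k<n. saw_term L \<gamma> (m + int k))) {of_int m..of_int m + real n}"
proof (induction n)
  case (Suc n)
  have "of_int (m + int n) = of_int m + real n" by simp
  with saw_integral_unit[of L \<gamma> "m + int n"]
  have "((\<lambda>v. of_real (saw L v) * ee (- \<gamma> * v)) has_integral saw_term L \<gamma> (m + int n)) {of_int m + real n..of_int m + real (Suc n)}"
    by (simp add: add_ac)
  from has_integral_combine[OF _ _ Suc.IH this] show ?case by simp
qed (simp add: has_integral_refl)

lemma saw_integrable: "(\<lambda>v. of_real (saw L v) * ee (- \<gamma> * v)) integrable_on {a..b}"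
proof -
  have "(\<lambda>v. of_real (saw L v) * ee (- \<gamma> * v)) integrable_on {of_int \<lfloor>a\<rfloor>..of_int \<lfloor>a\<rfloor> + real (nat (\<lceil>b\<rceil> - \<lfloor>a\<rfloor>))}"
    using saw_integral_int by blast
  then show ?thesis
  proof (rule integrable_on_subinterval)
    have "b \<le> of_int \<lfloor>a\<rfloor> + real (nat (\<lceil>b\<rceil> - \<lfloor>a\<rfloor>))" by linarith
    then show "{a..b} \<subseteq> {of_int \<lfloor>a\<rfloor>..of_int \<lfloor>a\<rfloor> + real (nat (\<lceil>b\<rceil> - \<lfloor>a\<rfloor>))}"
      by (auto intro: order_trans[OF of_int_floor_le])
  qed
qed

text \<open>Not normalised by the period; the missing factor reappears as the division by
  \<open>real L\<close> in the smoothing inequality.\<close>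

definition saw_coeff :: "nat \<Rightarrow> int \<Rightarrow> complex" where
  "saw_coeff L j = integral {0..2 * real L} (\<lambda>v. of_real (saw L v) * ee (- (of_int j / (2 * real L)) * v))"

text \<open>One period consists of \<open>L\<close> equal teeth followed by \<open>L\<close> unit
  intervals of zeros. So the transform of a single tooth is multiplied by a geometric sum, which is
  large only when \<open>j / (2 L)\<close> is close to an integer.\<close>

lemma saw_coeff_eq:
  "saw_coeff L j = (\<Sum>k<L. ee (real k * - (of_int j / (2 * real L)))) * saw_unit_coeff (of_int j / (2 * real L))"
proof -
  define \<gamma> where "\<gamma> = of_int j / (2 * real L)"
  have "((\<lambda>v. of_real (saw L v) * ee (- \<gamma> * v)) has_integral (\<Sum>k<2*L. saw_term L \<gamma> (int k))) {0..2 * real L}"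
    using saw_integral_int[where L = L and \<gamma> = \<gamma> and n = "2*L" and m = 0] by simp
  then have "saw_coeff L j = (\<Sum>k<2*L. saw_term L \<gamma> (int k))"
    unfolding saw_coeff_def \<gamma>_def by (rule integral_unique)
  also have "\<dots> = (\<Sum>k<2*L. if k < L then ee (real k * - \<gamma>) * saw_unit_coeff \<gamma> else 0)"
    by (intro sum.cong refl) (auto simp: saw_term_def zmod_trivial_iff mult.commute)
  also have "\<dots> = (\<Sum>k<L. ee (real k * - \<gamma>) * saw_unit_coeff \<gamma>)"
    by (rule sum.mono_neutral_cong_right) auto
  finally show ?thesis by (simp add: sum_distrib_right \<gamma>_def)
qed

lemma norm_saw_coeff_le:
  assumes "L > 0" "j > 0"
  shows "norm (saw_coeff L (int j)) \<le> 2 * (wt L (real j / real (2*L)) * min (real j / real (2*L)) (real (2*L) / real j))"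
proof -
  have "norm (saw_coeff L (int j)) \<le> wt L (- (real j / real (2*L))) * (2 * min (real j / real (2*L)) (1 / (real j / real (2*L))))"
    unfolding saw_coeff_eq norm_mult using assms
    by (intro mult_mono order_trans[OF norm_geometric_ee_le] order_trans[OF norm_saw_unit_coeff_le]) (auto simp: wt_nonneg)
  then show ?thesis by (simp add: wt_minus)
qed

text \<open>Every tooth has mean zero. Thus the frequency \<open>0\<close>, at which an exponential
  sum has no cancellation, does not contribute.\<close>

lemma saw_coeff_0: "L > 0 \<Longrightarrow> saw_coeff L 0 = 0"
proof -
  have "((\<lambda>v. (v - 1 / 2)) has_integral ((1^2/2 - 1/2) - (0^2/2 - 0/2))) {0..1::real}"
    by (intro fundamental_theorem_of_calculus)
       (auto intro!: derivative_eq_intros simp: has_real_derivative_iff_has_vector_derivative[symmetric])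
  then have "((\<lambda>v. (v - 1 / 2)) has_integral 0) {0..1::real}" by simp
  then have "((\<lambda>v. (of_real (v - 1 / 2))) has_integral (of_real 0 :: complex)) {0..1::real}"
    by (rule has_integral_of_real)
  then have "((\<lambda>v. of_real (v - 1 / 2) * ee (- 0 * v)) has_integral 0) {0..1}" by simp
  from has_integral_unique[OF saw_unit_coeff_integral this]
  show ?thesis by (simp add: saw_coeff_eq)
qed

lemma saw_coeff_uminus: "saw_coeff L (- j) = cnj (saw_coeff L j)"
proof -
  have u: "saw_unit_coeff (- \<gamma>) = cnj (saw_unit_coeff \<gamma>)" for \<gamma>
  proof -
    have "cnj \<circ> (\<lambda>v. of_real (v - 1 / 2) * ee (- \<gamma> * v)) = (\<lambda>v. of_real (v - 1 / 2) * ee (- (- \<gamma>) * v))"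
      by (simp add: fun_eq_iff cnj_ee)
    moreover have "(cnj \<circ> (\<lambda>v. of_real (v - 1 / 2) * ee (- \<gamma> * v)) has_integral cnj (saw_unit_coeff \<gamma>)) {0..1}"
      unfolding has_integral_cnj by (rule saw_unit_coeff_integral)
    ultimately show ?thesis using has_integral_unique[OF saw_unit_coeff_integral[of "- \<gamma>"]] by simp
  qed
  show ?thesis unfolding saw_coeff_eq using u[of "of_int j / (2 * real L)"] by (simp add: cnj_ee)
qed

lemma integral_periodic:
  fixes f :: "real \<Rightarrow> complex"
  assumes p: "p > 0" and per: "\<And>x n. f (x + of_int n * p) = f x" and int: "\<And>a b. f integrable_on {a..b}"
  shows "(f has_integral integral {0..p} f) {a..a + p}"
proof -
  define n where "n = \<lfloor>a / p\<rfloor>"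
  define r where "r = a - of_int n * p"
  have "of_int n \<le> a / p" "a / p < of_int n + 1" by (simp_all add: n_def)
  then have r: "0 \<le> r" "r < p" using p by (simp_all add: r_def field_simps)
  have I: "(f has_integral integral {x..y} f) {x..y}" for x y using int by (rule integrable_integral)
  have sh: "(f has_integral integral {x..y} f) {x + of_int m * p..y + of_int m * p}" for x y m
    using I[of x y] has_integral_shift_Icc_real[of f "of_int m * p" _ x y] per by (simp add: o_def add.commute)
  have "(f has_integral integral {r..p} f + integral {0..r} f) {r..r + p}"
    using has_integral_combine[OF _ _ I[of r p] sh[of 0 r 1, simplified]] r by (simp add: add.commute)
  moreover have "integral {r..p} f + integral {0..r} f = integral {0..p} f"
    using Henstock_Kurzweil_Integration.integral_combine[of 0 r p f] r int by (simp add: add.commute)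
  ultimately have "integral {r..r+p} f = integral {0..p} f" by (simp add: integral_unique)
  then show ?thesis using sh[of r "r + p" n] by (simp add: r_def add_ac)
qed

lemma saw_shift_integral:
  assumes "L > 0"
  shows "((\<lambda>x. of_real (saw L (v + x)) * ee (- (of_int j / (2 * real L)) * x)) has_integral
     ee (of_int j / (2 * real L) * v) * saw_coeff L j) {- real L..real L}"
proof -
  define \<gamma> where "\<gamma> = of_int j / (2 * real L)"
  define f where "f y = of_real (saw L y) * ee (- \<gamma> * y)" for y
  have per: "f (x + of_int n * (2 * real L)) = f x" for x n
  proof -
    have e: "- \<gamma> * (x + of_int n * (2 * real L)) = - \<gamma> * x + of_int (- (j * n))"
      using assms by (simp add: \<gamma>_def field_simps)
    show ?thesis unfolding f_def e ee_add ee_of_int saw_periodic by simp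
  qed
  have "(f has_integral integral {0..2 * real L} f) {v - L..v - L + 2 * real L}"
  proof (intro integral_periodic per)
    show "f integrable_on {a..b}" for a b unfolding f_def[abs_def] by (rule saw_integrable)
  qed (use assms in simp)
  then have "(f has_integral saw_coeff L j) {- real L + v..real L + v}"
    by (simp add: saw_coeff_def f_def[abs_def] \<gamma>_def add.commute)
  then have "((\<lambda>x. f (x + v)) has_integral saw_coeff L j) {- real L..real L}"
    using has_integral_shift_Icc_real[of f v _ "- real L" "real L"] by (simp add: o_def add.commute)
  from has_integral_mult_right[OF this, of "ee (\<gamma> * v)"]
  have "((\<lambda>x. ee (\<gamma> * v) * f (x + v)) has_integral ee (\<gamma> * v) * saw_coeff L j) {- real L..real L}" .
  also have "(\<lambda>x. ee (\<gamma> * v) * f (x + v)) = (\<lambda>x. of_real (saw L (v + x)) * ee (- \<gamma> * x))"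
  proof
    fix x
    have "ee (\<gamma> * v) * ee (- \<gamma> * (x + v)) = ee (- \<gamma> * x)"
      unfolding ee_add[symmetric] by (rule arg_cong[where f = ee]) (simp add: algebra_simps)
    then show "ee (\<gamma> * v) * f (x + v) = of_real (saw L (v + x)) * ee (- \<gamma> * x)"
      by (simp add: f_def mult.left_commute add.commute)
  qed
  finally show ?thesis by (simp add: \<gamma>_def)
qed


section \<open>The Fejer kernel and the smoothing inequality\<close>

lemma integral_ee_period:
  assumes "L > 0" "n \<noteq> 0"
  shows "((\<lambda>x. ee (- (of_int n / (2 * real L)) * x)) has_integral 0) {- real L..real L}"
proof -
  define c where "c = - (of_int n / (2 * real L))"
  define A where "A = 2 * pi * c * \<i>"
  have c: "c \<noteq> 0" using assms by (simp add: c_def)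
  then have A: "A \<noteq> 0" by (simp add: A_def)
  have "((\<lambda>x. ee (c * x)) has_integral (ee (c * real L) / A - ee (c * (- real L)) / A)) {- real L..real L}"
  proof (rule fundamental_theorem_of_calculus)
    fix x
    have "((\<lambda>x. ee (c * x) / A) has_vector_derivative (A * ee (c * x)) / A) (at x within {- real L..real L})"
      unfolding A_def by (intro has_vector_derivative_divide ee_has_vector_derivative)
    then show "((\<lambda>x. ee (c * x) / A) has_vector_derivative ee (c * x)) (at x within {- real L..real L})"
      using A by simp
  qed (use assms in simp)
  moreover have "ee (c * real L) = ee (c * (- real L))"
  proof -
    have "c * real L = c * (- real L) + of_int (- n)" using assms by (simp add: c_def)
    then have "ee (c * real L) = ee (c * (- real L)) * ee (of_int (- n))" by (simp only: ee_add)
    then show ?thesis by (simp only: ee_of_int mult_1_right)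
  qed
  ultimately show ?thesis by (simp add: c_def)
qed

text \<open>Written as a squared modulus, so that positivity and the decay away from the integers
  are immediate; the double sum needed for Fourier expansion comes from multiplying out.\<close>

definition fejer :: "nat \<Rightarrow> real \<Rightarrow> real" where
  "fejer J y = (norm (\<Sum>a<J. ee (real a * y)))\<^sup>2 / real J"

lemma fejer_nonneg: "fejer J y \<ge> 0"
  by (simp add: fejer_def)

lemma fejer_le:
  assumes "J > 0" "0 < t" "t \<le> nint_dist y"
  shows "fejer J y \<le> 1 / (t\<^sup>2 * real J)"
proof -
  have "norm (\<Sum>a<J. ee (real a * y)) \<le> 1 / t"
    using norm_geometric_ee_le[OF assms(1), of y] wt_le_inverse[OF assms(2,3), of J] by linarith
  then have "(norm (\<Sum>a<J. ee (real a * y)))\<^sup>2 \<le> (1 / t)\<^sup>2" by (intro power_mono) auto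
  then show ?thesis unfolding fejer_def using divide_right_mono[of _ "(1/t)\<^sup>2" "real J"]
    by (simp add: power_divide)
qed

lemma fejer_expand:
  "of_real (fejer J (x / p)) = (\<Sum>a<J. \<Sum>b<J. ee (- (of_int (int b - int a) / p) * x) / of_nat J)"
proof -
  have "of_real ((norm (\<Sum>a<J. ee (real a * y)))\<^sup>2) = (\<Sum>a<J. \<Sum>b<J. ee (real a * y - real b * y))" for y
    by (simp only: complex_norm_square cnj_sum sum_product ee_diff)
  moreover have "real a * (x / p) - real b * (x / p) = - (of_int (int b - int a) / p) * x" for a b
    by (simp add: diff_divide_distrib algebra_simps)
  ultimately show ?thesis by (simp only: fejer_def sum_divide_distrib of_real_divide of_real_of_nat_eq)
qed

lemma fejer_integral:
  assumes "L > 0" "J > 0"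
  shows "((\<lambda>x. fejer J (x / (2 * real L))) has_integral (2 * real L)) {- real L..real L}"
proof -
  have "((\<lambda>x. \<Sum>a<J. \<Sum>b<J. ee (- (of_int (int b - int a) / (2 * real L)) * x) / of_nat J) has_integral
      (\<Sum>a<J. \<Sum>b<J. (if a = b then of_real (2 * real L) else 0) / of_nat J)) {- real L..real L}"
  proof (intro has_integral_sum has_integral_divide)
    fix a b
    show "((\<lambda>x. ee (- (of_int (int b - int a) / (2 * real L)) * x)) has_integral (if a = b then of_real (2 * real L) else 0)) {- real L..real L}"
    proof (cases "a = b")
      case True
      have "((\<lambda>x. 1 :: complex) has_integral (measure lborel (cbox (- real L) (real L)) *\<^sub>R 1)) (cbox (- real L) (real L))"
        by (rule has_integral_const)
      then show ?thesis using True by (simp add: scaleR_conv_of_real)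
    next
      case False
      then show ?thesis using integral_ee_period[OF assms(1), of "int b - int a"] by simp
    qed
  qed auto
  also have "(\<Sum>a<J. \<Sum>b<J. (if a = b then of_real (2 * real L) else 0) / of_nat J) = (of_real (2 * real L) :: complex)"
  proof -
    have "(\<Sum>b<J. (if a = b then of_real (2 * real L) else 0) / of_nat J) = (of_real (2 * real L) / of_nat J :: complex)" if "a < J" for a
      using that by (simp add: sum_divide_distrib[symmetric])
    then show ?thesis using assms by simp
  qed
  finally have "((\<lambda>x. of_real (fejer J (x / (2 * real L)))) has_integral (of_real (2 * real L) :: complex)) {- real L..real L}"
    by (simp only: fejer_expand)
  from has_integral_Re[OF this] show ?thesis by simp
qed

text \<open>In the expanded kernel, for a fixed first index \<open>a\<close>, every nonzero distance
  to \<open>a\<close> occurs at most twice.\<close>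

lemma sum_abs_diff_le:
  fixes t :: "nat \<Rightarrow> real"
  assumes "t 0 = 0" "\<And>j. t j \<ge> 0" "a < J"
  shows "(\<Sum>b<J. t (nat \<bar>int b - int a\<bar>)) \<le> 2 * (\<Sum>j=1..J. t j)"
proof -
  have "{..<J} = {..<a} \<union> {a..<J}" using assms(3) by auto
  then have "(\<Sum>b<J. t (nat \<bar>int b - int a\<bar>)) = (\<Sum>b<a. t (nat \<bar>int b - int a\<bar>)) + (\<Sum>b=a..<J. t (nat \<bar>int b - int a\<bar>))"
    by (simp add: sum.union_disjoint ivl_disj_int)
  also have "(\<Sum>b<a. t (nat \<bar>int b - int a\<bar>)) = (\<Sum>j=1..a. t j)"
    by (rule sum.reindex_bij_witness[where i = "\<lambda>j. a - j" and j = "\<lambda>b. a - b"]) (auto simp: nat_diff_distrib' of_nat_diff abs_if intro!: arg_cong[where f = t])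
  also have "(\<Sum>b=a..<J. t (nat \<bar>int b - int a\<bar>)) = (\<Sum>j<J-a. t j)"
    by (rule sum.reindex_bij_witness[where i = "\<lambda>j. j + a" and j = "\<lambda>b. b - a"]) (auto intro!: arg_cong[where f = t])
  also have "(\<Sum>j<J-a. t j) = (\<Sum>j\<in>{1..<J-a}. t j)"
    using assms(1) by (intro sum.mono_neutral_right) (auto simp: Suc_le_eq)
  also have "(\<Sum>j=1..a. t j) + \<dots> \<le> (\<Sum>j=1..J. t j) + (\<Sum>j=1..J. t j)"
    using assms by (intro add_mono sum_mono2) auto
  finally show ?thesis by simp
qed

text \<open>One-sided Lipschitz continuity compares the value at a point with the values on an adjacent interval
  of length \<open>2 w\<close>. The mass of the kernel outside that interval is so small that, against the supremum \<open>B\<close> of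
  the sum over all shifts, it costs at most \<open>B / 2\<close>, which is absorbed.\<close>

lemma saw_sum_bound:
  fixes s :: "'i \<Rightarrow> real"
  assumes fin: "finite I" and L: "L > 0" and w: "w > 0" and J: "16 * real L ^ 2 \<le> real J * w\<^sup>2"
  shows "\<bar>\<Sum>i\<in>I. saw L (X - s i)\<bar> \<le> 4 * w * real (card I) +
     4 * (\<Sum>j=1..J. wt L (real j / real (2*L)) * min (real j / real (2*L)) (real (2*L) / real j) / real L
          * norm (\<Sum>i\<in>I. ee (real j / real (2*L) * s i)))"
proof -
  define p where "p = 2 * real L"
  define M where "M = real (card I)"
  define G where "G x = (\<Sum>i\<in>I. saw L (x - s i))" for x
  define F where "F x = fejer J (x / p)" for x
  define \<omega> where "\<omega> j = wt L (real j / real (2*L)) * min (real j / real (2*L)) (real (2*L) / real j)" for j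
  define S where "S j = norm (\<Sum>i\<in>I. ee (real j / real (2*L) * s i))" for j
  define E where "E = (\<Sum>j=1..J. \<omega> j * S j)"
  have p: "p > 0" using L by (simp add: p_def)
  have J0: "J > 0" using J L by (cases J) auto
  have F0: "F x \<ge> 0" for x by (simp add: F_def fejer_nonneg)
  have Fi: "(F has_integral p) {- real L..real L}"
    using fejer_integral[OF L J0] by (simp add: F_def[abs_def] p_def)
  have \<omega>0: "\<omega> j \<ge> 0" for j by (simp add: \<omega>_def wt_nonneg)
  have S0: "S j \<ge> 0" for j by (simp add: S_def)
  have E0: "E \<ge> 0" unfolding E_def by (intro sum_nonneg mult_nonneg_nonneg \<omega>0 S0)
  have Gadd: "G (x + u) \<le> G x + u * M" if "u \<ge> 0" for x u
  proof -
    have "G (x + u) \<le> (\<Sum>i\<in>I. saw L (x - s i) + u)"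
      unfolding G_def
    proof (rule sum_mono)
      fix i
      show "saw L (x + u - s i) \<le> saw L (x - s i) + u"
        using saw_add_le[OF that, of L "x - s i"] by (simp add: algebra_simps)
    qed
    then show ?thesis by (simp add: G_def sum.distrib M_def mult.commute)
  qed
  have "\<bar>G x\<bar> \<le> M" for x
  proof -
    have "\<bar>G x\<bar> \<le> (\<Sum>i\<in>I. \<bar>saw L (x - s i)\<bar>)" unfolding G_def by (rule sum_abs)
    also have "\<dots> \<le> (\<Sum>i\<in>I. 1)" using abs_saw_le[of L] by (intro sum_mono) (smt (verit) field_sum_of_halves)
    finally show ?thesis by (simp add: M_def)
  qed
  then have bdd: "bdd_above (range (\<lambda>x. \<bar>G x\<bar>))" by (intro bdd_aboveI2)
  define B where "B = (SUP x. \<bar>G x\<bar>)"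
  have GB: "\<bar>G x\<bar> \<le> B" for x unfolding B_def using bdd by (rule cSUP_upper[OF UNIV_I])
  have B0: "B \<ge> 0" using GB[of 0] by linarith
  \<comment> \<open>Bounds the kernel outside the central interval: within one period
    \<open>\<bar>x / p\<bar> \<le> 1/2\<close>, so the distance to the integers is
    \<open>\<bar>x\<bar> / p\<close>.\<close>
  define \<tau> where "\<tau> = 1 / ((w / p)\<^sup>2 * real J)"
  have \<tau>0: "\<tau> \<ge> 0" by (simp add: \<tau>_def)
  have F\<tau>: "F x \<le> \<tau>" if "w < \<bar>x\<bar>" "x \<in> {- real L..real L}" for x
  proof -
    have "\<bar>x / p\<bar> \<le> 1 / 2" using that p by (simp add: p_def abs_le_iff)
    then have "nint_dist (x / p) = \<bar>x / p\<bar>" using nint_dist_eq_abs[of "x / p" 0] by simp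
    then have "w / p \<le> nint_dist (x / p)" using that p by (simp add: divide_right_mono)
    then show ?thesis unfolding F_def \<tau>_def using w p by (intro fejer_le J0) auto
  qed
  \<comment> \<open>With \<open>p = 2 * L\<close> the hypothesis on \<open>J\<close> reads
    \<open>4 * p^2 \<le> J * w^2\<close>, that is \<open>\<tau> \<le> 1/4\<close>.\<close>
  have \<tau>p: "2 * B * \<tau> * p \<le> B / 2 * p"
  proof -
    have "4 * p\<^sup>2 \<le> real J * w\<^sup>2" using J by (simp add: p_def power_mult_distrib)
    moreover have "\<tau> = p\<^sup>2 / (real J * w\<^sup>2)" using w p J0 by (simp add: \<tau>_def power_divide)
    ultimately have "\<tau> \<le> 1 / 4" using w J0 by (simp add: divide_le_eq)
    then have "2 * B * \<tau> \<le> 2 * B * (1/4)" using B0 by (intro mult_left_mono) auto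
    then show ?thesis using p by (intro mult_right_mono) auto
  qed
  \<comment> \<open>Integration against the kernel turns \<open>G\<close> into a finite combination
    of Fourier coefficients; passing to absolute values makes the bound uniform in the
    shift.\<close>
  have int: "\<exists>R. ((\<lambda>x. G (X + x) * F x) has_integral R) {- real L..real L} \<and> \<bar>R\<bar> \<le> 4 * E" for X
  proof -
    define T where "T j = saw_coeff L j * (\<Sum>i\<in>I. ee (of_int j / p * (X - s i)))" for j
    define t where "t j = (if j = 0 then 0 else 2 * \<omega> j * S j)" for j
    have Tt: "norm (T j) \<le> t (nat \<bar>j\<bar>)" for j
    proof -
      have T_minus: "T (- j) = cnj (T j)" for j by (simp add: T_def saw_coeff_uminus cnj_ee)
      have pos: "norm (T (int n)) \<le> t n" for n
      proof (cases "n = 0")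
        case True then show ?thesis using saw_coeff_0[OF L] by (simp add: T_def t_def)
      next
        case False
        have "(\<Sum>i\<in>I. ee (of_int (int n) / p * (X - s i))) = ee (real n / p * X) * cnj (\<Sum>i\<in>I. ee (real n / p * s i))"
          by (simp add: right_diff_distrib ee_diff sum_distrib_left)
        then have "norm (\<Sum>i\<in>I. ee (of_int (int n) / p * (X - s i))) = S n"
          by (simp add: norm_mult S_def p_def del: cnj_sum)
        then show ?thesis using norm_saw_coeff_le[OF L, of n] False S0[of n]
          by (simp add: T_def t_def norm_mult \<omega>_def mult_right_mono)
      qed
      show ?thesis
      proof (cases "j \<ge> 0")
        case True then show ?thesis using pos[of "nat j"] by simp
      next
        case False then show ?thesis using pos[of "nat (- j)"] T_minus[of "- j"] by simp
      qed
    qed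
    have t0: "t j \<ge> 0" for j by (simp add: t_def \<omega>0 S0)
    define R where "R = (\<Sum>a<J. \<Sum>b<J. \<Sum>i\<in>I. saw_coeff L (int b - int a) * ee (of_int (int b - int a) / p * (X - s i)) / of_nat J)"
    have sh: "((\<lambda>x. of_real (saw L (v + x)) * ee (- (of_int j / p) * x)) has_integral saw_coeff L j * ee (of_int j / p * v)) {- real L..real L}" for j v
      using saw_shift_integral[OF L, of v j] unfolding p_def by (simp only: mult.commute[of "saw_coeff L j"])
    have "((\<lambda>x. \<Sum>a<J. \<Sum>b<J. \<Sum>i\<in>I. of_real (saw L ((X - s i) + x)) * ee (- (of_int (int b - int a) / p) * x) / of_nat J)
        has_integral R) {- real L..real L}"
      unfolding R_def by (intro has_integral_sum has_integral_divide sh fin finite_lessThan)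
    also have "(\<lambda>x. \<Sum>a<J. \<Sum>b<J. \<Sum>i\<in>I. of_real (saw L ((X - s i) + x)) * ee (- (of_int (int b - int a) / p) * x) / of_nat J)
       = (\<lambda>x. of_real (G (X + x) * F x))"
    proof
      fix x
      have "of_real (G (X + x) * F x) = (\<Sum>i\<in>I. of_real (saw L ((X - s i) + x))) * (\<Sum>a<J. \<Sum>b<J. ee (- (of_int (int b - int a) / p) * x) / of_nat J)"
        unfolding of_real_mult F_def fejer_expand G_def by (simp add: algebra_simps)
      also have "\<dots> = (\<Sum>a<J. \<Sum>b<J. (\<Sum>i\<in>I. of_real (saw L ((X - s i) + x))) * (ee (- (of_int (int b - int a) / p) * x) / of_nat J))"
        by (simp only: sum_distrib_left)
      also have "\<dots> = (\<Sum>a<J. \<Sum>b<J. \<Sum>i\<in>I. of_real (saw L ((X - s i) + x)) * ee (- (of_int (int b - int a) / p) * x) / of_nat J)"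
        by (simp only: sum_distrib_right times_divide_eq_right sum_divide_distrib)
      finally show "(\<Sum>a<J. \<Sum>b<J. \<Sum>i\<in>I. of_real (saw L ((X - s i) + x)) * ee (- (of_int (int b - int a) / p) * x) / of_nat J) = of_real (G (X + x) * F x)" ..
    qed
    finally have "((\<lambda>x. of_real (G (X + x) * F x)) has_integral R) {- real L..real L}" .
    from has_integral_Re[OF this] have "((\<lambda>x. G (X + x) * F x) has_integral Re R) {- real L..real L}" by simp
    moreover have "\<bar>Re R\<bar> \<le> 4 * E"
    proof -
      have R: "R = (\<Sum>a<J. \<Sum>b<J. T (int b - int a)) / of_nat J"
        unfolding R_def T_def by (simp only: sum_divide_distrib[symmetric] sum_distrib_left[symmetric])
      have "norm (\<Sum>a<J. \<Sum>b<J. T (int b - int a)) \<le> (\<Sum>a<J. \<Sum>b<J. t (nat \<bar>int b - int a\<bar>))"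
        by (intro order_trans[OF norm_sum] sum_mono Tt)
      also have "\<dots> \<le> (\<Sum>a<J. 2 * (\<Sum>j=1..J. t j))"
        by (intro sum_mono sum_abs_diff_le t0) (auto simp: t_def)
      also have "(\<Sum>j=1..J. t j) = 2 * E" unfolding E_def sum_distrib_left
        by (intro sum.cong refl) (auto simp: t_def)
      finally have "norm (\<Sum>a<J. \<Sum>b<J. T (int b - int a)) \<le> real J * (4 * E)" by simp
      then have "norm R \<le> 4 * E" unfolding R norm_divide using J0 by (simp add: divide_le_eq mult.commute)
      then show ?thesis using abs_Re_le_cmod[of R] by linarith
    qed
    ultimately show ?thesis by blast
  qed
  have cint: "((\<lambda>x. 2 * B * \<tau>) has_integral (2 * B * \<tau> * p)) {- real L..real L}"
    using has_integral_const_real[of "2 * B * \<tau>" "- real L" "real L"] L by (simp add: p_def mult.commute)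
  have cancel: "z \<le> 2 * w * M + 2 * E / real L + B / 2" if "(z - 2 * w * M) * p \<le> 4 * E + 2 * B * \<tau> * p" for z
  proof -
    have "(z - 2 * w * M) * p \<le> (4 * E / p + B / 2) * p" using that \<tau>p p by (simp add: distrib_right)
    then have "z - 2 * w * M \<le> 4 * E / p + B / 2" using p by simp
    then show ?thesis by (simp add: p_def)
  qed
  \<comment> \<open>For the upper bound the kernel is centred at \<open>X0 - w\<close>, so that
    \<open>X0\<close> lies to the right of the whole central interval and the one-sided estimate
    applies; for the lower bound it is centred at \<open>X0 + w\<close>.\<close>
  have main: "\<bar>G X0\<bar> \<le> 2 * w * M + 2 * E / real L + B / 2" for X0
  proof (rule abs_leI)
    obtain R where R: "((\<lambda>x. G ((X0 - w) + x) * F x) has_integral R) {- real L..real L}" "\<bar>R\<bar> \<le> 4 * E"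
      using int[of "X0 - w"] by blast
    have "(G X0 - 2 * w * M) * p \<le> R + 2 * B * \<tau> * p"
    proof (rule has_integral_le[OF has_integral_mult_right[OF Fi] has_integral_add[OF R(1) cint]])
      fix x assume x: "x \<in> {- real L..real L}"
      show "(G X0 - 2 * w * M) * F x \<le> G (X0 - w + x) * F x + 2 * B * \<tau>"
      proof (cases "\<bar>x\<bar> \<le> w")
        case True
        then have "G X0 \<le> G (X0 - w + x) + (w - x) * M" using Gadd[of "w - x" "X0 - w + x"] by simp
        moreover have "(w - x) * M \<le> 2 * w * M" using True by (intro mult_right_mono) (auto simp: M_def)
        ultimately have "(G X0 - 2 * w * M) * F x \<le> G (X0 - w + x) * F x" using F0 by (intro mult_right_mono) auto
        then show ?thesis using B0 \<tau>0 by (simp add: add_increasing2)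
      next
        case False
        have "G X0 - 2 * w * M - G (X0 - w + x) \<le> 2 * B"
          using GB[of X0] GB[of "X0 - w + x"] w by (smt (verit) M_def mult_nonneg_nonneg of_nat_0_le_iff)
        then have "(G X0 - 2 * w * M - G (X0 - w + x)) * F x \<le> 2 * B * F x" using F0 by (intro mult_right_mono) auto
        also have "\<dots> \<le> 2 * B * \<tau>" using F\<tau>[OF _ x] False B0 by (intro mult_left_mono) auto
        finally show ?thesis by (simp add: left_diff_distrib)
      qed
    qed
    then show "G X0 \<le> 2 * w * M + 2 * E / real L + B / 2" using R(2) by (intro cancel) linarith
  next
    obtain R where R: "((\<lambda>x. G ((X0 + w) + x) * F x) has_integral R) {- real L..real L}" "\<bar>R\<bar> \<le> 4 * E"
      using int[of "X0 + w"] by blast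
    have "(- G X0 - 2 * w * M) * p \<le> - R + 2 * B * \<tau> * p"
    proof (rule has_integral_le[OF has_integral_mult_right[OF Fi] has_integral_add[OF has_integral_neg[OF R(1)] cint]])
      fix x assume x: "x \<in> {- real L..real L}"
      show "(- G X0 - 2 * w * M) * F x \<le> - (G (X0 + w + x) * F x) + 2 * B * \<tau>"
      proof (cases "\<bar>x\<bar> \<le> w")
        case True
        then have "G (X0 + w + x) \<le> G X0 + (w + x) * M" using Gadd[of "w + x" "X0"] by (simp add: add_ac)
        moreover have "(w + x) * M \<le> 2 * w * M" using True by (intro mult_right_mono) (auto simp: M_def)
        ultimately have "(- G X0 - 2 * w * M) * F x \<le> (- G (X0 + w + x)) * F x" using F0 by (intro mult_right_mono) auto
        moreover have "0 \<le> 2 * B * \<tau>" using B0 \<tau>0 by simp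
        ultimately show ?thesis by linarith
      next
        case False
        have "- G X0 - 2 * w * M + G (X0 + w + x) \<le> 2 * B"
          using GB[of X0] GB[of "X0 + w + x"] w by (smt (verit) M_def mult_nonneg_nonneg of_nat_0_le_iff)
        then have "(- G X0 - 2 * w * M + G (X0 + w + x)) * F x \<le> 2 * B * F x" using F0 by (intro mult_right_mono) auto
        also have "\<dots> \<le> 2 * B * \<tau>" using F\<tau>[OF _ x] False B0 by (intro mult_left_mono) auto
        finally show ?thesis by (simp add: left_diff_distrib distrib_right)
      qed
    qed
    then show "- G X0 \<le> 2 * w * M + 2 * E / real L + B / 2" using R(2) by (intro cancel) linarith
  qed
  have "B \<le> 2 * w * M + 2 * E / real L + B / 2"
    unfolding B_def by (rule cSUP_least) (use main B_def in auto)
  then have "\<bar>G X\<bar> \<le> 4 * w * M + 4 * E / real L" using GB[of X] by linarith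
  moreover have "E / real L = (\<Sum>j=1..J. \<omega> j / real L * S j)"
    by (simp add: E_def sum_divide_distrib)
  then have "4 * E / real L = 4 * (\<Sum>j=1..J. \<omega> j / real L * S j)" by simp
  ultimately show ?thesis by (simp only: G_def M_def \<omega>_def S_def)
qed


section \<open>Riemann sums over unit cells\<close>

definition int_vecs :: "(real ^ 'n) set" where
  "int_vecs = {x. \<forall>i. x $ i \<in> \<int>}"

definition lattice_box :: "real \<Rightarrow> (real ^ 'n) set" where
  "lattice_box K = {x \<in> int_vecs. \<forall>i. \<bar>x $ i\<bar> \<le> K}"

text \<open>Centred, so that a lattice point is the midpoint of its cell and second differences
  appear; half open, so that the integer translates are disjoint.\<close>

definition half_open_cube :: "(real ^ 'n) set" where
  "half_open_cube = {u. \<forall>i. - 1 / 2 \<le> u $ i \<and> u $ i < 1 / 2}"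

lemma lattice_box_subset_image:
  "lattice_box K \<subseteq> (\<lambda>f. \<chi> i. real_of_int (f i)) ` (UNIV \<rightarrow>\<^sub>E {- \<lfloor>K\<rfloor>..\<lfloor>K\<rfloor>})"
proof
  fix x :: "real ^ 'n" assume x: "x \<in> lattice_box K"
  have fl: "\<bar>\<lfloor>x $ i\<rfloor>\<bar> \<le> \<lfloor>K\<rfloor>" "x $ i = of_int \<lfloor>x $ i\<rfloor>" for i
  proof -
    have eq: "of_int \<lfloor>x $ i\<rfloor> = x $ i" using x by (simp add: lattice_box_def int_vecs_def)
    then show "x $ i = of_int \<lfloor>x $ i\<rfloor>" ..
    have "\<bar>x $ i\<bar> \<le> K" using x by (simp add: lattice_box_def)
    then have "of_int \<bar>\<lfloor>x $ i\<rfloor>\<bar> \<le> K" by (simp add: eq)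
    then show "\<bar>\<lfloor>x $ i\<rfloor>\<bar> \<le> \<lfloor>K\<rfloor>" by (simp only: le_floor_iff)
  qed
  have "x = (\<chi> i. real_of_int \<lfloor>x $ i\<rfloor>)" unfolding vec_eq_iff using fl(2) by (metis vec_lambda_beta)
  moreover have "(\<lambda>i. \<lfloor>x $ i\<rfloor>) \<in> UNIV \<rightarrow>\<^sub>E {- \<lfloor>K\<rfloor>..\<lfloor>K\<rfloor>}"
    using fl(1) by (auto simp: PiE_UNIV_domain abs_le_iff minus_le_iff)
  ultimately show "x \<in> (\<lambda>f. \<chi> i. real_of_int (f i)) ` (UNIV \<rightarrow>\<^sub>E {- \<lfloor>K\<rfloor>..\<lfloor>K\<rfloor>})"
    by (rule image_eqI)
qed

lemma finite_lattice_box: "finite (lattice_box K :: (real ^ 'n) set)"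
  by (rule finite_subset[OF lattice_box_subset_image]) (intro finite_imageI finite_PiE, auto)

lemma card_lattice_box_le:
  assumes "K \<ge> 0"
  shows "real (card (lattice_box K :: (real ^ 'n) set)) \<le> (2 * K + 1) ^ CARD('n)"
proof -
  have "card (lattice_box K :: (real ^ 'n) set) \<le> card ((UNIV :: 'n set) \<rightarrow>\<^sub>E {- \<lfloor>K\<rfloor>..\<lfloor>K\<rfloor>})"
    by (rule order_trans[OF card_mono[OF _ lattice_box_subset_image] card_image_le])
       (auto intro!: finite_imageI finite_PiE)
  also have "\<dots> = nat (2 * \<lfloor>K\<rfloor> + 1) ^ CARD('n)" by (simp add: card_PiE)
  finally have "real (card (lattice_box K :: (real ^ 'n) set)) \<le> real (nat (2 * \<lfloor>K\<rfloor> + 1)) ^ CARD('n)"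
    by (metis of_nat_le_iff of_nat_power)
  also have "\<dots> \<le> (2 * K + 1) ^ CARD('n)" using assms by (intro power_mono) auto
  finally show ?thesis .
qed

lemma half_open_cube_unique:
  assumes "m \<in> int_vecs" "m' \<in> int_vecs" "x - m \<in> half_open_cube" "x - m' \<in> half_open_cube"
  shows "m = m'"
proof -
  have "m $ i = m' $ i" for i
  proof -
    obtain a b where ab: "m $ i = of_int a" "m' $ i = of_int b"
      using assms(1,2) by (auto simp: int_vecs_def elim!: Ints_cases) (metis Ints_cases)
    have "-1/2 \<le> x $ i - of_int a" "x $ i - of_int a < 1/2" "-1/2 \<le> x $ i - of_int b" "x $ i - of_int b < 1/2"
      using assms(3,4) ab by (auto simp: half_open_cube_def vector_minus_component) (metis+)?
    then have "a = b" by linarith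
    then show ?thesis by (simp add: ab)
  qed
  then show ?thesis by (simp add: vec_eq_iff)
qed

lemma half_open_cube_exists: "\<exists>m\<in>int_vecs. x - m \<in> half_open_cube"
proof
  show "(\<chi> i. of_int \<lfloor>x $ i + 1/2\<rfloor>) \<in> int_vecs" by (simp add: int_vecs_def)
  have "-1/2 \<le> x $ i - of_int \<lfloor>x $ i + 1/2\<rfloor>" "x $ i - of_int \<lfloor>x $ i + 1/2\<rfloor> < 1/2" for i by linarith+
  then show "x - (\<chi> i. of_int \<lfloor>x $ i + 1/2\<rfloor>) \<in> half_open_cube"
    by (simp add: half_open_cube_def)
qed

lemma half_open_cube_measurable [measurable]: "half_open_cube \<in> sets borel"
proof -
  have "half_open_cube = (\<Inter>i\<in>UNIV. {u :: real ^ 'n. - 1 / 2 \<le> u $ i} \<inter> {u. u $ i < 1 / 2})"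
    by (auto simp: half_open_cube_def)
  also have "\<dots> \<in> sets borel"
    by (intro sets.finite_INT sets.Int borel_closed borel_open closed_halfspace_component_ge_cart
        closed_Collect_le open_Collect_less continuous_intros) auto
  finally show ?thesis .
qed

lemma half_open_cube_bounds:
  "box (\<chi> i. - 1/2) (\<chi> i. 1/2) \<subseteq> (half_open_cube :: (real ^ 'n) set)"
  "(half_open_cube :: (real ^ 'n) set) \<subseteq> cbox (\<chi> i. - 1/2) (\<chi> i. 1/2)"
  by (auto simp: half_open_cube_def mem_box_cart less_imp_le)

lemma emeasure_half_open_cube: "emeasure lborel (half_open_cube :: (real ^ 'n) set) = 1"
proof -
  have m: "measure lborel (cbox (\<chi> i. - 1/2) (\<chi> i. 1/2) :: (real ^ 'n) set) = 1"
  proof -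
    have "(cbox (\<chi> i. - 1/2) (\<chi> i. 1/2) :: (real ^ 'n) set) \<noteq> {}" by (auto simp: interval_eq_empty_cart)
    then show ?thesis by (subst content_cbox_cart) simp_all
  qed
  have c: "emeasure lborel (cbox (\<chi> i. - 1/2) (\<chi> i. 1/2) :: (real ^ 'n) set) = 1"
  proof -
    have "emeasure lborel (cbox (\<chi> i. - 1/2) (\<chi> i. 1/2) :: (real ^ 'n) set) \<noteq> top"
      by (simp add: emeasure_lborel_cbox_eq)
    from emeasure_eq_ennreal_measure[OF this] show ?thesis unfolding m by simp
  qed
  have b: "emeasure lborel (box (\<chi> i. - 1/2) (\<chi> i. 1/2) :: (real ^ 'n) set) = 1"
    using c by (simp add: emeasure_lborel_cbox_eq emeasure_lborel_box_eq)
  show ?thesis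
  proof (rule antisym)
    show "emeasure lborel (half_open_cube :: (real ^ 'n) set) \<le> 1"
      unfolding c[symmetric] by (rule emeasure_mono[OF half_open_cube_bounds(2)]) simp
    show "1 \<le> emeasure lborel (half_open_cube :: (real ^ 'n) set)"
      unfolding b[symmetric] by (rule emeasure_mono[OF half_open_cube_bounds(1)]) simp
  qed
qed

lemma norm_half_open_cube_le:
  "(u :: real ^ 'n) \<in> half_open_cube \<Longrightarrow> norm u \<le> real CARD('n)"
proof -
  assume "u \<in> half_open_cube"
  then have "\<bar>u $ i\<bar> \<le> 1" for i by (smt (verit) half_open_cube_def mem_Collect_eq field_sum_of_halves)
  then have "(\<Sum>i\<in>UNIV. \<bar>u $ i\<bar>) \<le> (\<Sum>i\<in>(UNIV :: 'n set). 1)" by (intro sum_mono)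
  then show ?thesis using norm_le_l1_cart[of u] by simp
qed

section \<open>Folding integrals onto a unit cell\<close>

lemma integrable_lborel_translation:
  fixes g :: "'a :: euclidean_space \<Rightarrow> real"
  shows "integrable lborel (\<lambda>x. g (t + x)) \<longleftrightarrow> integrable lborel g" (is "?a \<longleftrightarrow> ?b")
proof -
  have 1: "integrable lborel (\<lambda>x. g (t + x))" if "integrable lborel g" for t and g :: "'a \<Rightarrow> real"
    using integrable_distr_eq[of "(+) t" lborel borel g] that by (simp add: lborel_distr_plus borel_measurable_integrable)
  show ?thesis using 1[of g t] 1[of "\<lambda>x. g (t + x)" "-t"] by auto
qed

lemma integral_lborel_translation:
  fixes g :: "'a :: euclidean_space \<Rightarrow> real"
  assumes "g \<in> borel_measurable borel"
  shows "(\<integral>x. g (t + x) \<partial>lborel) = (\<integral>x. g x \<partial>lborel)"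
  using integral_distr[of "(+) t" lborel borel g] assms by (simp add: lborel_distr_plus)

lemma lborel_distr_uminus_euclidean: "distr lborel borel uminus = (lborel :: 'a :: euclidean_space measure)"
proof -
  have "(lborel :: 'a measure) = density (distr lborel borel (\<lambda>x. 0 + (-1) *\<^sub>R x)) (\<lambda>_. ennreal (\<bar>-1\<bar> ^ DIM('a)))"
    by (rule lborel_affine) simp
  then show ?thesis by (simp add: density_1 o_def)
qed

lemma integral_lborel_reflect:
  fixes g :: "'a :: euclidean_space \<Rightarrow> real"
  assumes "g \<in> borel_measurable borel"
  shows "(\<integral>x. g (- x) \<partial>lborel) = (\<integral>x. g x \<partial>lborel)"
  using integral_distr[of uminus lborel borel g] assms by (simp add: lborel_distr_uminus_euclidean)

text \<open>The translates of \<open>D\<close> by \<open>B\<close> cover each point of the support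
  of \<open>g\<close> exactly once. Restricting to finitely many translations avoids questions of
  summability.\<close>

lemma integral_fundamental_domain:
  fixes g :: "real ^ 'n \<Rightarrow> real"
  assumes g: "integrable lborel g" and B: "finite B" and D: "D \<in> sets borel"
    and ex: "\<And>x. g x \<noteq> 0 \<Longrightarrow> \<exists>m\<in>B. x - m \<in> D"
    and un: "\<And>x m m'. m \<in> B \<Longrightarrow> m' \<in> B \<Longrightarrow> x - m \<in> D \<Longrightarrow> x - m' \<in> D \<Longrightarrow> m = m'"
  shows "integrable lborel (\<lambda>u. indicator D u * (\<Sum>m\<in>B. g (m + u)))"
    and "integral\<^sup>L lborel g = (\<integral>u. indicator D u * (\<Sum>m\<in>B. g (m + u)) \<partial>lborel)"
proof -
  have gm: "g x = (\<Sum>m\<in>B. indicator D (x - m) * g x)" for x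
  proof (cases "g x = 0")
    case False
    then obtain m where m: "m \<in> B" "x - m \<in> D" using ex by blast
    have "(\<Sum>m'\<in>B. indicator D (x - m') * g x) = (\<Sum>m'\<in>{m}. indicator D (x - m') * g x)"
      using m un B by (intro sum.mono_neutral_right) (auto simp: indicator_def)
    then show ?thesis using m by simp
  qed simp
  have sh: "integrable lborel (\<lambda>u. g (m + u))" for m using g by (simp add: integrable_lborel_translation)
  have int: "integrable lborel (\<lambda>u. indicator D u * g (m + u))" for m
    using integrable_mult_indicator[OF _ sh, of D] D by simp
  then show "integrable lborel (\<lambda>u. indicator D u * (\<Sum>m\<in>B. g (m + u)))"
    by (simp add: sum_distrib_left)
  have eq: "(\<lambda>x. indicator D (x - m) * g x) = (\<lambda>x. (\<lambda>u. indicator D u * g (m + u)) (- m + x))" for m by simp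
  have int2: "integrable lborel (\<lambda>x. indicator D (x - m) * g x)" for m
    unfolding eq using int[of m] integrable_lborel_translation[of "\<lambda>u. indicator D u * g (m + u)" "- m"] by blast
  have "integral\<^sup>L lborel g = (\<integral>x. (\<Sum>m\<in>B. indicator D (x - m) * g x) \<partial>lborel)" using gm by simp
  also have "\<dots> = (\<Sum>m\<in>B. \<integral>x. indicator D (x - m) * g x \<partial>lborel)" using int2 by simp
  also have "\<dots> = (\<Sum>m\<in>B. \<integral>u. indicator D u * g (m + u) \<partial>lborel)"
    unfolding eq using int by (intro sum.cong refl integral_lborel_translation) (simp add: borel_measurable_integrable)
  also have "\<dots> = (\<integral>u. (\<Sum>m\<in>B. indicator D u * g (m + u)) \<partial>lborel)" using int by simp
  finally show "integral\<^sup>L lborel g = (\<integral>u. indicator D u * (\<Sum>m\<in>B. g (m + u)) \<partial>lborel)"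
    by (simp add: sum_distrib_left)
qed

text \<open>Both the half-open cube and its reflection are fundamental domains; using both kills the linear terms.\<close>

lemma integral_symmetric_cells:
  fixes g :: "real ^ 'n \<Rightarrow> real"
  assumes g: "integrable lborel g" "g \<in> borel_measurable borel" and B: "finite B" "B \<subseteq> int_vecs"
    and supp: "\<And>x m. g x \<noteq> 0 \<Longrightarrow> m \<in> int_vecs \<Longrightarrow> norm (x - m) \<le> real CARD('n) \<Longrightarrow> m \<in> B"
  shows "integrable lborel (\<lambda>u. indicator half_open_cube u * (\<Sum>m\<in>B. g (m + u) + g (m - u)))"
    and "2 * integral\<^sup>L lborel g = (\<integral>u. indicator half_open_cube u * (\<Sum>m\<in>B. g (m + u) + g (m - u)) \<partial>lborel)"
proof -
  define D' where "D' = uminus ` (half_open_cube :: (real ^ 'n) set)"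
  have D'_iff: "u \<in> D' \<longleftrightarrow> - u \<in> half_open_cube" for u by (auto simp: D'_def image_iff) (metis minus_minus)
  have "D' = uminus -` half_open_cube" using D'_iff by auto
  then have D'm: "D' \<in> sets borel"
    using measurable_sets_borel[OF borel_measurable_uminus[OF measurable_ident_sets[OF refl]], of half_open_cube] by simp
  have ex: "\<exists>m\<in>B. x - m \<in> half_open_cube" if "g x \<noteq> 0" for x
    using half_open_cube_exists[of x] supp that norm_half_open_cube_le by blast
  have un: "m = m'" if "m \<in> B" "m' \<in> B" "x - m \<in> half_open_cube" "x - m' \<in> half_open_cube" for x m m'
    using that B by (intro half_open_cube_unique[of m m' x]) auto
  have 1: "integrable lborel (\<lambda>u. indicator half_open_cube u * (\<Sum>m\<in>B. g (m + u)))"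
    by (rule integral_fundamental_domain(1)[OF g(1) B(1) half_open_cube_measurable], erule ex, erule (3) un)
  have v1: "integral\<^sup>L lborel g = (\<integral>u. indicator half_open_cube u * (\<Sum>m\<in>B. g (m + u)) \<partial>lborel)"
    by (rule integral_fundamental_domain(2)[OF g(1) B(1) half_open_cube_measurable], erule ex, erule (3) un)
  have ex': "\<exists>m\<in>B. x - m \<in> D'" if "g x \<noteq> 0" for x
  proof -
    obtain m where m: "m \<in> int_vecs" "- x - m \<in> half_open_cube" using half_open_cube_exists by blast
    have "- m \<in> int_vecs" using m by (simp add: int_vecs_def)
    moreover have "x - (- m) \<in> D'" using m by (simp add: D'_iff)
    moreover have "norm (x - (- m)) \<le> real CARD('n)"
      using norm_half_open_cube_le[OF m(2)] norm_minus_cancel[of "x + m"] by simp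
    ultimately show ?thesis using supp[OF that] by blast
  qed
  have un': "m = m'" if "m \<in> B" "m' \<in> B" "x - m \<in> D'" "x - m' \<in> D'" for x m m'
  proof -
    have "- m = - m'" using that B by (intro half_open_cube_unique[of "-m" "-m'" "-x"]) (auto simp: D'_iff int_vecs_def)
    then show ?thesis by simp
  qed
  have 2: "integrable lborel (\<lambda>u. indicator D' u * (\<Sum>m\<in>B. g (m + u)))"
    by (rule integral_fundamental_domain(1)[OF g(1) B(1) D'm], erule ex', erule (3) un')
  have v2: "integral\<^sup>L lborel g = (\<integral>u. indicator D' u * (\<Sum>m\<in>B. g (m + u)) \<partial>lborel)"
    by (rule integral_fundamental_domain(2)[OF g(1) B(1) D'm], erule ex', erule (3) un')
  have meas: "(\<lambda>u. indicator D' u * (\<Sum>m\<in>B. g (m + u))) \<in> borel_measurable borel"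
    using borel_measurable_integrable[OF 2] by simp
  have refl: "(\<lambda>u. indicator half_open_cube u * (\<Sum>m\<in>B. g (m - u))) = (\<lambda>u. (\<lambda>u. indicator D' u * (\<Sum>m\<in>B. g (m + u))) (- u))"
    by (auto simp: indicator_def D'_iff)
  have 3: "integrable lborel (\<lambda>u. indicator half_open_cube u * (\<Sum>m\<in>B. g (m - u)))"
    unfolding refl using integrable_distr_eq[of uminus lborel borel "\<lambda>u. indicator D' u * (\<Sum>m\<in>B. g (m + u))"] 2 meas
    by (simp add: lborel_distr_uminus_euclidean)
  have 4: "(\<integral>u. indicator half_open_cube u * (\<Sum>m\<in>B. g (m - u)) \<partial>lborel) = integral\<^sup>L lborel g"
    unfolding refl using integral_lborel_reflect[OF meas] v2 by simp
  show "integrable lborel (\<lambda>u. indicator half_open_cube u * (\<Sum>m\<in>B. g (m + u) + g (m - u)))"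
    using Bochner_Integration.integrable_add[OF 1 3] by (simp add: sum.distrib distrib_left)
  show "2 * integral\<^sup>L lborel g = (\<integral>u. indicator half_open_cube u * (\<Sum>m\<in>B. g (m + u) + g (m - u)) \<partial>lborel)"
    using Bochner_Integration.integral_add[OF 1 3] v1 4 by (simp add: sum.distrib distrib_left)
qed

text \<open>As the cube has volume one, the sum of the values \<open>2 * g m\<close> is its own mean
  over the cube. Subtracting it from the symmetrised integral leaves the mean of the summed second
  differences.\<close>

lemma abs_integral_sub_sum_le:
  fixes g :: "real ^ 'n \<Rightarrow> real"
  assumes g: "integrable lborel g" "g \<in> borel_measurable borel" and B: "finite B" "B \<subseteq> int_vecs"
    and supp: "\<And>x m. g x \<noteq> 0 \<Longrightarrow> m \<in> int_vecs \<Longrightarrow> norm (x - m) \<le> real CARD('n) \<Longrightarrow> m \<in> B"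
    and le: "\<And>u. u \<in> half_open_cube \<Longrightarrow> \<bar>\<Sum>m\<in>B. g (m + u) + g (m - u) - 2 * g m\<bar> \<le> E"
  shows "\<bar>integral\<^sup>L lborel g - (\<Sum>m\<in>B. g m)\<bar> \<le> E / 2"
proof -
  have "measure lborel (half_open_cube :: (real ^ 'n) set) = 1" by (simp add: measure_def emeasure_half_open_cube)
  then have "has_bochner_integral lborel (indicator (half_open_cube :: (real ^ 'n) set)) (1 :: real)"
    using has_bochner_integral_real_indicator[of "half_open_cube :: (real ^ 'n) set" lborel] by (simp add: emeasure_half_open_cube)
  then have ci: "has_bochner_integral lborel (\<lambda>u :: real ^ 'n. indicator half_open_cube u * z) z" for z :: real
    using has_bochner_integral_mult_left[of z lborel "indicator (half_open_cube :: (real ^ 'n) set)" 1] by simp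
  have h: "has_bochner_integral lborel (\<lambda>u. indicator half_open_cube u * (\<Sum>m\<in>B. g (m + u) + g (m - u))) (2 * integral\<^sup>L lborel g)"
    using integral_symmetric_cells[OF g B supp] by (simp add: has_bochner_integral_iff)
  note d = has_bochner_integral_diff[OF h ci[of "\<Sum>m\<in>B. 2 * g m"]]
  have eq: "indicator half_open_cube u * (\<Sum>m\<in>B. g (m + u) + g (m - u)) - indicator half_open_cube u * (\<Sum>m\<in>B. 2 * g m)
       = indicator half_open_cube u * (\<Sum>m\<in>B. g (m + u) + g (m - u) - 2 * g m)" for u
    by (simp add: sum_subtractf right_diff_distrib)
  have "\<bar>2 * integral\<^sup>L lborel g - (\<Sum>m\<in>B. 2 * g m)\<bar> \<le> E"
  proof -
    have bound: "\<bar>indicator half_open_cube u * (\<Sum>m\<in>B. g (m + u) + g (m - u) - 2 * g m)\<bar> \<le> indicator half_open_cube u * E" for u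
      using le[of u] by (simp add: indicator_def)
    have "\<bar>integral\<^sup>L lborel (\<lambda>u. indicator half_open_cube u * (\<Sum>m\<in>B. g (m + u) + g (m - u) - 2 * g m))\<bar>
       \<le> integral\<^sup>L lborel (\<lambda>u :: real ^ 'n. indicator half_open_cube u * E)"
    proof (rule order_trans[OF integral_abs_bound], rule integral_mono)
      show "integrable lborel (\<lambda>u :: real ^ 'n. indicator half_open_cube u * E)"
        using ci[of E] by (rule integrable.intros)
      show "integrable lborel (\<lambda>u. \<bar>indicator half_open_cube u * (\<Sum>m\<in>B. g (m + u) + g (m - u) - 2 * g m)\<bar>)"
        using d[unfolded eq, THEN integrable.intros] by (rule integrable_abs)
    qed (rule bound)
    then show ?thesis
      unfolding has_bochner_integral_integral_eq[OF d[unfolded eq]] has_bochner_integral_integral_eq[OF ci] .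
  qed
  then show ?thesis unfolding sum_distrib_left[symmetric] by linarith
qed


section \<open>Lattice points and volume of the double paraboloid\<close>

locale paraboloid =
  fixes A :: "real ^ 'n ^ 'n" and \<beta> :: "real ^ 'n" and c :: real
  assumes sym: "transpose A = A" and posdef: "positive_definite A" and c_pos: "c > 0"
begin

text \<open>The scaled body is the set of all \<open>(x, y)\<close> with \<open>\<bar>y\<bar> \<le> height R x\<close>.\<close>

definition height :: "real \<Rightarrow> real ^ 'n \<Rightarrow> real" where
  "height R x = c * R - quad_form A (x + R *\<^sub>R \<beta>) / R"

lemma inner_mult_commute: "x \<bullet> (A *v y) = y \<bullet> (A *v x)"
  by (metis sym dot_lmul_matrix inner_commute transpose_matrix_vector)

lemma quad_form_add: "quad_form A (x + h) = quad_form A x + 2 * (x \<bullet> (A *v h)) + quad_form A h"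
  using inner_mult_commute[of h x]
  by (simp add: quad_form_def matrix_vector_right_distrib inner_add_left inner_add_right)

lemma quad_form_scale: "quad_form A (r *\<^sub>R x) = r\<^sup>2 * quad_form A x"
  by (simp add: quad_form_def matrix_vector_mult_scaleR power2_eq_square)

lemma quad_form_nonneg: "quad_form A x \<ge> 0"
  using posdef by (cases "x = 0") (auto simp: positive_definite_def quad_form_def less_imp_le)

lemma continuous_on_quad_form [continuous_intros]:
  "continuous_on S f \<Longrightarrow> continuous_on S (\<lambda>x. quad_form A (f x))"
  unfolding quad_form_def
  by (intro continuous_intros matrix_vector_mult_linear_continuous_on[THEN continuous_on_compose2, where t = UNIV]) auto

lemma quad_form_lower:
  obtains l where "l > 0" "\<And>x. l * (norm x)\<^sup>2 \<le> quad_form A x"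
proof -
  have "compact (sphere (0 :: real ^ 'n) 1)" "sphere (0 :: real ^ 'n) 1 \<noteq> {}" by simp_all
  then obtain z where z: "z \<in> sphere 0 1" "\<And>x. x \<in> sphere 0 1 \<Longrightarrow> quad_form A z \<le> quad_form A x"
    using continuous_attains_inf[of "sphere 0 1" "quad_form A"] continuous_on_quad_form[OF continuous_on_id] by blast
  show ?thesis
  proof
    have "z \<noteq> 0" using z(1) by auto
    then show "quad_form A z > 0" using posdef by (simp add: positive_definite_def)
    fix x :: "real ^ 'n"
    show "quad_form A z * (norm x)\<^sup>2 \<le> quad_form A x"
    proof (cases "x = 0")
      case False
      have "quad_form A x = (norm x)\<^sup>2 * quad_form A (x /\<^sub>R norm x)"
        using False quad_form_scale[of "norm x" "x /\<^sub>R norm x"] by simp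
      moreover have "quad_form A z \<le> quad_form A (x /\<^sub>R norm x)" using False by (intro z(2)) simp
      moreover have "quad_form A z * (norm x)\<^sup>2 \<le> quad_form A (x /\<^sub>R norm x) * (norm x)\<^sup>2"
        by (intro mult_right_mono calculation) simp
      ultimately show ?thesis by (simp only: mult.commute)
    qed (simp add: quad_form_nonneg)
  qed
qed

lemma inner_mult_bound:
  obtains k where "k > 0" "\<And>x y. \<bar>x \<bullet> (A *v y)\<bar> \<le> k * norm x * norm y"
proof -
  obtain k where k: "k > 0" "\<And>y. norm (A *v y) \<le> norm y * k"
    using bounded_linear.pos_bounded[OF matrix_vector_mul_bounded_linear[of A]] by blast
  have "\<bar>x \<bullet> (A *v y)\<bar> \<le> k * norm x * norm y" for x y
    using Cauchy_Schwarz_ineq2[of x "A *v y"] mult_left_mono[OF k(2)[of y], of "norm x"] by (simp add: mult_ac)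
  with k(1) that show ?thesis by blast
qed

text \<open>Confines everything relevant at scale \<open>R\<close> to balls of radius
  \<open>K * R\<close>, both around the origin and around the centre of the ellipsoid, with
  \<open>K\<close> independent of \<open>R\<close>.\<close>

lemma norm_le_of_quad_form_le:
  assumes "t \<ge> 0"
  obtains K where "K > 0" "\<And>R x. R \<ge> 1 \<Longrightarrow> quad_form A (x + R *\<^sub>R \<beta>) \<le> t * R\<^sup>2 \<Longrightarrow> norm (x + R *\<^sub>R \<beta>) \<le> K * R \<and> norm x \<le> K * R"
proof -
  obtain l where l: "l > 0" "\<And>x. l * (norm x)\<^sup>2 \<le> quad_form A x" using quad_form_lower by blast
  define K where "K = sqrt (t / l) + norm \<beta> + 1"
  show ?thesis
  proof
    show "K > 0" using l assms by (simp add: K_def add_nonneg_pos)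
    fix R :: real and x assume h: "R \<ge> 1" "quad_form A (x + R *\<^sub>R \<beta>) \<le> t * R\<^sup>2"
    have "(norm (x + R *\<^sub>R \<beta>))\<^sup>2 \<le> t / l * R\<^sup>2"
      using l(2)[of "x + R *\<^sub>R \<beta>"] h(2) l(1) by (simp add: field_simps)
    then have "sqrt ((norm (x + R *\<^sub>R \<beta>))\<^sup>2) \<le> sqrt (t / l * R\<^sup>2)" by (rule real_sqrt_le_mono)
    then have 1: "norm (x + R *\<^sub>R \<beta>) \<le> sqrt (t / l) * R" using h(1) by (simp add: real_sqrt_mult real_sqrt_divide)
    have "norm x \<le> norm (x + R *\<^sub>R \<beta>) + norm (R *\<^sub>R \<beta>)" using norm_triangle_ineq4[of "x + R *\<^sub>R \<beta>" "R *\<^sub>R \<beta>"] by simp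
    then have "norm x \<le> sqrt (t / l) * R + norm \<beta> * R" using 1 h(1) by (simp add: mult.commute)
    moreover have "K * R = sqrt (t / l) * R + norm \<beta> * R + R" by (simp add: K_def distrib_right)
    moreover have "0 \<le> norm \<beta> * R" using h(1) by simp
    ultimately show "norm (x + R *\<^sub>R \<beta>) \<le> K * R \<and> norm x \<le> K * R"
      using 1 h(1) by linarith
  qed
qed

definition ellipsoid_volume :: real where
  "ellipsoid_volume = measure lebesgue {x. quad_form A x \<le> 1}"

lemma closed_ellipsoid: "closed {x. quad_form A (x + b) \<le> t}"
  by (intro closed_Collect_le continuous_intros)

lemma compact_ellipsoid: "compact {x. quad_form A (x + b) \<le> t}"
proof -
  obtain l where l: "l > 0" "\<And>x. l * (norm x)\<^sup>2 \<le> quad_form A x" using quad_form_lower by blast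
  have "bounded {x. quad_form A (x + b) \<le> t}"
    unfolding bounded_iff
  proof (intro exI ballI)
    fix x assume "x \<in> {x. quad_form A (x + b) \<le> t}"
    then have "(norm (x + b))\<^sup>2 \<le> t / l" using l(2)[of "x + b"] l(1) by (simp add: field_simps)
    then have "norm (x + b) \<le> sqrt (t / l)" by (rule real_le_rsqrt)
    then show "norm x \<le> sqrt (t / l) + norm b" using norm_triangle_ineq4[of "x + b" b] by simp
  qed
  then show ?thesis using closed_ellipsoid compact_eq_bounded_closed by blast
qed

lemma measure_ellipsoid:
  assumes "t > 0"
  shows "measure lborel {x. quad_form A (x + b) \<le> t} = sqrt t ^ CARD('n) * ellipsoid_volume"
proof -
  have "{x. quad_form A (x + b) \<le> t} = (\<lambda>x. sqrt t *\<^sub>R x + (- b)) ` {x. quad_form A x \<le> 1}"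
  proof (intro equalityI subsetI)
    fix x assume x: "x \<in> {x. quad_form A (x + b) \<le> t}"
    have "quad_form A ((1 / sqrt t) *\<^sub>R (x + b)) \<le> 1"
      using x assms by (simp add: quad_form_scale power_divide)
    moreover have "x = sqrt t *\<^sub>R ((1 / sqrt t) *\<^sub>R (x + b)) + (- b)" using assms by simp
    ultimately show "x \<in> (\<lambda>x. sqrt t *\<^sub>R x + (- b)) ` {x. quad_form A x \<le> 1}" by blast
  next
    fix x assume "x \<in> (\<lambda>x. sqrt t *\<^sub>R x + (- b)) ` {x. quad_form A x \<le> 1}"
    then obtain y where "x = sqrt t *\<^sub>R y + (- b)" "quad_form A y \<le> 1" by blast
    then show "x \<in> {x. quad_form A (x + b) \<le> t}" using assms by (simp add: quad_form_scale)
  qed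
  then have "measure lebesgue {x. quad_form A (x + b) \<le> t} = sqrt t ^ CARD('n) * ellipsoid_volume"
    using measure_lebesgue_affine[of "sqrt t" "- b" "{x. quad_form A x \<le> 1}"] assms
    by (simp add: ellipsoid_volume_def)
  moreover have "{x. quad_form A (x + b) \<le> t} \<in> sets borel" using closed_ellipsoid by (rule borel_closed)
  ultimately show ?thesis by (simp add: measure_completion)
qed

section \<open>Integer points near the boundary of the base ellipsoid\<close>

lemma power_diff_le:
  fixes a b :: real
  assumes "0 \<le> b" "b \<le> a"
  shows "a ^ n - b ^ n \<le> real n * (a - b) * a ^ (n - 1)"
proof (induction n)
  case (Suc n)
  have "a ^ Suc n - b ^ Suc n = a * (a ^ n - b ^ n) + (a - b) * b ^ n" by (simp add: algebra_simps)
  also have "\<dots> \<le> a * (real n * (a - b) * a ^ (n - 1)) + (a - b) * a ^ n"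
    using Suc assms by (intro add_mono mult_left_mono power_mono) auto
  also have "\<dots> = real (Suc n) * (a - b) * a ^ (Suc n - 1)" by (cases n) (auto simp: algebra_simps)
  finally show ?case .
qed simp

text \<open>Unit cells around the points counted are disjoint and lie in the slightly wider shell
  between \<open>c R^2 - C1 R\<close> and \<open>c R^2 + C1 R\<close>. The volume of that shell is a
  difference of two ellipsoid volumes whose radii differ by a bounded amount.\<close>

lemma shell_count:
  assumes "C \<ge> 0"
  obtains C' R0 where "C' > 0" "R0 \<ge> 1"
    "\<And>R. R \<ge> R0 \<Longrightarrow> finite {m \<in> int_vecs. \<bar>height R m\<bar> \<le> C} \<and>
       real (card {m \<in> int_vecs. \<bar>height R m\<bar> \<le> C}) \<le> C' * R ^ (CARD('n) - 1)"
proof -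
  define n where "n = CARD('n)"
  have n: "n \<ge> 1" by (simp add: n_def Suc_leI)
  obtain k where k: "k > 0" "\<And>x y. \<bar>x \<bullet> (A *v y)\<bar> \<le> k * norm x * norm y" using inner_mult_bound by blast
  obtain K where K: "K > 0" "\<And>R x. R \<ge> 1 \<Longrightarrow> quad_form A (x + R *\<^sub>R \<beta>) \<le> (c + C) * R\<^sup>2 \<Longrightarrow> norm (x + R *\<^sub>R \<beta>) \<le> K * R \<and> norm x \<le> K * R"
    using norm_le_of_quad_form_le[of "c + C"] c_pos assms by auto
  \<comment> \<open>\<open>C\<close> is the width of the given shell; the next two summands bound
    the variation of the form over a cell, divided by \<open>R\<close>, and the \<open>1\<close>
    makes the inequality strict.\<close>
  define C1 where "C1 = C + 2 * k * K * n + k * n ^ 2 + 1"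
  have C1: "C1 > 0" unfolding C1_def using assms k K by (intro add_nonneg_pos add_nonneg_nonneg mult_nonneg_nonneg) auto
  obtain K1 where K1: "K1 > 0" "\<And>R x. R \<ge> 1 \<Longrightarrow> quad_form A (x + R *\<^sub>R \<beta>) \<le> (c + C1) * R\<^sup>2 \<Longrightarrow> norm (x + R *\<^sub>R \<beta>) \<le> K1 * R \<and> norm x \<le> K1 * R"
    using norm_le_of_quad_form_le[of "c + C1"] c_pos C1 by auto
  \<comment> \<open>From here on \<open>c R^2 - C1 R \<ge> C1 R\<close>, so the inner ellipsoid is
    not degenerate.\<close>
  define R0 where "R0 = max 1 (2 * C1 / c)"
  define C' where "C' = real n * (2 * C1 / sqrt c) * sqrt (c + C1) ^ (n - 1) * ellipsoid_volume + 1"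
  have ev: "ellipsoid_volume \<ge> 0" by (simp add: ellipsoid_volume_def)
  show ?thesis
  proof
    show "C' > 0" unfolding C'_def using C1 c_pos ev by (intro add_nonneg_pos mult_nonneg_nonneg) auto
    show "R0 \<ge> 1" by (simp add: R0_def)
    fix R :: real assume R0: "R \<ge> R0"
    then have R: "R \<ge> 1" "R \<ge> 2 * C1 / c" by (auto simp: R0_def)
    have RR: "R \<le> R\<^sup>2" using R by (simp add: power2_eq_square)
    define S where "S = {m \<in> int_vecs. \<bar>height R m\<bar> \<le> C}"
    define t1 where "t1 = c * R\<^sup>2 + C1 * R"
    define t2 where "t2 = c * R\<^sup>2 - C1 * R"
    define q where "q x = quad_form A (x + R *\<^sub>R \<beta>)" for x
    define Sh where "Sh = {x. q x \<le> t1} - {x. q x \<le> t2}"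
    have "2 * C1 \<le> c * R" using R(2) c_pos by (simp add: field_simps)
    then have "2 * C1 * R \<le> c * R * R" using R by (intro mult_right_mono) auto
    then have t2: "t2 \<ge> C1 * R" by (simp add: t2_def power2_eq_square)
    then have t2p: "t2 > 0" using C1 R by (smt (verit) mult_pos_pos)
    have t12: "t2 \<le> t1" using C1 R by (simp add: t1_def t2_def)
    have Sq: "\<bar>q m - c * R\<^sup>2\<bar> \<le> C * R" "norm (m + R *\<^sub>R \<beta>) \<le> K * R" if "m \<in> S" for m
    proof -
      have "\<bar>height R m\<bar> * R \<le> C * R" using that R by (intro mult_right_mono) (auto simp: S_def)
      moreover have "height R m * R = c * R\<^sup>2 - q m" using R by (simp add: height_def q_def power2_eq_square left_diff_distrib)
      moreover have "\<bar>height R m\<bar> * R = \<bar>height R m * R\<bar>" using R by (simp add: abs_mult)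
      ultimately show 1: "\<bar>q m - c * R\<^sup>2\<bar> \<le> C * R" by (simp add: abs_minus_commute)
      have "C * R \<le> C * R\<^sup>2" using RR assms by (intro mult_left_mono)
      then have "q m \<le> (c + C) * R\<^sup>2" using 1 by (simp add: distrib_right abs_le_iff)
      then show "norm (m + R *\<^sub>R \<beta>) \<le> K * R" using K(2)[OF R(1), of m] by (simp add: q_def)
    qed
    have inSh: "m + u \<in> Sh" if m: "m \<in> S" and u: "u \<in> half_open_cube" for m u
    proof -
      have nu: "norm u \<le> n" using norm_half_open_cube_le[OF u] by (simp add: n_def)
      have "q (m + u) = q m + 2 * ((m + R *\<^sub>R \<beta>) \<bullet> (A *v u)) + quad_form A u"
        using quad_form_add[of "m + R *\<^sub>R \<beta>" u] by (simp add: q_def add_ac)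
      moreover have "\<bar>(m + R *\<^sub>R \<beta>) \<bullet> (A *v u)\<bar> \<le> k * (K * R) * n"
        using k(1) K(1) R nu Sq(2)[OF m] by (intro order_trans[OF k(2)] mult_mono) auto
      moreover have "\<bar>quad_form A u\<bar> \<le> k * n * n"
        unfolding quad_form_def using k(1) nu by (intro order_trans[OF k(2)] mult_mono) auto
      ultimately have "\<bar>q (m + u) - c * R\<^sup>2\<bar> \<le> C * R + 2 * (k * (K * R) * n) + k * n * n"
        using Sq(1)[OF m] by linarith
      also have "\<dots> < C1 * R"
      proof -
        have "k * n * n \<le> k * n * n * R" using R k by (intro mult_left_mono[of 1 R "k * n * n", simplified]) auto
        then show ?thesis using R by (simp add: C1_def algebra_simps power2_eq_square)
      qed
      finally show ?thesis unfolding Sh_def t1_def t2_def by auto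
    qed
    define B where "B = (lattice_box (K1 * R + n) :: (real ^ 'n) set)"
    have suppB: "m \<in> B" if "x \<in> Sh" "m \<in> int_vecs" "norm (x - m) \<le> n" for x m
    proof -
      have "C1 * R \<le> C1 * R\<^sup>2" using RR C1 by (intro mult_left_mono) auto
      then have "q x \<le> (c + C1) * R\<^sup>2" using that(1) by (auto simp: Sh_def t1_def distrib_right)
      then have "norm x \<le> K1 * R" using K1(2)[OF R(1), of x] by (simp add: q_def)
      then have "norm m \<le> K1 * R + n" using that(3) norm_triangle_ineq4[of x "x - m"] by simp
      then show ?thesis using that(2) component_le_norm_cart[of m] unfolding B_def lattice_box_def by (auto intro: order_trans)
    qed
    have SB: "S \<subseteq> B"
    proof
      fix m assume m: "m \<in> S"
      have 0: "(0 :: real ^ 'n) \<in> half_open_cube" by (simp add: half_open_cube_def)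
      have "m + 0 \<in> Sh" by (rule inSh[OF m 0])
      then show "m \<in> B" using m by (intro suppB[of m]) (auto simp: S_def)
    qed
    have finB: "finite B" unfolding B_def by (rule finite_lattice_box)
    have meas1: "{x. q x \<le> t} \<in> sets lborel" for t unfolding q_def using borel_closed[OF closed_ellipsoid] by simp
    have fin1: "emeasure lborel {x. q x \<le> t} \<noteq> \<infinity>" for t
      unfolding q_def using emeasure_bounded_finite[OF compact_imp_bounded[OF compact_ellipsoid]] by (simp add: less_top)
    have Shm: "Sh \<in> sets lborel" unfolding Sh_def by (intro sets.Diff meas1)
    have mSh: "measure lborel Sh = measure lborel {x. q x \<le> t1} - measure lborel {x. q x \<le> t2}"
      unfolding Sh_def using t12 by (intro measure_Diff meas1 fin1) auto
    have "emeasure lborel Sh \<le> emeasure lborel {x. q x \<le> t1}" by (rule emeasure_mono) (use meas1[of t1] in \<open>auto simp: Sh_def\<close>)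
    then have finSh: "emeasure lborel Sh < \<infinity>" using fin1[of t1] by (auto simp: less_top intro: order_le_less_trans)
    have gi: "integrable lborel (indicator Sh :: _ \<Rightarrow> real)" using Shm finSh by (rule integrable_real_indicator)
    have exSh: "\<exists>m\<in>B. x - m \<in> half_open_cube" if "indicator Sh x \<noteq> (0 :: real)" for x
      using that half_open_cube_exists[of x] suppB[of x] norm_half_open_cube_le unfolding n_def by (auto simp: indicator_def split: if_splits)
    have unB: "m = m'" if "m \<in> B" "m' \<in> B" "x - m \<in> half_open_cube" "x - m' \<in> half_open_cube" for x m m'
      using that half_open_cube_unique[of m m' x] by (auto simp: B_def lattice_box_def)
    have I1: "integrable lborel (\<lambda>u. indicator half_open_cube u * (\<Sum>m\<in>B. indicator Sh (m + u) :: real))"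
      by (rule integral_fundamental_domain(1)[OF gi finB half_open_cube_measurable], erule exSh, erule (3) unB)
    have I2: "integral\<^sup>L lborel (indicator Sh :: _ \<Rightarrow> real) = (\<integral>u. indicator half_open_cube u * (\<Sum>m\<in>B. indicator Sh (m + u)) \<partial>lborel)"
      by (rule integral_fundamental_domain(2)[OF gi finB half_open_cube_measurable], erule exSh, erule (3) unB)
    have I3: "integrable lborel (\<lambda>u :: real ^ 'n. indicator half_open_cube u * real (card S))"
      by (intro integrable_mult_left integrable_real_indicator) (auto simp: emeasure_half_open_cube)
    have "real (card S) = (\<integral>u. indicator (half_open_cube :: (real ^ 'n) set) u * real (card S) \<partial>lborel)"
      by (simp add: measure_def emeasure_half_open_cube)
    also have "\<dots> \<le> integral\<^sup>L lborel (indicator Sh :: _ \<Rightarrow> real)"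
      unfolding I2
    proof (rule integral_mono[OF I3 I1])
      fix u :: "real ^ 'n"
      show "indicator half_open_cube u * real (card S) \<le> indicator half_open_cube u * (\<Sum>m\<in>B. indicator Sh (m + u))"
      proof (cases "u \<in> half_open_cube")
        case True
        have "real (card S) = (\<Sum>m\<in>S. indicator Sh (m + u))" using inSh True by simp
        also have "\<dots> \<le> (\<Sum>m\<in>B. indicator Sh (m + u))" using SB finB by (intro sum_mono2) auto
        finally show ?thesis using True by simp
      qed simp
    qed
    also have "\<dots> = measure lborel Sh" using Shm by simp
    also have "\<dots> = (sqrt t1 ^ n - sqrt t2 ^ n) * ellipsoid_volume"
      unfolding mSh q_def using t2p t12 by (simp add: measure_ellipsoid n_def left_diff_distrib)
    also have "\<dots> \<le> (real n * (2 * C1 / sqrt c) * (sqrt (c + C1) ^ (n - 1) * R ^ (n - 1))) * ellipsoid_volume"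
    proof (intro mult_right_mono ev)
      have s1: "sqrt t1 \<ge> sqrt c * R"
        using R C1 c_pos real_sqrt_le_mono[of "c * R\<^sup>2" t1] by (simp add: t1_def real_sqrt_mult)
      have s2: "sqrt t1 \<le> sqrt (c + C1) * R"
      proof -
        have "t1 \<le> (c + C1) * R\<^sup>2" using RR C1 by (simp add: t1_def distrib_right)
        then show ?thesis using R real_sqrt_le_mono[of t1 "(c + C1) * R\<^sup>2"] by (simp add: real_sqrt_mult)
      qed
      have s12: "sqrt t2 \<le> sqrt t1" using t12 by simp
      \<comment> \<open>The difference of the roots is \<open>t1 - t2 = 2 * C1 * R\<close> divided
        by their sum, and the sum is at least \<open>sqrt c * R\<close>.\<close>
      have "(sqrt t1 - sqrt t2) * (sqrt c * R) \<le> (sqrt t1 - sqrt t2) * (sqrt t1 + sqrt t2)"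
        using s1 s12 real_sqrt_ge_zero[of t2] t2p by (intro mult_left_mono) linarith+
      also have "\<dots> = t1 - t2" using t2p t12 by (simp add: left_diff_distrib distrib_left)
      also have "\<dots> = (2 * C1 / sqrt c) * (sqrt c * R)" using c_pos by (simp add: t1_def t2_def)
      finally have "sqrt t1 - sqrt t2 \<le> 2 * C1 / sqrt c" using c_pos R by (simp add: pos_le_divide_eq)
      moreover have "sqrt t1 ^ (n - 1) \<le> (sqrt (c + C1) * R) ^ (n - 1)" using s2 t12 t2p by (intro power_mono) auto
      ultimately show "sqrt t1 ^ n - sqrt t2 ^ n \<le> real n * (2 * C1 / sqrt c) * (sqrt (c + C1) ^ (n - 1) * R ^ (n - 1))"
        using s12 t2p t12 C1 c_pos unfolding power_mult_distrib[symmetric]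
        by (intro order_trans[OF power_diff_le] mult_mono) auto
    qed
    also have "\<dots> \<le> C' * R ^ (n - 1)" using R by (simp add: C'_def algebra_simps)
    finally show "finite {m \<in> int_vecs. \<bar>height R m\<bar> \<le> C} \<and>
       real (card {m \<in> int_vecs. \<bar>height R m\<bar> \<le> C}) \<le> C' * R ^ (CARD('n) - 1)"
      using finite_subset[OF SB finB] by (simp add: S_def n_def)
  qed
qed

end


text \<open>If \<open>a\<close> is farther from zero than \<open>\<bar>l\<bar> + e\<close>, all
  three arguments lie on the same side of the kink, and at most the curvature term
  \<open>2 * e\<close> remains.\<close>

lemma second_difference_pos_part_le:
  fixes a l e :: real
  assumes "e \<ge> 0"
  shows "\<bar>max (a + l - e) 0 + max (a - l - e) 0 - 2 * max a 0\<bar> \<le> 2 * e + (if \<bar>a\<bar> \<le> \<bar>l\<bar> + e then 2 * (\<bar>l\<bar> + e) else 0)"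
  using assms by (auto simp: max_def abs_if split: if_splits)

lemma card_Ints_abs_le:
  fixes h :: real
  shows "real (card {y :: real. y \<in> \<int> \<and> \<bar>y\<bar> \<le> h}) = (if h \<ge> 0 then 2 * of_int \<lfloor>h\<rfloor> + 1 else (0::real))"
proof (cases "h \<ge> 0")
  case True
  have "{y \<in> \<int>. \<bar>y\<bar> \<le> h} = (of_int ` {- \<lfloor>h\<rfloor>..\<lfloor>h\<rfloor>} :: real set)"
  proof (intro equalityI subsetI)
    fix y :: real assume "y \<in> {y \<in> \<int>. \<bar>y\<bar> \<le> h}"
    then obtain k where k: "y = of_int k" "\<bar>y\<bar> \<le> h" by (auto elim: Ints_cases)
    then have "\<bar>k\<bar> \<le> \<lfloor>h\<rfloor>" by (simp add: le_floor_iff)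
    then show "y \<in> of_int ` {- \<lfloor>h\<rfloor>..\<lfloor>h\<rfloor>}" using k by (auto simp: abs_le_iff)
  next
    fix y :: real assume "y \<in> of_int ` {- \<lfloor>h\<rfloor>..\<lfloor>h\<rfloor>}"
    then obtain k where k: "y = of_int k" "\<bar>k\<bar> \<le> \<lfloor>h\<rfloor>" by (auto simp: abs_le_iff)
    then show "y \<in> {y \<in> \<int>. \<bar>y\<bar> \<le> h}" by (simp add: le_floor_iff)
  qed
  then have "card {y \<in> \<int>. \<bar>y\<bar> \<le> h} = card {- \<lfloor>h\<rfloor>..\<lfloor>h\<rfloor>}" by (simp add: card_image inj_on_def)
  then show ?thesis using True by simp
next
  case False
  then have "{y \<in> \<int>. \<bar>y\<bar> \<le> h} = {}" by (auto simp: abs_le_iff)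
  then have "card {y \<in> \<int>. \<bar>y\<bar> \<le> h} = 0" by (simp only: card.empty)
  then show ?thesis using False by simp
qed

context paraboloid
begin

lemma height_shift:
  assumes "R > 0"
  shows "height R (m + u) = height R m - 2 * ((m + R *\<^sub>R \<beta>) \<bullet> (A *v u)) / R - quad_form A u / R"
  using quad_form_add[of "m + R *\<^sub>R \<beta>" u] by (simp add: height_def add_ac add_divide_distrib)

lemma continuous_on_height [continuous_intros]:
  "continuous_on S f \<Longrightarrow> continuous_on S (\<lambda>x. height R (f x))"
  unfolding height_def divide_inverse by (intro continuous_intros)

lemma height_nonneg_iff: "R > 0 \<Longrightarrow> height R x \<ge> 0 \<longleftrightarrow> quad_form A (x + R *\<^sub>R \<beta>) \<le> c * R\<^sup>2"
  by (simp add: height_def field_simps power2_eq_square)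

lemma integrable_height:
  assumes "R > 0"
  shows "integrable lborel (\<lambda>x. max (height R x) 0)" "(\<lambda>x. max (height R x) 0) \<in> borel_measurable borel"
proof -
  have cont: "continuous_on S (\<lambda>x. max (height R x) 0)" for S
    using continuous_on_max[OF continuous_on_height[where f = "\<lambda>x. x" and S = S and R = R] continuous_on_const[where c = 0]] by simp
  then show "(\<lambda>x. max (height R x) 0) \<in> borel_measurable borel" by (rule borel_measurable_continuous_onI)
  define E where "E = {x. quad_form A (x + R *\<^sub>R \<beta>) \<le> c * R\<^sup>2}"
  have "integrable lborel (\<lambda>x. indicator E x *\<^sub>R max (height R x) 0)"
    unfolding E_def by (rule borel_integrable_compact[OF compact_ellipsoid cont])
  also have "(\<lambda>x. indicator E x *\<^sub>R max (height R x) 0) = (\<lambda>x. max (height R x) 0)"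
  proof
    fix x
    show "indicator E x *\<^sub>R max (height R x) 0 = max (height R x) 0"
      using height_nonneg_iff[OF assms, of x] by (cases "height R x \<ge> 0") (simp_all add: E_def)
  qed
  finally show "integrable lborel (\<lambda>x. max (height R x) 0)" .
qed

lemma riemann_sum_height:
  obtains C R0 where "C > 0" "R0 \<ge> 1"
    "\<And>R B. R \<ge> R0 \<Longrightarrow> finite B \<Longrightarrow> B \<subseteq> int_vecs \<Longrightarrow> {m \<in> int_vecs. height R m \<ge> 0} \<subseteq> B \<Longrightarrow>
       \<bar>(\<integral>x. max (height R x) 0 \<partial>lborel) - (\<Sum>m\<in>B. max (height R m) 0)\<bar> \<le> C * R ^ (CARD('n) - 1)"
proof -
  define n where "n = CARD('n)"
  have n: "n \<ge> 1" by (simp add: n_def Suc_leI)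
  obtain k where k: "k > 0" "\<And>x y. \<bar>x \<bullet> (A *v y)\<bar> \<le> k * norm x * norm y" using inner_mult_bound by blast
  obtain K where K: "K > 0" "\<And>R x. R \<ge> 1 \<Longrightarrow> quad_form A (x + R *\<^sub>R \<beta>) \<le> c * R\<^sup>2 \<Longrightarrow> norm (x + R *\<^sub>R \<beta>) \<le> K * R \<and> norm x \<le> K * R"
    using norm_le_of_quad_form_le[of c] c_pos by auto
  define K2 where "K2 = n * (K + n) + norm \<beta>"
  define C3 where "C3 = 2 * k * K2 * n + k * n\<^sup>2"
  have K2: "K2 \<ge> 0" using K by (simp add: K2_def)
  have C3: "C3 \<ge> 0" using K2 k by (simp add: C3_def)
  obtain C' R0 where C': "C' > 0" "R0 \<ge> 1"
    "\<And>R. R \<ge> R0 \<Longrightarrow> finite {m \<in> int_vecs. \<bar>height R m\<bar> \<le> C3} \<and>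
       real (card {m \<in> int_vecs. \<bar>height R m\<bar> \<le> C3}) \<le> C' * R ^ (CARD('n) - 1)"
    using shell_count[OF C3] by blast
  define K4 where "K4 = 2 * K + 2 * n + 1"
  have K4: "K4 > 0" using K by (simp add: K4_def)
  define C where "C = 2 * k * n\<^sup>2 * K4 ^ n + 2 * C3 * C' + 1"
  show ?thesis
  proof
    show "C > 0" unfolding C_def using k K4 C3 C' by (intro add_nonneg_pos add_nonneg_nonneg mult_nonneg_nonneg) auto
    show "R0 \<ge> 1" by fact
    fix R :: real and B :: "(real ^ 'n) set"
    assume h: "R \<ge> R0" "finite B" "B \<subseteq> int_vecs" "{m \<in> int_vecs. height R m \<ge> 0} \<subseteq> B"
    have R: "R \<ge> 1" "R > 0" using h(1) C'(2) by auto
    define g where "g x = max (height R x) 0" for x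
    define B' where "B' = (lattice_box (K * R + n) :: (real ^ 'n) set)"
    define S where "S = {m \<in> int_vecs. \<bar>height R m\<bar> \<le> C3}"
    have finB': "finite B'" unfolding B'_def by (rule finite_lattice_box)
    have B'_int: "B' \<subseteq> int_vecs" by (auto simp: B'_def lattice_box_def)
    have supp: "m \<in> B'" if "g x \<noteq> 0" "m \<in> int_vecs" "norm (x - m) \<le> real CARD('n)" for x m
    proof -
      have "height R x \<ge> 0" using that(1) by (auto simp: g_def max_def split: if_splits)
      then have "norm x \<le> K * R" using height_nonneg_iff[OF R(2)] K(2)[OF R(1)] by blast
      then have "norm m \<le> K * R + n" using that(3) norm_triangle_ineq4[of x "x - m"] by (simp add: n_def)
      then show ?thesis using that(2) component_le_norm_cart[of m] unfolding B'_def lattice_box_def by (auto intro: order_trans)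
    qed
    have normB': "norm (m + R *\<^sub>R \<beta>) \<le> K2 * R" if "m \<in> B'" for m
    proof -
      have "norm m \<le> (\<Sum>i\<in>UNIV. \<bar>m $ i\<bar>)" by (rule norm_le_l1_cart)
      also have "\<dots> \<le> (\<Sum>i\<in>(UNIV :: 'n set). K * R + n)" using that by (intro sum_mono) (auto simp: B'_def lattice_box_def)
      also have "\<dots> = n * (K * R + n)" by (simp add: n_def)
      also have "\<dots> \<le> n * ((K + n) * R)" using R mult_left_mono[of 1 R "real n"] by (intro mult_left_mono) (auto simp: distrib_right)
      finally have "norm m \<le> n * (K + n) * R" by (simp add: mult.assoc)
      moreover have "norm (R *\<^sub>R \<beta>) = norm \<beta> * R" using R by simp
      ultimately show ?thesis using norm_triangle_ineq[of m "R *\<^sub>R \<beta>"] unfolding K2_def distrib_right by linarith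
    qed
    \<comment> \<open>The slope term \<open>l\<close> is bounded because a gradient of order
      \<open>R\<close> is divided by \<open>R\<close>, and \<open>e\<close> is
      \<open>O(1 / R)\<close>. So the kink matters only at points of height at most
      \<open>C3\<close> in modulus, which are those of the shell \<open>S\<close>.\<close>
    have diff: "\<bar>g (m + u) + g (m - u) - 2 * g m\<bar> \<le> 2 * (k * n\<^sup>2 / R) + 2 * C3 * indicator S m" if m: "m \<in> B'" and u: "u \<in> half_open_cube" for m u
    proof -
      have nu: "norm u \<le> n" using norm_half_open_cube_le[OF u] by (simp add: n_def)
      define l where "l = - 2 * ((m + R *\<^sub>R \<beta>) \<bullet> (A *v u)) / R"
      define e where "e = quad_form A u / R"
      have e: "0 \<le> e" using R quad_form_nonneg by (simp add: e_def)
      have Qu: "quad_form A u \<le> k * n\<^sup>2"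
      proof -
        have "\<bar>quad_form A u\<bar> \<le> k * n * n"
          unfolding quad_form_def using k(1) nu by (intro order_trans[OF k(2)] mult_mono) auto
        then show ?thesis by (simp add: power2_eq_square)
      qed
      have eR: "e \<le> k * n\<^sup>2 / R" unfolding e_def using Qu R by (intro divide_right_mono) auto
      have e2: "e \<le> k * n\<^sup>2"
      proof -
        have "k * n\<^sup>2 / R \<le> k * n\<^sup>2 / 1" using R k by (intro divide_left_mono) auto
        then show ?thesis using eR by simp
      qed
      have l: "\<bar>l\<bar> \<le> 2 * k * K2 * n"
      proof -
        have "\<bar>(m + R *\<^sub>R \<beta>) \<bullet> (A *v u)\<bar> \<le> k * (K2 * R) * n"
          using k(1) K2 R nu normB'[OF m] by (intro order_trans[OF k(2)] mult_mono) auto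
        then have "2 * \<bar>(m + R *\<^sub>R \<beta>) \<bullet> (A *v u)\<bar> / R \<le> 2 * (k * (K2 * R) * n) / R"
          using R by (intro divide_right_mono) auto
        then show ?thesis using R by (simp add: l_def abs_mult)
      qed
      have "height R (m + u) = height R m + l - e" using height_shift[OF R(2), of m u] by (simp add: l_def e_def)
      moreover have "height R (m - u) = height R m - l - e"
        using height_shift[OF R(2), of m "- u"] quad_form_scale[of "-1" u] linear_neg[OF matrix_vector_mul_linear, of A u] by (simp add: l_def e_def)
      ultimately have "\<bar>g (m + u) + g (m - u) - 2 * g m\<bar> \<le> 2 * e + (if \<bar>height R m\<bar> \<le> \<bar>l\<bar> + e then 2 * (\<bar>l\<bar> + e) else 0)"
        unfolding g_def using second_difference_pos_part_le[OF e] by simp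
      also have "\<dots> \<le> 2 * (k * n\<^sup>2 / R) + 2 * C3 * indicator S m"
        using eR l e2 B'_int m C3 by (auto simp: C3_def S_def indicator_def)
      finally show ?thesis .
    qed
    have "\<bar>integral\<^sup>L lborel g - (\<Sum>m\<in>B'. g m)\<bar> \<le> (card B' * (2 * (k * n\<^sup>2 / R)) + 2 * C3 * card S) / 2"
    proof (rule abs_integral_sub_sum_le[OF _ _ finB' B'_int])
      show "integrable lborel g" "g \<in> borel_measurable borel" using integrable_height[OF R(2)] by (simp_all add: g_def[abs_def])
      show "m \<in> B'" if "g x \<noteq> 0" "m \<in> int_vecs" "norm (x - m) \<le> real CARD('n)" for x m using supp that .
      fix u :: "real ^ 'n" assume u: "u \<in> half_open_cube"
      have "\<bar>\<Sum>m\<in>B'. g (m + u) + g (m - u) - 2 * g m\<bar> \<le> (\<Sum>m\<in>B'. 2 * (k * n\<^sup>2 / R) + 2 * C3 * indicator S m)"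
        by (intro order_trans[OF sum_abs] sum_mono diff u)
      also have "\<dots> = card B' * (2 * (k * n\<^sup>2 / R)) + 2 * C3 * (\<Sum>m\<in>B'. indicator S m)"
        by (simp add: sum.distrib sum_distrib_left)
      also have "(\<Sum>m\<in>B'. indicator S m :: real) = card (B' \<inter> S)"
        using finB' by (simp add: indicator_def sum.If_cases)
      also have "card B' * (2 * (k * n\<^sup>2 / R)) + 2 * C3 * real (card (B' \<inter> S)) \<le> card B' * (2 * (k * n\<^sup>2 / R)) + 2 * C3 * real (card S)"
        using C3 C'(3)[OF h(1)] by (intro add_left_mono mult_left_mono) (auto intro!: card_mono simp: S_def)
      finally show "\<bar>\<Sum>m\<in>B'. g (m + u) + g (m - u) - 2 * g m\<bar> \<le> card B' * (2 * (k * n\<^sup>2 / R)) + 2 * C3 * real (card S)" .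
    qed
    also have "\<dots> \<le> card B' * (2 * (k * n\<^sup>2 / R)) + 2 * C3 * card S"
    proof -
      have "0 \<le> card B' * (2 * (k * n\<^sup>2 / R)) + 2 * C3 * card S"
        using k R C3 by (intro add_nonneg_nonneg mult_nonneg_nonneg) auto
      moreover have "z / 2 \<le> z" if "0 \<le> z" for z :: real using that by simp
      ultimately show ?thesis by blast
    qed
    also have "\<dots> \<le> (K4 * R) ^ n * (2 * (k * n\<^sup>2 / R)) + 2 * C3 * (C' * R ^ (n - 1))"
    proof (intro add_mono mult_right_mono mult_left_mono)
      have "real (card B') \<le> (2 * (K * R + n) + 1) ^ n"
        unfolding B'_def n_def using K R by (intro card_lattice_box_le) auto
      also have "\<dots> \<le> (K4 * R) ^ n"
      proof (rule power_mono)
        have "real n \<le> n * R" using R mult_left_mono[of 1 R "real n"] by simp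
        then show "2 * (K * R + n) + 1 \<le> K4 * R" using R by (simp add: K4_def algebra_simps)
      qed (use K R in auto)
      finally show "real (card B') \<le> (K4 * R) ^ n" .
      show "real (card S) \<le> C' * R ^ (n - 1)" using C'(3)[OF h(1)] by (simp add: S_def n_def)
    qed (use k R C3 in auto)
    also have "(K4 * R) ^ n * (2 * (k * n\<^sup>2 / R)) = 2 * k * n\<^sup>2 * K4 ^ n * R ^ (n - 1)"
    proof -
      have "R ^ n = R * R ^ (n - 1)" using n by (simp add: power_eq_if)
      then show ?thesis using R by (simp add: power_mult_distrib)
    qed
    also have "2 * k * n\<^sup>2 * K4 ^ n * R ^ (n - 1) + 2 * C3 * (C' * R ^ (n - 1)) \<le> C * R ^ (n - 1)"
      using R by (simp add: C_def algebra_simps)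
    finally have "\<bar>integral\<^sup>L lborel g - (\<Sum>m\<in>B'. g m)\<bar> \<le> C * R ^ (n - 1)" .
    moreover have "(\<Sum>m\<in>B'. g m) = (\<Sum>m\<in>B. g m)"
    proof -
      have 1: "(\<Sum>m\<in>B \<inter> B'. g m) = (\<Sum>m\<in>B'. g m)"
        using h B'_int finB' by (intro sum.mono_neutral_left) (auto simp: g_def max_def split: if_splits)
      have "m \<in> B'" if "g m \<noteq> 0" "m \<in> B" for m using supp[of m m] that h(3) by auto
      then have 2: "(\<Sum>m\<in>B \<inter> B'. g m) = (\<Sum>m\<in>B. g m)"
        using h by (intro sum.mono_neutral_left) auto
      show ?thesis using 1 2 by simp
    qed
    ultimately show "\<bar>(\<integral>x. max (height R x) 0 \<partial>lborel) - (\<Sum>m\<in>B. max (height R m) 0)\<bar> \<le> C * R ^ (CARD('n) - 1)"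
      by (simp add: g_def[abs_def] n_def)
  qed
qed

section \<open>Lattice points and volume by slicing\<close>

lemma mem_scaled_paraboloid_iff:
  assumes "R > 0"
  shows "inverse R *\<^sub>R (x, y) \<in> double_paraboloid A \<beta> c \<longleftrightarrow> \<bar>y\<bar> \<le> height R x"
proof -
  have "x /\<^sub>R R + \<beta> = inverse R *\<^sub>R (x + R *\<^sub>R \<beta>)" using assms by (simp add: scaleR_add_right)
  then have q: "quad_form A (x /\<^sub>R R + \<beta>) = quad_form A (x + R *\<^sub>R \<beta>) / R\<^sup>2"
    by (simp add: quad_form_scale power_inverse divide_inverse mult.commute)
  have y: "\<bar>inverse R * y\<bar> = \<bar>y\<bar> / R" using assms by (simp add: abs_mult divide_inverse)
  have "inverse R *\<^sub>R (x, y) \<in> double_paraboloid A \<beta> c \<longleftrightarrow> \<bar>y\<bar> / R \<le> c - quad_form A (x + R *\<^sub>R \<beta>) / R\<^sup>2"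
    unfolding double_paraboloid_def scaleR_Pair mem_Collect_eq prod.case real_scaleR_def q y ..
  also have "\<dots> \<longleftrightarrow> \<bar>y\<bar> \<le> (c - quad_form A (x + R *\<^sub>R \<beta>) / R\<^sup>2) * R" using assms by (rule pos_divide_le_eq)
  also have "(c - quad_form A (x + R *\<^sub>R \<beta>) / R\<^sup>2) * R = height R x"
    using assms by (simp add: height_def left_diff_distrib power2_eq_square)
  finally show ?thesis .
qed

text \<open>Fibres over points of negative height are empty, so enlarging the index set adds
  nothing.\<close>

lemma scaled_lattice_points_eq:
  assumes R: "R > 0" and B: "B \<subseteq> int_vecs" "{m \<in> int_vecs. height R m \<ge> 0} \<subseteq> B"
  shows "{v \<in> integer_lattice. inverse R *\<^sub>R v \<in> double_paraboloid A \<beta> c} = (SIGMA m:B. {y \<in> \<int>. \<bar>y\<bar> \<le> height R m})"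
proof -
  have lat: "(x, y) \<in> integer_lattice \<longleftrightarrow> x \<in> int_vecs \<and> y \<in> \<int>" for x :: "real ^ 'n" and y :: real
    by (auto simp: integer_lattice_def int_vecs_def Basis_prod_def Basis_vec_def inner_axis)
  show ?thesis
  proof (intro equalityI subsetI)
    fix v assume v: "v \<in> {v \<in> integer_lattice. inverse R *\<^sub>R v \<in> double_paraboloid A \<beta> c}"
    obtain x y where xy: "v = (x, y)" by (cases v)
    have 1: "x \<in> int_vecs" "y \<in> \<int>" "\<bar>y\<bar> \<le> height R x"
      using v mem_scaled_paraboloid_iff[OF R] lat by (simp_all add: xy del: scaleR_Pair)
    then have "height R x \<ge> 0" by (meson abs_ge_zero order_trans)
    then show "v \<in> (SIGMA m:B. {y \<in> \<int>. \<bar>y\<bar> \<le> height R m})" using 1 B(2) by (auto simp: xy)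
  next
    fix v assume "v \<in> (SIGMA m:B. {y \<in> \<int>. \<bar>y\<bar> \<le> height R m})"
    then show "v \<in> {v \<in> integer_lattice. inverse R *\<^sub>R v \<in> double_paraboloid A \<beta> c}"
      using mem_scaled_paraboloid_iff[OF R] lat B(1) by (auto simp del: scaleR_Pair)
  qed
qed

text \<open>A fibre has \<open>2 \<lfloor>h\<rfloor> + 1 = 2 h - 2 (frac h - 1/2)\<close> points:
  the central point \<open>y = 0\<close> is exactly what gives the sawtooth mean zero. For
  \<open>h < 0\<close> both terms vanish, by the cutoff built into \<open>saw\<close>.\<close>

lemma lattice_count_eq:
  assumes R: "R > 0" and B: "finite B" "B \<subseteq> int_vecs" "{m \<in> int_vecs. height R m \<ge> 0} \<subseteq> B"
    and L: "\<And>m. m \<in> B \<Longrightarrow> - real L \<le> height R m" "\<And>m. m \<in> B \<Longrightarrow> height R m < real L"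
  shows "real (lattice_count (double_paraboloid A \<beta> c) R) = 2 * (\<Sum>m\<in>B. max (height R m) 0) - 2 * (\<Sum>m\<in>B. saw L (height R m))"
proof -
  have "{v \<in> integer_lattice. inverse R *\<^sub>R v \<in> double_paraboloid A \<beta> c} = (SIGMA m:B. {y \<in> \<int>. \<bar>y\<bar> \<le> height R m})"
    by (rule scaled_lattice_points_eq[OF R B(2,3)])
  moreover have "card (SIGMA m:B. {y \<in> \<int>. \<bar>y\<bar> \<le> height R m}) = (\<Sum>m\<in>B. card {y \<in> \<int>. \<bar>y\<bar> \<le> height R m})"
    using B(1) finite_abs_int_segment by (intro card_SigmaI) auto
  ultimately have "real (lattice_count (double_paraboloid A \<beta> c) R) = (\<Sum>m\<in>B. real (card {y \<in> \<int>. \<bar>y\<bar> \<le> height R m}))"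
    by (simp add: lattice_count_def)
  also have "\<dots> = (\<Sum>m\<in>B. 2 * max (height R m) 0 - 2 * saw L (height R m))"
  proof (rule sum.cong[OF refl])
    fix m assume m: "m \<in> B"
    show "real (card {y \<in> \<int>. \<bar>y\<bar> \<le> height R m}) = 2 * max (height R m) 0 - 2 * saw L (height R m)"
      using saw_nonneg_arg[of "height R m" L] saw_neg_arg[of L "height R m"] L[OF m]
      by (cases "height R m \<ge> 0") (auto simp: card_Ints_abs_le frac_def)
  qed
  finally show ?thesis by (simp add: sum_subtractf sum_distrib_left)
qed

text \<open>Cavalieri: the fibre of the scaled body over \<open>x\<close> is empty or an interval of
  length twice the height.\<close>

lemma volume_scaled:
  assumes R: "R > 0"
  shows "measure lebesgue (double_paraboloid A \<beta> c) * R ^ (CARD('n) + 1) = 2 * (\<integral>x. max (height R x) 0 \<partial>lborel)"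
proof -
  define S where "S = {(x, y). \<bar>y\<bar> \<le> height R x}"
  have Simg: "S = (\<lambda>v. R *\<^sub>R v + 0) ` double_paraboloid A \<beta> c"
  proof (intro equalityI subsetI)
    fix v assume "v \<in> S"
    then have "inverse R *\<^sub>R v \<in> double_paraboloid A \<beta> c" using mem_scaled_paraboloid_iff[OF R] by (auto simp: S_def simp del: scaleR_Pair)
    then show "v \<in> (\<lambda>v. R *\<^sub>R v + 0) ` double_paraboloid A \<beta> c" using R by (intro image_eqI[of _ _ "inverse R *\<^sub>R v"]) auto
  next
    fix v assume "v \<in> (\<lambda>v. R *\<^sub>R v + 0) ` double_paraboloid A \<beta> c"
    then obtain w where "w \<in> double_paraboloid A \<beta> c" "v = R *\<^sub>R w" by auto
    then have "inverse R *\<^sub>R v \<in> double_paraboloid A \<beta> c" using R by simp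
    then show "v \<in> S" using mem_scaled_paraboloid_iff[OF R, of "fst v" "snd v"] by (simp add: S_def case_prod_unfold)
  qed
  have "measure lebesgue S = R ^ DIM((real ^ 'n) \<times> real) * measure lebesgue (double_paraboloid A \<beta> c)"
    unfolding Simg measure_lebesgue_affine using R by simp
  then have 1: "measure lebesgue S = measure lebesgue (double_paraboloid A \<beta> c) * R ^ (CARD('n) + 1)"
    by (simp add: mult.commute)
  have "closed S"
  proof -
    have "S = {v. \<bar>snd v\<bar> \<le> height R (fst v)}" by (auto simp: S_def)
    then show ?thesis
      by (simp only: closed_Collect_le continuous_on_height continuous_on_fst continuous_on_snd continuous_on_id continuous_on_rabs)
  qed
  then have Sm: "S \<in> sets borel" by (rule borel_closed)
  have slice: "emeasure lborel (Pair x -` S) = ennreal (2 * max (height R x) 0)" for x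
  proof -
    have "Pair x -` S = (if height R x \<ge> 0 then {- height R x..height R x} else {})"
      by (auto simp: S_def abs_le_iff)
    then show ?thesis by (simp add: max_def)
  qed
  have "emeasure lborel S = (\<integral>\<^sup>+x. ennreal (2 * max (height R x) 0) \<partial>lborel)"
  proof -
    have "S \<in> sets (lborel \<Otimes>\<^sub>M lborel)" unfolding lborel_prod using Sm by simp
    from lborel.emeasure_pair_measure_alt[OF this] show ?thesis unfolding lborel_prod slice .
  qed
  also have "\<dots> = ennreal (\<integral>x. 2 * max (height R x) 0 \<partial>lborel)"
    using integrable_height(1)[OF R] by (intro nn_integral_eq_integral) auto
  finally have "measure lborel S = 2 * (\<integral>x. max (height R x) 0 \<partial>lborel)"
    by (simp add: measure_def integral_nonneg_AE)
  then show ?thesis using 1 Sm by (simp add: measure_completion)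
qed

end


section \<open>Lattice points on the boundary\<close>

definition int_quad_form :: "('n::finite \<Rightarrow> 'n \<Rightarrow> int) \<Rightarrow> ('n \<Rightarrow> int) \<Rightarrow> int" where
  "int_quad_form G m = (\<Sum>i\<in>UNIV. \<Sum>j\<in>UNIV. G i j * m i * m j)"

text \<open>Taylor expansion along a line; when \<open>v\<close> is isotropic modulo
  \<open>p\<close>, the term in \<open>t^2\<close> disappears and a linear congruence is
  left.\<close>

lemma int_quad_form_add:
  assumes "\<And>i j. G i j = G j i"
  shows "int_quad_form G (\<lambda>i. m i + t * v i) = int_quad_form G m + 2 * t * (\<Sum>i\<in>UNIV. m i * (\<Sum>j\<in>UNIV. G i j * v j)) + t\<^sup>2 * int_quad_form G v"
proof -
  have "(\<Sum>i\<in>UNIV. \<Sum>j\<in>UNIV. G i j * v i * m j) = (\<Sum>j\<in>UNIV. \<Sum>i\<in>UNIV. G i j * v i * m j)" by (rule sum.swap)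
  also have "\<dots> = (\<Sum>i\<in>UNIV. \<Sum>j\<in>UNIV. G i j * m i * v j)"
    using assms by (intro sum.cong refl) (metis mult.assoc mult.commute)
  finally have sw: "(\<Sum>i\<in>UNIV. \<Sum>j\<in>UNIV. G i j * v i * m j) = (\<Sum>i\<in>UNIV. \<Sum>j\<in>UNIV. G i j * m i * v j)" .
  have "int_quad_form G (\<lambda>i. m i + t * v i) = (\<Sum>i\<in>UNIV. \<Sum>j\<in>UNIV. G i j * m i * m j + t * (G i j * m i * v j) + t * (G i j * v i * m j) + t\<^sup>2 * (G i j * v i * v j))"
    unfolding int_quad_form_def by (intro sum.cong refl) (simp add: algebra_simps power2_eq_square)
  also have "\<dots> = int_quad_form G m + t * (\<Sum>i\<in>UNIV. \<Sum>j\<in>UNIV. G i j * m i * v j) + t * (\<Sum>i\<in>UNIV. \<Sum>j\<in>UNIV. G i j * v i * m j) + t\<^sup>2 * int_quad_form G v"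
    unfolding int_quad_form_def by (simp only: sum.distrib sum_distrib_left)
  also have "(\<Sum>i\<in>UNIV. \<Sum>j\<in>UNIV. G i j * m i * v j) = (\<Sum>i\<in>UNIV. m i * (\<Sum>j\<in>UNIV. G i j * v j))"
    by (simp add: sum_distrib_left mult_ac)
  finally show ?thesis unfolding sw by (simp add: sum_distrib_left mult_ac)
qed

lemma int_quad_form_mod:
  "[int_quad_form G (\<lambda>i. m i mod p) = int_quad_form G m] (mod p)"
  unfolding int_quad_form_def by (intro cong_sum cong_mult cong_refl) (simp_all add: cong_def)

text \<open>Euclid's argument: a prime factor of \<open>(fact N)^2 * \<Delta> + 1\<close> cannot be
  at most \<open>N\<close>, and \<open>\<Delta>\<close> times this number is
  \<open>(fact N * \<Delta>)^2 + \<Delta>\<close>.\<close>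

lemma exists_large_prime_dividing:
  fixes \<Delta> :: int and N :: nat
  assumes "\<Delta> > 0"
  obtains p :: nat and x :: int where "prime p" "p > N" "int p dvd x\<^sup>2 + \<Delta>"
proof -
  define k :: nat where "k = fact N"
  have k: "k \<ge> 1" by (simp add: k_def)
  define q where "q = k\<^sup>2 * nat \<Delta> + 1"
  have "q \<noteq> 1" using k assms by (simp add: q_def)
  then obtain p where p: "prime p" "p dvd q" using prime_factor_nat by blast
  have "p > N"
  proof (rule ccontr)
    assume "\<not> p > N"
    then have "p dvd k" unfolding k_def using p(1) by (intro dvd_fact) (use prime_ge_1_nat[OF p(1)] in auto)
    then have "p dvd k\<^sup>2 * nat \<Delta>" by (simp add: power2_eq_square)
    then have "p dvd 1" using p(2) unfolding q_def by (simp only: dvd_add_right_iff)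
    then show False using p(1) by auto
  qed
  moreover have "int p dvd (int k * \<Delta>)\<^sup>2 + \<Delta>"
  proof -
    have "int q = (int k)\<^sup>2 * \<Delta> + 1" using assms by (simp add: q_def)
    then have "(int k * \<Delta>)\<^sup>2 + \<Delta> = \<Delta> * int q" by (simp add: algebra_simps power2_eq_square)
    then show ?thesis using p(2) by (simp add: dvd_mult)
  qed
  ultimately show ?thesis using that p(1) by blast
qed

definition residue_box :: "nat \<Rightarrow> ('n::finite \<Rightarrow> int) set" where
  "residue_box p = {m. \<forall>i. 0 \<le> m i \<and> m i < int p}"

lemma residue_box_eq: "residue_box p = (UNIV \<rightarrow>\<^sub>E {0..<int p})"
  by (auto simp: residue_box_def PiE_UNIV_domain)

lemma finite_residue_box: "finite (residue_box p)"
  unfolding residue_box_eq by (intro finite_PiE) auto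

lemma card_residue_box: "card (residue_box p :: ('n::finite \<Rightarrow> int) set) = p ^ CARD('n)"
  unfolding residue_box_eq by (simp add: card_PiE)

text \<open>Increasing the coordinate \<open>a\<close> by one modulo \<open>p\<close> changes the
  linear form by \<open>w a\<close>, which is not divisible by \<open>p\<close>. This maps its zeros
  injectively to non-zeros, so at least half of the box consists of non-zeros.\<close>

lemma card_nonzero_linear_form:
  fixes w :: "'n::finite \<Rightarrow> int"
  assumes p: "p > 0" and w: "\<not> int p dvd w a"
  shows "p ^ CARD('n) \<le> 2 * card {m \<in> residue_box p. \<not> int p dvd (\<Sum>i\<in>UNIV. m i * w i)}"
proof -
  define b where "b m = (\<Sum>i\<in>UNIV. m i * w i)" for m :: "'n \<Rightarrow> int"
  define X where "X = {m \<in> residue_box p. \<not> int p dvd b m}"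
  define Y where "Y = {m \<in> residue_box p. int p dvd b m}"
  define f where "f m = m(a := (m a + 1) mod int p)" for m :: "'n \<Rightarrow> int"
  have "card Y \<le> card X"
  proof (rule card_inj_on_le[where f = f])
    show "inj_on f Y"
    proof (rule inj_onI)
      fix m m' assume m: "m \<in> Y" "m' \<in> Y" "f m = f m'"
      have "m i = m' i" for i
      proof (cases "i = a")
        case True
        have "[m a + 1 = m' a + 1] (mod int p)" using fun_cong[OF m(3), of a] by (simp add: f_def cong_def)
        then have "[m a = m' a] (mod int p)" by (simp only: cong_add_rcancel)
        then show ?thesis using m(1,2) True by (simp add: Y_def residue_box_def cong_def)
      next
        case False
        then show ?thesis using fun_cong[OF m(3), of i] by (simp add: f_def)
      qed
      then show "m = m'" by blast
    qed
    show "f ` Y \<subseteq> X"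
    proof
      fix m' assume "m' \<in> f ` Y"
      then obtain m where m: "m \<in> Y" "m' = f m" by blast
      define S where "S = (\<Sum>i\<in>UNIV - {a}. m i * w i)"
      have bf: "b (f m) = (m a + 1) mod int p * w a + S"
        unfolding b_def S_def by (subst sum.remove[of _ a]) (auto simp: f_def intro!: sum.cong)
      have "b m = m a * w a + S"
        unfolding b_def S_def by (subst sum.remove[of _ a]) auto
      then have bm: "b m + w a = (m a + 1) * w a + S" by (simp add: distrib_right)
      have "[b (f m) = b m + w a] (mod int p)"
        unfolding bf bm by (intro cong_add cong_mult cong_refl) (simp add: cong_def)
      moreover have "[b m + w a = 0 + w a] (mod int p)"
        using m(1) by (intro cong_add cong_refl) (simp add: Y_def cong_0_iff)
      ultimately have "[b (f m) = 0 + w a] (mod int p)" by (rule cong_trans)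
      then have "\<not> int p dvd b (f m)" using w cong_dvd_iff[of "b (f m)" "w a" "int p"] by simp
      moreover have "f m \<in> residue_box p" using m(1) p by (auto simp: f_def Y_def residue_box_def)
      ultimately show "m' \<in> X" by (simp add: X_def m(2))
    qed
    show "finite X" unfolding X_def by (rule finite_subset[OF _ finite_residue_box]) auto
  qed
  moreover have "card (residue_box p :: ('n \<Rightarrow> int) set) = card X + card Y"
  proof -
    have "residue_box p = X \<union> Y" by (auto simp: X_def Y_def)
    moreover have "finite X" "finite Y" unfolding X_def Y_def by (rule finite_subset[OF _ finite_residue_box]; auto)+
    moreover have "X \<inter> Y = {}" by (auto simp: X_def Y_def)
    ultimately show ?thesis by (simp only: card_Un_disjoint)
  qed
  ultimately show ?thesis by (simp add: card_residue_box X_def b_def)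
qed

text \<open>Along a line in an isotropic direction the form is affine modulo p, so every line on which
  its slope does not vanish contains a zero.\<close>

lemma card_zeros_mod_prime:
  fixes G :: "'n::finite \<Rightarrow> 'n \<Rightarrow> int"
  assumes p: "prime p" "p > 2" and G: "\<And>i j. G i j = G j i"
    and v: "int p dvd int_quad_form G v" "\<not> int p dvd (\<Sum>j\<in>UNIV. G a j * v j)"
  shows "p ^ CARD('n) \<le> 2 * p * card {m \<in> residue_box p. int p dvd int_quad_form G m}"
proof -
  define b where "b m = (\<Sum>i\<in>UNIV. m i * (\<Sum>j\<in>UNIV. G i j * v j))" for m
  define X where "X = {m \<in> residue_box p. \<not> int p dvd b m}"
  define Z where "Z = {m \<in> residue_box p. int p dvd int_quad_form G m}"
  have p0: "p > 0" using p by simp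
  have finZ: "finite Z" unfolding Z_def by (rule finite_subset[OF _ finite_residue_box]) auto
  \<comment> \<open>A point of \<open>X\<close> is recovered from the zero on its line and the
    parameter \<open>t\<close> by walking back, which bounds \<open>card X\<close> by
    \<open>p * card Z\<close>.\<close>
  have "X \<subseteq> (\<lambda>(t, z) i. (z i - t * v i) mod int p) ` ({0..<int p} \<times> Z)"
  proof
    fix m assume m: "m \<in> X"
    have pi: "prime (int p)" using p by simp
    have "\<not> int p dvd 2" using p by (metis int_dvd_int_iff of_nat_numeral dvd_imp_le not_less zero_less_numeral)
    then have "\<not> int p dvd 2 * b m" using m pi by (simp add: X_def prime_dvd_mult_iff)
    then have "coprime (2 * b m) (int p)" using pi by (metis coprime_commute prime_imp_coprime)
    then obtain y where y: "[2 * b m * y = 1] (mod int p)" using cong_solve_coprime_int by blast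
    \<comment> \<open>Solves the linear congruence for the zero: \<open>y\<close> is the inverse of
      the slope \<open>2 * b m\<close>, which exists because \<open>p\<close> is an odd
      prime.\<close>
    define t where "t = (- int_quad_form G m * y) mod int p"
    define z where "z i = (m i + t * v i) mod int p" for i
    have "[int_quad_form G z = int_quad_form G m + 2 * t * b m + t\<^sup>2 * int_quad_form G v] (mod int p)"
      using int_quad_form_mod[of G "\<lambda>i. m i + t * v i" "int p"] unfolding int_quad_form_add[OF G] z_def b_def .
    also have "[int_quad_form G m + 2 * t * b m + t\<^sup>2 * int_quad_form G v = int_quad_form G m + (- int_quad_form G m * y) * (2 * b m) + 0] (mod int p)"
    proof (intro cong_add cong_refl)
      have "[t * (2 * b m) = (- int_quad_form G m * y) * (2 * b m)] (mod int p)"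
        unfolding t_def by (intro cong_mult cong_refl) (simp add: cong_def)
      then show "[2 * t * b m = (- int_quad_form G m * y) * (2 * b m)] (mod int p)" by (simp add: mult_ac)
      show "[t\<^sup>2 * int_quad_form G v = 0] (mod int p)" using v(1) by (simp add: cong_0_iff)
    qed
    also have "int_quad_form G m + (- int_quad_form G m * y) * (2 * b m) + 0 = int_quad_form G m + (- int_quad_form G m) * (2 * b m * y)" by (simp add: mult_ac)
    also have "[int_quad_form G m + (- int_quad_form G m) * (2 * b m * y) = int_quad_form G m + (- int_quad_form G m) * 1] (mod int p)"
      by (intro cong_add cong_mult cong_refl y)
    finally have "int p dvd int_quad_form G z" by (simp add: cong_0_iff)
    then have "z \<in> Z" using p0 by (simp add: Z_def residue_box_def z_def)
    moreover have "t \<in> {0..<int p}" using p0 by (simp add: t_def)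
    moreover have "m = (\<lambda>(t, z) i. (z i - t * v i) mod int p) (t, z)"
    proof
      fix i
      have "(z i - t * v i) mod int p = (m i + t * v i - t * v i) mod int p" unfolding z_def by (simp only: mod_diff_left_eq)
      also have "\<dots> = m i" using m by (simp add: X_def residue_box_def)
      finally show "m i = (\<lambda>(t, z) i. (z i - t * v i) mod int p) (t, z) i" by simp
    qed
    ultimately show "m \<in> (\<lambda>(t, z) i. (z i - t * v i) mod int p) ` ({0..<int p} \<times> Z)" by blast
  qed
  then have "card X \<le> card ({0..<int p} \<times> Z)"
    using finZ by (meson card_image_le card_mono finite_SigmaI finite_atLeastLessThan_int finite_imageI le_trans)
  then have "card X \<le> p * card Z" by (simp add: card_cartesian_product)
  then show ?thesis using card_nonzero_linear_form[where w = "\<lambda>i. \<Sum>j\<in>UNIV. G i j * v j" and a = a, OF p0 v(2)] by (simp add: X_def Z_def b_def)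
qed

lemma common_denominator:
  assumes "finite S" "S \<subseteq> \<rat>"
  obtains D :: nat where "D > 0" "\<And>x. x \<in> S \<Longrightarrow> real D * x \<in> \<int>"
proof -
  have "\<exists>D::nat. D > 0 \<and> (\<forall>x\<in>S. real D * x \<in> \<int>)"
    using assms
  proof (induction S rule: finite_induct)
    case (insert x S)
    then obtain D :: nat where D: "D > 0" "\<forall>x\<in>S. real D * x \<in> \<int>" by auto
    obtain a :: int and b :: nat where ab: "b \<noteq> 0" "x = of_int a / real b"
      using insert.prems by (auto simp: Rats_eq_int_div_nat)
    have "real (D * b) * y \<in> \<int>" if "y \<in> insert x S" for y
    proof (cases "y = x")
      case True
      then have "real (D * b) * y = of_int (int D * a)" using ab by simp
      then show ?thesis by (metis Ints_of_int)
    next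
      case False
      then have "real D * y \<in> \<int>" using that D by auto
      then have "real b * (real D * y) \<in> \<int>" using Ints_mult[OF Ints_of_nat] by blast
      then show ?thesis by (simp add: mult_ac)
    qed
    then show ?case using D(1) ab(1) by (intro exI[of _ "D * b"]) auto
  qed (auto intro: exI[of _ 1])
  then show ?thesis using that by blast
qed

section \<open>Boundary points of a rational double paraboloid\<close>

context paraboloid
begin

lemma diag_pos: "A $ i $ i > 0"
proof -
  have "axis i 1 \<noteq> (0 :: real ^ 'n)" by (simp add: axis_eq_0_iff)
  then have "quad_form A (axis i 1) > 0" using posdef by (simp add: positive_definite_def)
  then show ?thesis by (simp add: quad_form_def matrix_vector_mul_component inner_axis' matrix_vector_mult_basis column_def)
qed

lemma symm: "A $ i $ j = A $ j $ i"
  using sym by (metis transpose_def vec_lambda_beta)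

lemma quad_form_sum: "quad_form A x = (\<Sum>i\<in>UNIV. \<Sum>j\<in>UNIV. A $ i $ j * x $ i * x $ j)"
  by (simp add: quad_form_def inner_vec_def matrix_vector_mult_def sum_distrib_left mult_ac)

lemma quad_form_axes:
  "quad_form A (y + x1 *\<^sub>R axis i1 1 + x2 *\<^sub>R axis i2 1) = quad_form A y + 2 * x1 * (A *v y) $ i1 + 2 * x2 * (A *v y) $ i2
     + A $ i1 $ i1 * x1\<^sup>2 + 2 * A $ i1 $ i2 * x1 * x2 + A $ i2 $ i2 * x2\<^sup>2"
proof -
  have q: "quad_form A (t *\<^sub>R axis i 1) = A $ i $ i * t\<^sup>2" for t i
    unfolding quad_form_scale by (simp add: quad_form_def inner_axis' matrix_vector_mult_basis column_def)
  have b: "x \<bullet> (A *v (t *\<^sub>R axis i 1)) = t * (A *v x) $ i" for x t i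
    using inner_mult_commute[of x "t *\<^sub>R axis i 1"] by (simp add: inner_axis')
  have e: "(A *v (x1 *\<^sub>R axis i1 1)) $ i2 = x1 * A $ i1 $ i2"
    using symm[of i2 i1] by (simp add: matrix_vector_mult_scaleR matrix_vector_mult_basis column_def)
  show ?thesis
    unfolding quad_form_add q b matrix_vector_right_distrib vector_add_component e by (simp add: algebra_simps)
qed

text \<open>The vector with entries \<open>- b\<close> and \<open>a\<close> at these two places
  completes the square: the form takes there the value \<open>a\<close> times the minor.\<close>

lemma minor_pos:
  assumes "i1 \<noteq> i2"
  shows "A $ i1 $ i1 * A $ i2 $ i2 - (A $ i1 $ i2)\<^sup>2 > 0"
proof -
  define a where "a = A $ i1 $ i1"
  define b where "b = A $ i1 $ i2"
  have a: "a > 0" unfolding a_def by (rule diag_pos)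
  define x where "x = 0 + (- b) *\<^sub>R axis i1 1 + a *\<^sub>R axis i2 (1 :: real)"
  have "x $ i2 = a" using assms by (simp add: x_def axis_def)
  then have "x \<noteq> 0" using a by (metis less_irrefl zero_index)
  then have "quad_form A x > 0" using posdef by (simp add: positive_definite_def)
  also have "quad_form A x = a * (a * A $ i2 $ i2 - b\<^sup>2)"
    unfolding x_def quad_form_axes by (simp add: quad_form_def a_def[symmetric] b_def[symmetric] algebra_simps power2_eq_square)
  finally show ?thesis using a by (simp add: zero_less_mult_iff a_def b_def)
qed

lemma finite_height_nonneg: "R \<ge> 1 \<Longrightarrow> finite {m \<in> int_vecs. height R m \<ge> 0}"
proof -
  assume R: "R \<ge> 1"
  obtain K where K: "K > 0" "\<And>R x. R \<ge> 1 \<Longrightarrow> quad_form A (x + R *\<^sub>R \<beta>) \<le> c * R\<^sup>2 \<Longrightarrow> norm (x + R *\<^sub>R \<beta>) \<le> K * R \<and> norm x \<le> K * R"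
    using norm_le_of_quad_form_le[of c] c_pos by auto
  have "{m \<in> int_vecs. height R m \<ge> 0} \<subseteq> lattice_box (K * R)"
  proof
    fix m :: "real ^ 'n" assume m: "m \<in> {m \<in> int_vecs. height R m \<ge> 0}"
    then have "norm m \<le> K * R" using K(2)[OF R, of m] height_nonneg_iff[of R m] R by simp
    then show "m \<in> lattice_box (K * R)"
      using m component_le_norm_cart[of m] by (auto simp: lattice_box_def intro: order_trans)
  qed
  then show ?thesis using finite_lattice_box finite_subset by blast
qed

text \<open>With \<open>\<beta> = 0\<close> the height over a fixed point strictly increases with
  the scale. The bodies are therefore nested, and a lattice point on the upper boundary at scale
  \<open>R\<close> is missing at every smaller scale.\<close>

lemma card_boundary_le_lattice_count_diff:
  assumes "\<beta> = 0" "1 \<le> R'" "R' < R"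
  shows "card {m \<in> int_vecs. height R m \<ge> 0 \<and> height R m \<in> \<int>} + lattice_count (double_paraboloid A \<beta> c) R' \<le> lattice_count (double_paraboloid A \<beta> c) R"
proof -
  define B where "B = {m \<in> int_vecs. height R m \<ge> 0}"
  define E where "E = {m \<in> int_vecs. height R m \<ge> 0 \<and> height R m \<in> \<int>}"
  have finB: "finite B" unfolding B_def using assms(2,3) by (intro finite_height_nonneg) auto
  have mono: "height R' m < height R m" for m
  proof -
    have "c * R' < c * R" using c_pos assms(2,3) by simp
    moreover have "quad_form A m / R \<le> quad_form A m / R'" using assms(2,3) quad_form_nonneg[of m] by (intro divide_left_mono) auto
    moreover have "height r m = c * r - quad_form A m / r" for r
      unfolding height_def by (simp add: assms(1))
    ultimately show ?thesis by (simp only:)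
  qed
  have BI: "B \<subseteq> int_vecs" by (auto simp: B_def)
  have mono_le: "t \<le> height R m" if "t \<le> height R' m" for t m using that mono[of m] by linarith
  have B': "{m \<in> int_vecs. height R' m \<ge> 0} \<subseteq> B" unfolding B_def by (simp add: subset_iff mono_le)
  have S: "{v \<in> integer_lattice. inverse R *\<^sub>R v \<in> double_paraboloid A \<beta> c} = (SIGMA m:B. {y \<in> \<int>. \<bar>y\<bar> \<le> height R m})"
    using assms(2,3) by (intro scaled_lattice_points_eq BI) (auto simp: B_def)
  have S': "{v \<in> integer_lattice. inverse R' *\<^sub>R v \<in> double_paraboloid A \<beta> c} = (SIGMA m:B. {y \<in> \<int>. \<bar>y\<bar> \<le> height R' m})"
    using assms(2,3) by (intro scaled_lattice_points_eq BI B') auto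
  have fin: "finite (SIGMA m:B. {y \<in> \<int>. \<bar>y\<bar> \<le> height R m})"
    by (rule finite_SigmaI[OF finB]) (rule finite_abs_int_segment)
  have sub': "(SIGMA m:B. {y \<in> \<int>. \<bar>y\<bar> \<le> height R' m}) \<subseteq> (SIGMA m:B. {y \<in> \<int>. \<bar>y\<bar> \<le> height R m})"
    by (rule Sigma_mono[OF order_refl]) (simp add: subset_iff mono_le)
  have disj: "(\<lambda>m. (m, height R m)) ` E \<inter> (SIGMA m:B. {y \<in> \<int>. \<bar>y\<bar> \<le> height R' m}) = {}"
  proof -
    have no: "\<not> \<bar>height R m\<bar> \<le> height R' m" for m using mono[of m] abs_ge_self[of "height R m"] by linarith
    show ?thesis
    proof (rule equals0I)
      fix x assume x: "x \<in> (\<lambda>m. (m, height R m)) ` E \<inter> (SIGMA m:B. {y \<in> \<int>. \<bar>y\<bar> \<le> height R' m})"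
      then obtain m where "x = (m, height R m)" by blast
      then show False using x no[of m] by simp
    qed
  qed
  have subE: "(\<lambda>m. (m, height R m)) ` E \<subseteq> (SIGMA m:B. {y \<in> \<int>. \<bar>y\<bar> \<le> height R m})"
    by (auto simp: E_def B_def)
  have "card E + card (SIGMA m:B. {y \<in> \<int>. \<bar>y\<bar> \<le> height R' m}) = card ((\<lambda>m. (m, height R m)) ` E) + card (SIGMA m:B. {y \<in> \<int>. \<bar>y\<bar> \<le> height R' m})"
    by (simp add: card_image inj_on_def)
  also have "\<dots> = card ((\<lambda>m. (m, height R m)) ` E \<union> (SIGMA m:B. {y \<in> \<int>. \<bar>y\<bar> \<le> height R' m}))"
    by (rule card_Un_disjoint[symmetric, OF finite_subset[OF subE fin] finite_subset[OF sub' fin] disj])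
  also have "\<dots> \<le> card (SIGMA m:B. {y \<in> \<int>. \<bar>y\<bar> \<le> height R m})"
    by (rule card_mono[OF fin Un_least[OF subE sub']])
  finally show ?thesis unfolding lattice_count_def S S' E_def .
qed

text \<open>If \<open>int_quad_form G m = p * q\<close>, then the multiple \<open>s * m\<close> has
  height \<open>c * k * p - q\<close> at scale \<open>k * p\<close>. The constants are arranged so
  that this is a nonnegative integer for every zero \<open>m\<close> in the residue box.\<close>

lemma many_boundary_points:
  assumes \<beta>: "\<beta> = 0" and c: "c \<in> \<rat>" and rat: "\<And>i j. A $ i $ j \<in> \<rat>" and i12: "i1 \<noteq> (i2 :: 'n)"
  obtains \<kappa> :: real where "\<kappa> \<ge> 1"
    "\<And>N. \<exists>p>N. real p ^ (CARD('n) - 1) \<le> 2 * real (card {m \<in> int_vecs. height (\<kappa> * real p) m \<ge> 0 \<and> height (\<kappa> * real p) m \<in> \<int>})"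
proof -
  obtain D :: nat where D: "D > 0" "\<And>x. x \<in> range (\<lambda>(i, j). A $ i $ j) \<Longrightarrow> real D * x \<in> \<int>"
  proof (rule common_denominator)
    show "finite (range (\<lambda>(i, j). A $ i $ j))" by simp
    show "range (\<lambda>(i, j). A $ i $ j) \<subseteq> \<rat>" using rat by auto
  qed blast
  define G where "G i j = \<lfloor>real D * A $ i $ j\<rfloor>" for i j
  have G: "of_int (G i j) = real D * A $ i $ j" for i j
  proof -
    have "A $ i $ j \<in> range (\<lambda>(i, j). A $ i $ j)" by (rule image_eqI[of _ _ "(i, j)"]) auto
    from D(2)[OF this] show ?thesis by (simp add: G_def)
  qed
  have Gsym: "G i j = G j i" for i j using symm[of i j] by (simp add: G_def)
  define \<Delta> where "\<Delta> = G i1 i1 * G i2 i2 - (G i1 i2)\<^sup>2"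
  have \<Delta>: "\<Delta> > 0"
  proof -
    have "real_of_int \<Delta> = (real D)\<^sup>2 * (A $ i1 $ i1 * A $ i2 $ i2 - (A $ i1 $ i2)\<^sup>2)"
      by (simp add: \<Delta>_def G algebra_simps power2_eq_square)
    then have "real_of_int \<Delta> > 0" using minor_pos[OF i12] D(1) by simp
    then show ?thesis by simp
  qed
  have G11: "G i1 i1 > 0"
  proof -
    have "real_of_int (G i1 i1) > 0" using G[of i1 i1] D(1) diag_pos[of i1] by simp
    then show ?thesis by simp
  qed
  define Gs where "Gs = (\<Sum>i\<in>UNIV. \<Sum>j\<in>UNIV. \<bar>G i j\<bar>)"
  obtain b :: nat where b: "b > 0" "real b * c \<in> \<int>"
  proof (rule common_denominator[of "{c}"])
    show "{c} \<subseteq> \<rat>" using c by simp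
  qed (use that in auto)
  obtain t :: nat where t: "t \<ge> 1" "of_int Gs \<le> c * real t"
  proof -
    obtain t :: nat where "of_int Gs / c < real t" using reals_Archimedean2 by blast
    then have "of_int Gs < c * real t" using c_pos by (simp add: pos_divide_less_eq mult.commute)
    also have "\<dots> \<le> c * real (max 1 t)" using c_pos by (intro mult_left_mono) auto
    finally have "of_int Gs \<le> c * real (max 1 t)" by simp
    then show ?thesis using that[of "max 1 t"] by simp
  qed
  \<comment> \<open>\<open>D\<close> clears the denominators of the form, \<open>b\<close> that of
    \<open>c\<close>, and \<open>t\<close> makes \<open>c * k\<close> at least the sum
    \<open>Gs\<close> of the moduli of the entries of \<open>G\<close>. With
    \<open>s = D * C\<close> the form at \<open>s * m\<close> is \<open>D * C^2 = k\<close> times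
    its integral version at \<open>m\<close>, and this \<open>k\<close> cancels against the
    scale.\<close>
  define C where "C = b * t"
  define s where "s = D * C"
  define k where "k = D * C\<^sup>2"
  have C1: "C \<ge> 1" using b t by (simp add: C_def Suc_leI)
  have k1: "k \<ge> 1" using C1 D by (simp add: k_def Suc_leI)
  have tk: "real t \<le> real k"
  proof -
    have "t \<le> k" using b(1) D(1) t(1) by (simp add: k_def C_def power2_eq_square)
    then show ?thesis by simp
  qed
  have ck: "c * real k \<in> \<int>"
  proof -
    have "c * real k = (real b * c) * of_nat (D * b * t\<^sup>2)" by (simp add: k_def C_def power2_eq_square)
    then show ?thesis using b(2) by (simp only: Ints_mult Ints_of_nat)
  qed
  show ?thesis
  proof
    show "real k \<ge> 1" using k1 by simp
    fix N :: nat
    \<comment> \<open>So large a prime divides neither \<open>\<Delta>\<close> nor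
      \<open>G i1 i1\<close>, and then not \<open>x\<close> either. Hence the slope
      \<open>G i1 i1 * x\<close> found below is nonzero modulo \<open>p\<close>.\<close>
    obtain p :: nat and x :: int where p: "prime p" "p > N + nat \<Delta> + nat (G i1 i1) + 2" "int p dvd x\<^sup>2 + \<Delta>"
      using exists_large_prime_dividing[OF \<Delta>] by blast
    have p0: "p > 0" "real p > 0" using p by auto
    have pi: "prime (int p)" using p by simp
    have nd: "\<not> int p dvd \<Delta>" "\<not> int p dvd G i1 i1"
      using \<Delta> G11 p(2) zdvd_not_zless[of \<Delta> "int p"] zdvd_not_zless[of "G i1 i1" "int p"] by auto
    have ndx: "\<not> int p dvd x"
    proof
      assume "int p dvd x"
      then have "int p dvd x\<^sup>2" by (simp add: power2_eq_square)
      then show False using p(3) nd(1) by (simp add: dvd_add_right_iff)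
    qed
    \<comment> \<open>A root of the binary subform by completing the square: its value is
      \<open>G i1 i1 * (x^2 + \<Delta>)\<close>, which is divisible by \<open>p\<close>.\<close>
    define v where "v i = (if i = i1 then x - G i1 i2 else if i = i2 then G i1 i1 else 0)" for i
    have Gv: "(\<Sum>j\<in>UNIV. G i j * v j) = G i i1 * (x - G i1 i2) + G i i2 * G i1 i1" for i
    proof -
      have "(\<Sum>j\<in>UNIV. G i j * v j) = (\<Sum>j\<in>{i1, i2}. G i j * v j)"
        by (intro sum.mono_neutral_right) (auto simp: v_def)
      then show ?thesis using i12 by (simp add: v_def)
    qed
    have "int_quad_form G v = (\<Sum>i\<in>UNIV. v i * (\<Sum>j\<in>UNIV. G i j * v j))"
      by (simp add: int_quad_form_def sum_distrib_left mult_ac)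
    also have "\<dots> = (\<Sum>i\<in>{i1, i2}. v i * (\<Sum>j\<in>UNIV. G i j * v j))"
      by (intro sum.mono_neutral_right) (auto simp: v_def)
    also have "\<dots> = G i1 i1 * (x\<^sup>2 + \<Delta>)"
      unfolding Gv using i12 Gsym[of i2 i1] by (simp add: v_def \<Delta>_def algebra_simps power2_eq_square)
    finally have v1: "int p dvd int_quad_form G v" using p(3) by simp
    have "(\<Sum>j\<in>UNIV. G i1 j * v j) = G i1 i1 * x" unfolding Gv by (simp add: algebra_simps)
    then have v2: "\<not> int p dvd (\<Sum>j\<in>UNIV. G i1 j * v j)" using nd(2) ndx pi by (simp add: prime_dvd_mult_iff)
    define Z where "Z = {m \<in> residue_box p. int p dvd int_quad_form G m}"
    have "p ^ CARD('n) \<le> 2 * p * card Z"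
      unfolding Z_def using p by (intro card_zeros_mod_prime[OF _ _ Gsym v1 v2]) auto
    moreover have "p ^ CARD('n) = p * p ^ (CARD('n) - 1)" by (simp add: power_eq_if)
    ultimately have cZ: "p ^ (CARD('n) - 1) \<le> 2 * card Z" using p0 by simp
    define E where "E = {m \<in> int_vecs. height (real k * real p) m \<ge> 0 \<and> height (real k * real p) m \<in> \<int>}"
    define f where "f m = (\<chi> i. real s * of_int (m i))" for m :: "'n \<Rightarrow> int"
    have s0: "real s > 0" using D C1 by (simp add: s_def)
    have fE: "f m \<in> E" if m: "m \<in> Z" for m
    proof -
      obtain q where q: "int_quad_form G m = int p * q" using m by (auto simp: Z_def)
      have "real D * quad_form A (f m) = (real s)\<^sup>2 * of_int (int_quad_form G m)"
        by (simp add: quad_form_sum int_quad_form_def f_def G sum_distrib_left power2_eq_square mult_ac)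
      then have "real D * quad_form A (f m) = real D * (real D * (real C)\<^sup>2 * of_int (int_quad_form G m))"
        by (simp add: s_def power_mult_distrib power2_eq_square mult_ac)
      then have Qf: "quad_form A (f m) = real k * of_int (int_quad_form G m)" using D(1) by (simp add: k_def)
      then have h: "height (real k * real p) (f m) = c * real k * real p - of_int q"
        using k1 p0 unfolding height_def by (simp add: \<beta> q)
      have le: "int_quad_form G m \<le> Gs * int p * int p"
      proof -
        have "G i j * m i * m j \<le> \<bar>G i j\<bar> * int p * int p" for i j
        proof -
          have "0 \<le> m i" "m i \<le> int p" "0 \<le> m j" "m j \<le> int p" using m by (auto simp: Z_def residue_box_def less_imp_le)
          then have "\<bar>G i j * m i * m j\<bar> \<le> \<bar>G i j\<bar> * int p * int p" unfolding abs_mult by (intro mult_mono) auto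
          then show ?thesis by linarith
        qed
        then have "int_quad_form G m \<le> (\<Sum>i\<in>UNIV. \<Sum>j\<in>UNIV. \<bar>G i j\<bar> * int p * int p)"
          unfolding int_quad_form_def by (intro sum_mono)
        then show ?thesis by (simp add: Gs_def sum_distrib_right)
      qed
      then have "int p * q \<le> int p * (Gs * int p)" by (simp add: q mult_ac)
      then have "q \<le> Gs * int p" using p0 by simp
      then have "real_of_int q \<le> of_int Gs * real p" by (metis of_int_le_iff of_int_mult of_int_of_nat_eq)
      also have "\<dots> \<le> (c * real k) * real p"
      proof -
        have "of_int Gs \<le> c * real k" using t(2) tk mult_left_mono[OF tk, of c] c_pos by linarith
        then show ?thesis by (intro mult_right_mono) auto
      qed
      finally have "height (real k * real p) (f m) \<ge> 0" unfolding h by simp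
      moreover have "height (real k * real p) (f m) \<in> \<int>" unfolding h by (intro Ints_diff Ints_mult[OF ck] Ints_of_nat Ints_of_int)
      moreover have "f m \<in> int_vecs" by (simp add: f_def int_vecs_def)
      ultimately show ?thesis by (simp add: E_def)
    qed
    have "card Z \<le> card E"
    proof (rule card_inj_on_le[where f = f])
      show "inj_on f Z"
      proof (rule inj_onI)
        fix m m' assume "f m = f m'"
        then have "real s * of_int (m i) = real s * of_int (m' i)" for i by (auto simp: f_def vec_eq_iff)
        then have "m i = m' i" for i using s0 by simp
        then show "m = m'" by (rule ext)
      qed
      show "f ` Z \<subseteq> E" using fE by blast
      have "real k * real p \<ge> 1 * 1" using k1 p0 by (intro mult_mono) auto
      then have "finite {m \<in> int_vecs. height (real k * real p) m \<ge> 0}" by (intro finite_height_nonneg) simp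
      then show "finite E" by (rule finite_subset[rotated]) (auto simp: E_def)
    qed
    then have "p ^ (CARD('n) - 1) \<le> 2 * card E" using cZ by linarith
    then have "real (p ^ (CARD('n) - 1)) \<le> real (2 * card E)" by (rule of_nat_mono)
    then show "\<exists>p>N. real p ^ (CARD('n) - 1) \<le> 2 * real (card {m \<in> int_vecs. height (real k * real p) m \<ge> 0 \<and> height (real k * real p) m \<in> \<int>})"
      using p(2) by (intro exI[of _ p]) (auto simp: E_def)
  qed
qed

end


section \<open>The exponent of the double paraboloid\<close>

lemma card_lattice_box_plane_le:
  fixes i1 i2 :: "'n :: finite"
  assumes "K \<ge> 0" "i1 \<noteq> i2"
  shows "real (card {z \<in> (lattice_box K :: (real ^ 'n) set). z $ i1 = 0 \<and> z $ i2 = 0}) \<le> (2 * K + 1) ^ (CARD('n) - 2)"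
proof -
  define Z where "Z = {z \<in> (lattice_box K :: (real ^ 'n) set). z $ i1 = 0 \<and> z $ i2 = 0}"
  define S where "S = UNIV - {i1, i2}"
  define F where "F = S \<rightarrow>\<^sub>E {- \<lfloor>K\<rfloor>..\<lfloor>K\<rfloor>}"
  define f where "f z = restrict (\<lambda>i. \<lfloor>z $ i\<rfloor>) S" for z :: "real ^ 'n"
  have fl: "z $ i = of_int \<lfloor>z $ i\<rfloor>" "\<lfloor>z $ i\<rfloor> \<in> {- \<lfloor>K\<rfloor>..\<lfloor>K\<rfloor>}" if "z \<in> Z" for z i
  proof -
    have z: "z $ i \<in> \<int>" "\<bar>z $ i\<bar> \<le> K" using that by (auto simp: Z_def lattice_box_def int_vecs_def)
    from z(1) obtain k where k: "z $ i = of_int k" by (rule Ints_cases)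
    then have "\<bar>k\<bar> \<le> \<lfloor>K\<rfloor>" using z(2) by (simp add: le_floor_iff)
    then show "z $ i = of_int \<lfloor>z $ i\<rfloor>" "\<lfloor>z $ i\<rfloor> \<in> {- \<lfloor>K\<rfloor>..\<lfloor>K\<rfloor>}" using k by (auto simp: abs_le_iff)
  qed
  have "card Z \<le> card F"
  proof (rule card_inj_on_le[where f = f])
    show "inj_on f Z"
    proof (rule inj_onI)
      fix z z' assume h: "z \<in> Z" "z' \<in> Z" "f z = f z'"
      have "z $ i = z' $ i" for i
      proof (cases "i \<in> S")
        case True
        then have "\<lfloor>z $ i\<rfloor> = \<lfloor>z' $ i\<rfloor>" using fun_cong[OF h(3), of i] by (simp add: f_def)
        then show ?thesis using fl(1)[OF h(1), of i] fl(1)[OF h(2), of i] by simp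
      next
        case False
        then show ?thesis using h by (auto simp: S_def Z_def)
      qed
      then show "z = z'" by (simp add: vec_eq_iff)
    qed
    show "f ` Z \<subseteq> F" using fl(2) by (force simp: F_def f_def)
    show "finite F" unfolding F_def S_def by (intro finite_PiE) auto
  qed
  also have "card F = nat (2 * \<lfloor>K\<rfloor> + 1) ^ (CARD('n) - 2)"
  proof -
    have "card S = CARD('n) - 2" using assms(2) by (simp add: S_def card_Diff_subset)
    then show ?thesis by (simp add: F_def S_def card_PiE)
  qed
  finally have "real (card Z) \<le> real (nat (2 * \<lfloor>K\<rfloor> + 1)) ^ (CARD('n) - 2)"
    by (metis of_nat_le_iff of_nat_power)
  also have "\<dots> \<le> (2 * K + 1) ^ (CARD('n) - 2)" using assms by (intro power_mono) auto
  finally show ?thesis by (simp add: Z_def)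
qed

section \<open>The sawtooth sum in sheared coordinates\<close>

context paraboloid
begin

text \<open>With the coordinates of the index set sheared by the rational ratio of the coefficients, the
  binary form in two of the variables becomes diagonal, up to linear terms.\<close>

lemma quad_form_sheared:
  fixes \<rho> D H r :: real
  assumes "A $ i1 $ i2 = A $ i1 $ i1 * \<rho>"
  obtains K l1 l2 where
    "\<And>u v. quad_form A (y + ((u - H) - \<rho> * D * (v - H)) *\<^sub>R axis i1 1 + (D * (v - H) + r) *\<^sub>R axis i2 1)
       = K + (A $ i1 $ i1 * u\<^sup>2 + l1 * u) + ((A $ i2 $ i2 - A $ i1 $ i1 * \<rho>\<^sup>2) * D\<^sup>2 * v\<^sup>2 + l2 * v)"
proof -
  define a where "a = A $ i1 $ i1"
  define b where "b = A $ i2 $ i2 - a * \<rho>\<^sup>2"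
  have b: "A $ i2 $ i2 = b + a * \<rho>\<^sup>2" by (simp add: b_def)
  define Y1 where "Y1 = (A *v y) $ i1"
  define Y2 where "Y2 = (A *v y) $ i2"
  define l1 where "l1 = 2 * a * (\<rho> * r - H) + 2 * Y1"
  define l2 where "l2 = 2 * b * D * (r - D * H) - 2 * \<rho> * D * Y1 + 2 * D * Y2"
  define K where "K = quad_form A y + 2 * (\<rho> * D * H - H) * Y1 + 2 * (r - D * H) * Y2 + a * (\<rho> * r - H)\<^sup>2 + b * (r - D * H)\<^sup>2"
  show ?thesis
  proof (rule that[of K l1 l2])
    fix u v :: real
    show "quad_form A (y + ((u - H) - \<rho> * D * (v - H)) *\<^sub>R axis i1 1 + (D * (v - H) + r) *\<^sub>R axis i2 1)
       = K + (A $ i1 $ i1 * u\<^sup>2 + l1 * u) + ((A $ i2 $ i2 - A $ i1 $ i1 * \<rho>\<^sup>2) * D\<^sup>2 * v\<^sup>2 + l2 * v)"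
      unfolding quad_form_axes assms a_def[symmetric] b Y1_def[symmetric] Y2_def[symmetric]
      unfolding K_def l1_def l2_def by (simp add: power2_eq_square algebra_simps)
  qed
qed

text \<open>Without a mixed term the sum over a square box is a product. The data \<open>y\<close>,
  \<open>H\<close> and \<open>r\<close> enter only linear and constant terms, so they do not appear
  in the bound, and the sum over all other coordinates can be done trivially afterwards.\<close>

lemma norm_exp_sum_sheared_le:
  fixes \<rho> D H r g R :: real
  assumes "A $ i1 $ i2 = A $ i1 $ i1 * \<rho>" "M > 0" "M \<le> N" "R > 0"
  shows "norm (\<Sum>u<M. \<Sum>v<M. ee (g * (quad_form A (y + ((real u - H) - \<rho> * D * (real v - H)) *\<^sub>R axis i1 1 + (D * (real v - H) + r) *\<^sub>R axis i2 1) / R)))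
    \<le> ((real N + 2 * (\<Sum>h=1..N. wt N (real h * g * (2 * A $ i1 $ i1 / R)))) +
        (real N + 2 * (\<Sum>h=1..N. wt N (real h * g * (2 * ((A $ i2 $ i2 - A $ i1 $ i1 * \<rho>\<^sup>2) * D\<^sup>2) / R))))) / 2"
proof -
  define a where "a = A $ i1 $ i1"
  define b where "b = (A $ i2 $ i2 - A $ i1 $ i1 * \<rho>\<^sup>2) * D\<^sup>2"
  define S where "S \<alpha> \<beta>' = (\<Sum>u<M. ee (\<alpha> * (real u)\<^sup>2 + \<beta>' * real u))" for \<alpha> \<beta>' :: real
  define T where "T \<kappa> = real N + 2 * (\<Sum>h=1..N. wt N (real h * g * (2 * \<kappa> / R)))" for \<kappa>
  have ST: "(norm (S (g * \<kappa> / R) \<beta>'))\<^sup>2 \<le> T \<kappa>" for \<kappa> \<beta>'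
  proof -
    have "(norm (S (g * \<kappa> / R) \<beta>'))\<^sup>2 \<le> real M + 2 * (\<Sum>h=1..M. wt M (2 * (g * \<kappa> / R) * real h))"
      unfolding S_def by (rule weyl_square[OF assms(2)])
    also have "\<dots> \<le> real N + 2 * (\<Sum>h=1..N. wt N (2 * (g * \<kappa> / R) * real h))"
    proof -
      have "(\<Sum>h=1..M. wt M (2 * (g * \<kappa> / R) * real h)) \<le> (\<Sum>h=1..M. wt N (2 * (g * \<kappa> / R) * real h))"
        using assms by (intro sum_mono wt_mono) auto
      also have "\<dots> \<le> (\<Sum>h=1..N. wt N (2 * (g * \<kappa> / R) * real h))"
        using assms by (intro sum_mono2) (auto simp: wt_nonneg)
      finally show ?thesis using assms(3) by simp
    qed
    also have "\<dots> = T \<kappa>" unfolding T_def by (simp add: mult_ac)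
    finally show ?thesis .
  qed
  obtain K l1 l2 where q: "\<And>u v. quad_form A (y + ((u - H) - \<rho> * D * (v - H)) *\<^sub>R axis i1 1 + (D * (v - H) + r) *\<^sub>R axis i2 1)
       = K + (a * u\<^sup>2 + l1 * u) + (b * v\<^sup>2 + l2 * v)"
    unfolding a_def b_def using quad_form_sheared[OF assms(1)] by metis
  have "(\<Sum>u<M. \<Sum>v<M. ee (g * (quad_form A (y + ((real u - H) - \<rho> * D * (real v - H)) *\<^sub>R axis i1 1 + (D * (real v - H) + r) *\<^sub>R axis i2 1) / R)))
     = (\<Sum>u<M. \<Sum>v<M. ee (g * K / R) * (ee (g * a / R * (real u)\<^sup>2 + g * l1 / R * real u) * ee (g * b / R * (real v)\<^sup>2 + g * l2 / R * real v)))"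
    unfolding q ee_add[symmetric]
    by (intro sum.cong refl arg_cong[where f = ee]) (use assms(4) in \<open>simp add: field_simps\<close>)
  also have "\<dots> = ee (g * K / R) * (S (g * a / R) (g * l1 / R) * S (g * b / R) (g * l2 / R))"
    unfolding S_def sum_product unfolding sum_distrib_left ..
  finally have "norm (\<Sum>u<M. \<Sum>v<M. ee (g * (quad_form A (y + ((real u - H) - \<rho> * D * (real v - H)) *\<^sub>R axis i1 1 + (D * (real v - H) + r) *\<^sub>R axis i2 1) / R)))
     = norm (S (g * a / R) (g * l1 / R)) * norm (S (g * b / R) (g * l2 / R))"
    by (simp add: norm_mult)
  also have "\<dots> \<le> ((norm (S (g * a / R) (g * l1 / R)))\<^sup>2 + (norm (S (g * b / R) (g * l2 / R)))\<^sup>2) / 2"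
    using sum_squares_bound[of "norm (S (g * a / R) (g * l1 / R))" "norm (S (g * b / R) (g * l2 / R))"] by simp
  also have "\<dots> \<le> (T a + T b) / 2" by (intro divide_right_mono add_mono ST) simp
  finally show ?thesis by (simp only: T_def a_def b_def)
qed

text \<open>The box covers all points of nonnegative height, and the points of negative height that
  it adds contribute zero, as long as all heights stay below \<open>L\<close> in modulus.
  \<open>Z\<close> collects the \<open>n - 2\<close> coordinates in which no cancellation is
  sought.\<close>

lemma saw_sum_height:
  fixes i1 i2 :: 'n
  assumes i12: "i1 \<noteq> i2" and rat: "A $ i1 $ i2 / A $ i1 $ i1 \<in> \<rat>" and \<epsilon>: "\<epsilon> > 0"
  obtains C where "C > 0"
    "\<And>R. R \<ge> 1 \<Longrightarrow> \<exists>B L. finite B \<and> B \<subseteq> int_vecs \<and> {m \<in> int_vecs. height R m \<ge> 0} \<subseteq> B \<and>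
       (\<forall>m\<in>B. - real L \<le> height R m \<and> height R m < real L) \<and>
       \<bar>\<Sum>m\<in>B. saw L (height R m)\<bar> \<le> C * R powr (real (CARD('n) - 1) + \<epsilon>)"
proof -
  define n where "n = CARD('n)"
  have n: "n \<ge> 2" using card_mono[of UNIV "{i1, i2}"] i12 by (simp add: n_def)
  obtain p :: int and D :: nat where pD: "D > 0" "A $ i1 $ i2 / A $ i1 $ i1 = of_int p / real D"
    using rat by (auto simp: Rats_eq_int_div_nat)
  define \<rho> where "\<rho> = of_int p / real D"
  have \<rho>D: "\<rho> * real D = of_int p" using pD by (simp add: \<rho>_def)
  have A12: "A $ i1 $ i2 = A $ i1 $ i1 * \<rho>" using pD diag_pos[of i1] by (simp add: \<rho>_def field_simps)
  define \<kappa>1 where "\<kappa>1 = A $ i1 $ i1"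
  define \<kappa>2 where "\<kappa>2 = (A $ i2 $ i2 - A $ i1 $ i1 * \<rho>\<^sup>2) * (real D)\<^sup>2"
  have \<kappa>1: "\<kappa>1 > 0" unfolding \<kappa>1_def by (rule diag_pos)
  have \<kappa>2: "\<kappa>2 > 0"
  proof -
    have "A $ i1 $ i1 * (A $ i2 $ i2 - A $ i1 $ i1 * \<rho>\<^sup>2) = A $ i1 $ i1 * A $ i2 $ i2 - (A $ i1 $ i2)\<^sup>2"
      by (simp add: A12 power2_eq_square algebra_simps)
    then have "A $ i1 $ i1 * (A $ i2 $ i2 - A $ i1 $ i1 * \<rho>\<^sup>2) > 0" using minor_pos[OF i12] by simp
    then show ?thesis using diag_pos[of i1] pD by (simp add: \<kappa>2_def zero_less_mult_iff)
  qed
  obtain k where k: "k > 0" "\<And>x y. \<bar>x \<bullet> (A *v y)\<bar> \<le> k * norm x * norm y" using inner_mult_bound by blast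
  obtain K where K: "K > 0" "\<And>R x. R \<ge> 1 \<Longrightarrow> quad_form A (x + R *\<^sub>R \<beta>) \<le> c * R\<^sup>2 \<Longrightarrow> norm (x + R *\<^sub>R \<beta>) \<le> K * R \<and> norm x \<le> K * R"
    using norm_le_of_quad_form_le[of c] c_pos by auto
  define P where "P = \<bar>real_of_int p\<bar>"
  have P: "P \<ge> 0" by (simp add: P_def)
  \<comment> \<open>Undoing the shear sends integer coordinates of size at most \<open>K * R\<close>
    to \<open>a + p * v0\<close>, of size at most \<open>(1 + P) * K * R\<close>; the
    \<open>1\<close> allows for rounding up.\<close>
  define cH where "cH = (1 + P) * K + 1"
  have cH: "cH > 0" using P K by (simp add: cH_def add_nonneg_pos)
  define cM where "cM = 2 * cH + 1"
  define K3 where "K3 = n * K + (1 + P) * cH + D * (cH + 1) + norm \<beta>"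
  have K3: "K3 \<ge> 0" unfolding K3_def using K P cH by (intro add_nonneg_nonneg mult_nonneg_nonneg) auto
  \<comment> \<open>\<open>c\<close> and \<open>k * K3^2\<close> keep all heights on the box below
    \<open>L\<close> in modulus, \<open>cM\<close> gives \<open>M \<le> L\<close>, and
    \<open>16\<close> gives \<open>L \<ge> 16 R\<close> for the condition on the Fejer
    degree.\<close>
  define CL where "CL = c + k * K3\<^sup>2 + cM + 16"
  have CL: "CL > 0" unfolding CL_def cM_def using c_pos k cH by (intro add_nonneg_pos add_nonneg_nonneg) auto
  \<comment> \<open>The slope in use is \<open>\<tau> = 2 * \<kappa>1 / R\<close>, and
    \<open>L\<close> lies between \<open>CL * R\<close> and \<open>(CL + 1) * R\<close>; this gives
    the two bounds for \<open>L * \<tau>\<close>.\<close>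
  have "2 * \<kappa>1 * CL > 0" "2 * \<kappa>1 * (CL + 1) > 0" using \<kappa>1 CL by simp_all
  from weighted_weyl_sum[OF this \<epsilon>, of 5] obtain C1 where C1: "C1 > 0"
    "\<And>N \<tau>. N \<ge> 1 \<Longrightarrow> 2 * \<kappa>1 * CL \<le> real N * \<tau> \<Longrightarrow> real N * \<tau> \<le> 2 * \<kappa>1 * (CL + 1) \<Longrightarrow>
       (\<Sum>j=1..N^5. wt N (real j / real (2*N)) * min (real j / real (2*N)) (real (2*N) / real j) / real N
          * (real N + 2 * (\<Sum>h=1..N. wt N (real h * (real j / real (2*N)) * \<tau>)))) \<le> C1 * real N powr (1 + \<epsilon>)" by blast
  have "2 * \<kappa>2 * CL > 0" "2 * \<kappa>2 * (CL + 1) > 0" using \<kappa>2 CL by simp_all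
  from weighted_weyl_sum[OF this \<epsilon>, of 5] obtain C2 where C2: "C2 > 0"
    "\<And>N \<tau>. N \<ge> 1 \<Longrightarrow> 2 * \<kappa>2 * CL \<le> real N * \<tau> \<Longrightarrow> real N * \<tau> \<le> 2 * \<kappa>2 * (CL + 1) \<Longrightarrow>
       (\<Sum>j=1..N^5. wt N (real j / real (2*N)) * min (real j / real (2*N)) (real (2*N) / real j) / real N
          * (real N + 2 * (\<Sum>h=1..N. wt N (real h * (real j / real (2*N)) * \<tau>)))) \<le> C2 * real N powr (1 + \<epsilon>)" by blast
  define cZ where "cZ = (2 * K + 1) ^ (n - 2)"
  have cZ: "cZ > 0" using K by (simp add: cZ_def)
  define C where "C = 4 * (cM\<^sup>2 * D * cZ) + 2 * D * cZ * (C1 + C2) * (CL + 1) powr (1 + \<epsilon>) + 1"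
  show ?thesis
  proof
    have "0 \<le> 4 * (cM\<^sup>2 * D * cZ)" "0 \<le> 2 * D * cZ * (C1 + C2) * (CL + 1) powr (1 + \<epsilon>)"
      using cZ C1 C2 by (auto intro!: mult_nonneg_nonneg)
    then show "C > 0" unfolding C_def by (intro add_nonneg_pos add_nonneg_nonneg zero_less_one)
    fix R :: real assume R: "R \<ge> 1"
    define H where "H = nat \<lceil>(1 + P) * (K * R)\<rceil>"
    define M where "M = 2 * H + 1"
    define L where "L = nat \<lceil>CL * R\<rceil>"
    define Z where "Z = {z \<in> (lattice_box (K * R) :: (real ^ 'n) set). z $ i1 = 0 \<and> z $ i2 = 0}"
    \<comment> \<open>Splitting the second coordinate by residues modulo \<open>D\<close> makes the
      shear integral, since \<open>\<rho> * D\<close> is an integer. Then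
      \<open>x1 + \<rho> * x2 = u - H + \<rho> * r\<close> no longer involves \<open>v\<close>,
      which removes the mixed term.\<close>
    define x1 where "x1 u v = (real u - real H) - \<rho> * real D * (real v - real H)" for u v :: nat
    define x2 where "x2 r v = real D * (real v - real H) + real r" for r v :: nat
    define \<phi> where "\<phi> = (\<lambda>(z, r, u, v). z + x1 u v *\<^sub>R axis i1 1 + x2 r v *\<^sub>R axis i2 (1 :: real))"
    define I where "I = Z \<times> {..<D} \<times> {..<M} \<times> {..<M}"
    define s where "s i = quad_form A (\<phi> i + R *\<^sub>R \<beta>) / R" for i
    have HR: "(1 + P) * (K * R) \<le> real H" "real H \<le> cH * R"
    proof -
      have "0 \<le> (1 + P) * (K * R)" using P K R by simp
      then show "(1 + P) * (K * R) \<le> real H" by (simp add: H_def)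
      have "real H \<le> (1 + P) * (K * R) + 1" using \<open>0 \<le> (1 + P) * (K * R)\<close> unfolding H_def by linarith
      also have "\<dots> \<le> cH * R" using R by (simp add: cH_def distrib_right)
      finally show "real H \<le> cH * R" .
    qed
    have MR: "real M \<le> cM * R" using HR(2) R by (simp add: M_def cM_def distrib_right)
    have CLR: "0 \<le> CL * R" using CL R by simp
    have LR: "CL * R \<le> real L" "real L \<le> (CL + 1) * R"
    proof -
      show "CL * R \<le> real L" unfolding L_def by (rule real_nat_ceiling_ge)
      have "real L \<le> CL * R + 1" unfolding L_def using CLR by linarith
      then show "real L \<le> (CL + 1) * R" using R by (simp add: distrib_right)
    qed
    have M_le_L: "M \<le> L"
    proof -
      have "cM * R \<le> CL * R" using R c_pos k by (intro mult_right_mono) (auto simp: CL_def)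
      then show ?thesis using MR LR(1) by linarith
    qed
    have L16: "16 * R \<le> real L"
    proof -
      have "16 * R \<le> CL * R" using R c_pos k cH by (intro mult_right_mono) (auto simp: CL_def cM_def)
      then show ?thesis using LR(1) by linarith
    qed
    have L1: "L \<ge> 1" using L16 R by linarith
    have finZ: "finite Z" unfolding Z_def by (rule finite_subset[OF _ finite_lattice_box]) auto
    have finI: "finite I" using finZ by (simp add: I_def)
    have comp: "\<phi> (z, r, u, v) $ i1 = x1 u v" "\<phi> (z, r, u, v) $ i2 = x2 r v"
       "i \<noteq> i1 \<Longrightarrow> i \<noteq> i2 \<Longrightarrow> \<phi> (z, r, u, v) $ i = z $ i" if "z \<in> Z" for z r u v i
      using that i12 by (auto simp: \<phi>_def Z_def axis_def)
    have x1_int: "x1 u v = of_int ((int u - int H) - p * (int v - int H))" for u v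
      by (simp add: x1_def \<rho>D)
    have x2_int: "x2 r v = of_int (int D * (int v - int H) + int r)" for r v
      by (simp add: x2_def)
    have inj: "inj_on \<phi> I"
    proof (rule inj_onI)
      fix a b assume ab: "a \<in> I" "b \<in> I" "\<phi> a = \<phi> b"
      obtain z r u v where a: "a = (z, r, u, v)" by (cases a)
      obtain z' r' u' v' where b: "b = (z', r', u', v')" by (cases b)
      have m: "z \<in> Z" "z' \<in> Z" "r < D" "r' < D" using ab by (auto simp: I_def a b)
      have "x2 r v = x2 r' v'" using comp(2)[OF m(1), of r u v] comp(2)[OF m(2), of r' u' v'] ab(3) by (simp add: a b)
      then have "real (D * v + r) = real (D * v' + r')" by (simp add: x2_def algebra_simps)
      then have e: "D * v + r = D * v' + r'" by (simp only: of_nat_eq_iff)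
      have "r = (D * v + r) mod D" using m(3) by simp
      also have "\<dots> = r'" unfolding e using m(4) by simp
      finally have r: "r = r'" .
      then have v: "v = v'" using e pD(1) by simp
      have "x1 u v = x1 u' v'" using comp(1)[OF m(1), of r u v] comp(1)[OF m(2), of r' u' v'] ab(3) by (simp add: a b)
      then have u: "u = u'" by (simp add: x1_def v)
      have "z = z'" using ab(3) by (simp add: a b \<phi>_def r u v)
      then show "a = b" by (simp add: a b r u v)
    qed
    define B where "B = \<phi> ` I"
    have finB: "finite B" unfolding B_def using finI by simp
    have BI: "B \<subseteq> int_vecs"
    proof
      fix m assume "m \<in> B"
      then obtain z r u v where m: "m = \<phi> (z, r, u, v)" "z \<in> Z" by (auto simp: B_def I_def)
      have "m $ i \<in> \<int>" for i
      proof (cases "i = i1 \<or> i = i2")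
        case True
        then show ?thesis using comp(1,2)[OF m(2)] unfolding m(1) x1_int x2_int by (metis Ints_of_int)
      next
        case False
        then have "m $ i = z $ i" using comp(3)[OF m(2)] by (simp add: m(1))
        then show ?thesis using m(2) by (simp add: Z_def lattice_box_def int_vecs_def)
      qed
      then show "m \<in> int_vecs" by (simp add: int_vecs_def)
    qed
    have cover: "{m \<in> int_vecs. height R m \<ge> 0} \<subseteq> B"
    proof
      fix m :: "real ^ 'n" assume m: "m \<in> {m \<in> int_vecs. height R m \<ge> 0}"
      have mi: "\<bar>m $ i\<bar> \<le> K * R" for i
        using m K(2)[OF R, of m] height_nonneg_iff[of R m] R component_le_norm_cart[of m i] by auto
      have "m $ i1 \<in> \<int>" "m $ i2 \<in> \<int>" using m by (auto simp: int_vecs_def)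
      then obtain a b where ab: "m $ i1 = of_int a" "m $ i2 = of_int b" by (metis Ints_cases)
      \<comment> \<open>The inverse of the parametrisation: division by \<open>D\<close> with
        remainder in the second coordinate, then undoing the shear in the first.\<close>
      define v0 where "v0 = b div int D"
      define r0 where "r0 = b mod int D"
      define u0 where "u0 = a + p * v0"
      have D1: "int D \<ge> 1" using pD by simp
      have "\<bar>v0\<bar> \<le> \<bar>b\<bar>"
      proof -
        have b: "b = int D * v0 + r0" "0 \<le> r0" "r0 \<le> int D - 1" using D1 by (auto simp: v0_def r0_def)
        show ?thesis
        proof (cases "v0 \<ge> 0")
          case True
          then have "1 * v0 \<le> int D * v0" using D1 by (intro mult_right_mono) auto
          then show ?thesis using True b by linarith
        next
          case False
          then have "(int D - 1) * v0 \<le> (int D - 1) * (- 1)" using D1 by (intro mult_left_mono) auto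
          then show ?thesis using False b by (simp add: left_diff_distrib)
        qed
      qed
      then have v0: "real_of_int \<bar>v0\<bar> \<le> K * R" using mi[of i2] unfolding ab by linarith
      have u0: "real_of_int \<bar>u0\<bar> \<le> (1 + P) * (K * R)"
      proof -
        have "\<bar>u0\<bar> \<le> \<bar>a\<bar> + \<bar>p\<bar> * \<bar>v0\<bar>" unfolding u0_def abs_mult[symmetric] by (rule abs_triangle_ineq)
        then have "real_of_int \<bar>u0\<bar> \<le> real_of_int (\<bar>a\<bar> + \<bar>p\<bar> * \<bar>v0\<bar>)" by (simp only: of_int_le_iff)
        also have "\<dots> = \<bar>m $ i1\<bar> + P * real_of_int \<bar>v0\<bar>" by (simp add: ab P_def)
        also have "\<dots> \<le> K * R + P * (K * R)" using mi[of i1] v0 P by (intro add_mono mult_left_mono) auto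
        finally show ?thesis by (simp add: distrib_right)
      qed
      have "K * R \<le> (1 + P) * (K * R)" using P K R by (simp add: distrib_right)
      then have "real_of_int \<bar>v0\<bar> \<le> real_of_int (int H)" "real_of_int \<bar>u0\<bar> \<le> real_of_int (int H)" using v0 u0 HR(1) by simp_all
      then have H: "\<bar>v0\<bar> \<le> int H" "\<bar>u0\<bar> \<le> int H" by (simp_all only: of_int_le_iff)
      define u where "u = nat (u0 + int H)"
      define v where "v = nat (v0 + int H)"
      define r where "r = nat r0"
      define z where "z = (\<chi> i. if i = i1 \<or> i = i2 then 0 else m $ i)"
      have uv: "int u = u0 + int H" "int v = v0 + int H" "int r = r0"
        using H D1 by (auto simp: u_def v_def r_def r0_def)
      have "u < M" "v < M" using H uv by (auto simp: M_def)
      moreover have "r < D"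
      proof -
        have "int r < int D" using D1 by (simp add: uv r0_def)
        then show ?thesis by simp
      qed
      moreover have zZ: "z \<in> Z"
        using mi m K R by (auto simp: Z_def z_def lattice_box_def int_vecs_def)
      ultimately have "(z, r, u, v) \<in> I" by (simp add: I_def)
      moreover have "m = \<phi> (z, r, u, v)"
      proof -
        have "x1 u v = m $ i1" by (simp add: x1_int uv u0_def ab)
        moreover have "x2 r v = m $ i2" by (simp add: x2_int uv ab v0_def r0_def)
        moreover have "i \<noteq> i1 \<Longrightarrow> i \<noteq> i2 \<Longrightarrow> m $ i = z $ i" for i by (simp add: z_def)
        ultimately have "m $ i = \<phi> (z, r, u, v) $ i" for i using comp[OF zZ] by metis
        then show ?thesis by (simp add: vec_eq_iff)
      qed
      ultimately show "m \<in> B" unfolding B_def by blast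
    qed
    have normB: "norm (m + R *\<^sub>R \<beta>) \<le> K3 * R" if "m \<in> B" for m
    proof -
      from that have "m \<in> \<phi> ` I" by (simp only: B_def)
      then obtain i where i: "m = \<phi> i" "i \<in> I" by (rule imageE)
      obtain z r u v where zruv: "i = (z, r, u, v)" by (cases i)
      have m: "m = \<phi> (z, r, u, v)" "z \<in> Z" "r < D" "u < M" "v < M" using i by (simp_all add: zruv I_def)
      have "norm z \<le> (\<Sum>i\<in>UNIV. \<bar>z $ i\<bar>)" by (rule norm_le_l1_cart)
      also have "\<dots> \<le> (\<Sum>i\<in>(UNIV :: 'n set). K * R)" using m(2) by (intro sum_mono) (auto simp: Z_def lattice_box_def)
      finally have nz: "norm z \<le> n * K * R" by (simp add: n_def)
      have uH: "\<bar>real u - real H\<bar> \<le> cH * R" "\<bar>real v - real H\<bar> \<le> cH * R" using m HR(2) by (auto simp: M_def)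
      have "\<bar>x1 u v\<bar> \<le> \<bar>real u - real H\<bar> + \<bar>of_int p * (real v - real H)\<bar>" unfolding x1_def \<rho>D by (rule abs_triangle_ineq4)
      also have "\<dots> \<le> cH * R + P * (cH * R)" unfolding abs_mult P_def[symmetric] using uH P by (intro add_mono mult_left_mono) auto
      finally have nx1: "\<bar>x1 u v\<bar> \<le> (1 + P) * cH * R" by (simp add: distrib_right mult.assoc)
      have "\<bar>x2 r v\<bar> \<le> \<bar>real D * (real v - real H)\<bar> + \<bar>real r\<bar>" unfolding x2_def by (rule abs_triangle_ineq)
      also have "\<dots> \<le> D * (cH * R) + D * R" unfolding abs_mult
      proof (intro add_mono)
        show "\<bar>real D\<bar> * \<bar>real v - real H\<bar> \<le> D * (cH * R)" using uH by (intro mult_mono) auto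
        have "real r \<le> real D * 1" using m(3) by simp
        also have "\<dots> \<le> real D * R" using R by (intro mult_left_mono) auto
        finally show "\<bar>real r\<bar> \<le> D * R" by simp
      qed
      finally have nx2: "\<bar>x2 r v\<bar> \<le> D * (cH + 1) * R" by (simp add: algebra_simps)
      have "norm (m + R *\<^sub>R \<beta>) \<le> norm z + norm (x1 u v *\<^sub>R axis i1 (1::real)) + norm (x2 r v *\<^sub>R axis i2 (1::real)) + norm (R *\<^sub>R \<beta>)"
        unfolding m(1) \<phi>_def prod.case by (intro norm_triangle_le add_mono order_refl)
      also have "\<dots> = norm z + \<bar>x1 u v\<bar> + \<bar>x2 r v\<bar> + norm \<beta> * R" using R by simp
      also have "\<dots> \<le> K3 * R" using nz nx1 nx2 unfolding K3_def distrib_right by linarith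
      finally show ?thesis .
    qed
    have heightB: "\<bar>height R m\<bar> < real L" if "m \<in> B" for m
    proof -
      have "\<bar>quad_form A (m + R *\<^sub>R \<beta>)\<bar> \<le> k * (K3 * R) * (K3 * R)"
        unfolding quad_form_def using normB[OF that] k(1) K3 R by (intro order_trans[OF k(2)] mult_mono) auto
      then have "\<bar>quad_form A (m + R *\<^sub>R \<beta>)\<bar> / R \<le> k * (K3 * R) * (K3 * R) / R" using R by (intro divide_right_mono) auto
      also have "\<dots> = k * K3\<^sup>2 * R" using R by (simp add: power2_eq_square)
      finally have "\<bar>quad_form A (m + R *\<^sub>R \<beta>) / R\<bar> \<le> k * K3\<^sup>2 * R" using R by simp
      then have "\<bar>height R m\<bar> \<le> c * R + k * K3\<^sup>2 * R" unfolding height_def using c_pos R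
        by (intro order_trans[OF abs_triangle_ineq4] add_mono) auto
      also have "\<dots> < CL * R" using R cH by (simp add: CL_def cM_def distrib_right add_pos_pos)
      finally show ?thesis using LR(1) by linarith
    qed
    have cardZ: "real (card Z) \<le> cZ * R ^ (n - 2)"
    proof -
      have "real (card Z) \<le> (2 * (K * R) + 1) ^ (n - 2)"
        unfolding Z_def n_def using K R i12 by (intro card_lattice_box_plane_le) auto
      also have "\<dots> \<le> ((2 * K + 1) * R) ^ (n - 2)" using K R by (intro power_mono) (auto simp: distrib_right)
      finally show ?thesis by (simp add: cZ_def power_mult_distrib)
    qed
    define T where "T \<kappa> j = real L + 2 * (\<Sum>h=1..L. wt L (real h * (real j / real (2*L)) * (2 * \<kappa> / R)))" for \<kappa> j
    define \<omega> where "\<omega> j = wt L (real j / real (2*L)) * min (real j / real (2*L)) (real (2*L) / real j) / real L" for j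
    have \<omega>0: "\<omega> j \<ge> 0" for j by (simp add: \<omega>_def wt_nonneg)
    have exps: "norm (\<Sum>i\<in>I. ee (real j / real (2*L) * s i)) \<le> real (card Z) * real D * ((T \<kappa>1 j + T \<kappa>2 j) / 2)" for j
    proof -
      have "(\<Sum>i\<in>I. ee (real j / real (2*L) * s i)) = (\<Sum>z\<in>Z. \<Sum>r<D. \<Sum>u<M. \<Sum>v<M. ee (real j / real (2*L) * s (z, r, u, v)))"
        unfolding I_def by (simp only: sum.cartesian_product')
      also have "norm \<dots> \<le> (\<Sum>z\<in>Z. \<Sum>r<D. norm (\<Sum>u<M. \<Sum>v<M. ee (real j / real (2*L) * s (z, r, u, v))))"
        by (rule order_trans[OF norm_sum sum_mono[OF norm_sum]])
      also have "\<dots> \<le> (\<Sum>z\<in>Z. \<Sum>r<D. (T \<kappa>1 j + T \<kappa>2 j) / 2)"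
      proof (intro sum_mono)
        fix z r
        have s_eq: "s (z, r, u, v) = quad_form A ((z + R *\<^sub>R \<beta>) + ((real u - real H) - \<rho> * real D * (real v - real H)) *\<^sub>R axis i1 1 + (real D * (real v - real H) + real r) *\<^sub>R axis i2 1) / R" for u v
          unfolding s_def \<phi>_def prod.case x1_def x2_def by (simp only: add_ac)
        have "M > 0" "R > 0" using R by (simp_all add: M_def)
        then show "norm (\<Sum>u<M. \<Sum>v<M. ee (real j / real (2*L) * s (z, r, u, v))) \<le> (T \<kappa>1 j + T \<kappa>2 j) / 2"
          unfolding s_eq T_def \<kappa>1_def \<kappa>2_def by (intro norm_exp_sum_sheared_le[OF A12 _ M_le_L])
      qed
      also have "\<dots> = real (card Z) * real D * ((T \<kappa>1 j + T \<kappa>2 j) / 2)" by simp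
      finally show ?thesis .
    qed
    have wsum: "(\<Sum>j=1..L^5. \<omega> j * T \<kappa>1 j) \<le> C1 * real L powr (1 + \<epsilon>)" "(\<Sum>j=1..L^5. \<omega> j * T \<kappa>2 j) \<le> C2 * real L powr (1 + \<epsilon>)"
    proof -
      have r: "2 * \<kappa> * CL \<le> real L * (2 * \<kappa> / R)" "real L * (2 * \<kappa> / R) \<le> 2 * \<kappa> * (CL + 1)" if "\<kappa> > 0" for \<kappa>
        using mult_left_mono[OF LR(1), of "2 * \<kappa>"] mult_left_mono[OF LR(2), of "2 * \<kappa>"] R that by (simp_all add: field_simps)
      show "(\<Sum>j=1..L^5. \<omega> j * T \<kappa>1 j) \<le> C1 * real L powr (1 + \<epsilon>)" unfolding \<omega>_def T_def by (rule C1(2)[OF L1 r[OF \<kappa>1]])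
      show "(\<Sum>j=1..L^5. \<omega> j * T \<kappa>2 j) \<le> C2 * real L powr (1 + \<epsilon>)" unfolding \<omega>_def T_def by (rule C2(2)[OF L1 r[OF \<kappa>2]])
    qed
    \<comment> \<open>With width \<open>w = 1 / R\<close> the first term of the smoothing inequality
      is of order \<open>card I / R\<close>, hence of order \<open>R^(n-1)\<close>. A power of
      \<open>L\<close> is affordable as Fejer degree, since the frequency average has the same order
      for every fixed exponent \<open>q\<close>.\<close>
    have J: "16 * (real L)\<^sup>2 \<le> real (L ^ 5) * (1 / R)\<^sup>2"
    proof -
      have "16 * R\<^sup>2 \<le> real L * (real L)\<^sup>2"
      proof (rule mult_mono)
        show "16 \<le> real L" using L16 R by linarith
        show "R\<^sup>2 \<le> (real L)\<^sup>2" using L16 R by (intro power_mono) auto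
      qed auto
      then have "(real L)\<^sup>2 * (16 * R\<^sup>2) \<le> (real L)\<^sup>2 * (real L * (real L)\<^sup>2)" by (intro mult_left_mono) auto
      also have "\<dots> = real (L ^ 5)" by (simp add: power2_eq_square eval_nat_numeral)
      finally show ?thesis using R by (simp add: power_divide field_simps)
    qed
    have powL: "real L powr (1 + \<epsilon>) \<le> (CL + 1) powr (1 + \<epsilon>) * R powr (1 + \<epsilon>)"
    proof -
      have "real L powr (1 + \<epsilon>) \<le> ((CL + 1) * R) powr (1 + \<epsilon>)" using LR(2) \<epsilon> by (intro powr_mono2) auto
      then show ?thesis using CL R by (simp add: powr_mult)
    qed
    have Rpow: "R ^ (n - 2) * R powr (1 + \<epsilon>) = R powr (real (n - 1) + \<epsilon>)"
    proof -
      have "R ^ (n - 2) = R powr (real (n - 2))" using R by (simp add: powr_realpow)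
      then show ?thesis using n by (simp add: powr_add[symmetric] of_nat_diff add_ac)
    qed
    have R2: "R * R ^ (n - 2) \<le> R powr (real (n - 1) + \<epsilon>)"
    proof -
      have "R powr 1 \<le> R powr (1 + \<epsilon>)" using R \<epsilon> by (intro powr_mono) auto
      then have "R ^ (n - 2) * R \<le> R ^ (n - 2) * R powr (1 + \<epsilon>)" using R by (intro mult_left_mono) auto
      then show ?thesis unfolding Rpow by (simp add: mult.commute)
    qed
    have "(\<Sum>m\<in>B. saw L (height R m)) = (\<Sum>i\<in>I. saw L (c * R - s i))"
      unfolding B_def by (subst sum.reindex[OF inj]) (simp add: height_def s_def)
    then have "\<bar>\<Sum>m\<in>B. saw L (height R m)\<bar> \<le> 4 * (1 / R) * real (card I) + 4 * (\<Sum>j=1..L^5. \<omega> j * norm (\<Sum>i\<in>I. ee (real j / real (2*L) * s i)))"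
      unfolding \<omega>_def using saw_sum_bound[OF finI _ _ J, of "c * R" s] L1 R by simp
    also have "\<dots> \<le> 4 * (1 / R) * ((cM * R)\<^sup>2 * D * (cZ * R ^ (n - 2))) + 4 * (real (card Z) * real D / 2 * ((\<Sum>j=1..L^5. \<omega> j * T \<kappa>1 j) + (\<Sum>j=1..L^5. \<omega> j * T \<kappa>2 j)))"
    proof (intro add_mono mult_left_mono)
      have "real (card I) = real M ^ 2 * D * card Z" by (simp add: I_def card_cartesian_product power2_eq_square)
      also have "\<dots> \<le> (cM * R)\<^sup>2 * D * (cZ * R ^ (n - 2))"
        using MR cardZ by (intro mult_mono power_mono) auto
      finally show "real (card I) \<le> (cM * R)\<^sup>2 * D * (cZ * R ^ (n - 2))" .
      have "(\<Sum>j=1..L^5. \<omega> j * norm (\<Sum>i\<in>I. ee (real j / real (2*L) * s i))) \<le> (\<Sum>j=1..L^5. \<omega> j * (real (card Z) * real D * ((T \<kappa>1 j + T \<kappa>2 j) / 2)))"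
        by (intro sum_mono mult_left_mono exps \<omega>0)
      also have "\<dots> = (\<Sum>j=1..L^5. real (card Z) * real D / 2 * (\<omega> j * T \<kappa>1 j + \<omega> j * T \<kappa>2 j))"
        by (intro sum.cong refl) (simp add: algebra_simps add_divide_distrib)
      also have "\<dots> = real (card Z) * real D / 2 * ((\<Sum>j=1..L^5. \<omega> j * T \<kappa>1 j) + (\<Sum>j=1..L^5. \<omega> j * T \<kappa>2 j))"
        by (simp only: sum_distrib_left[symmetric] sum.distrib)
      finally show "(\<Sum>j=1..L^5. \<omega> j * norm (\<Sum>i\<in>I. ee (real j / real (2*L) * s i))) \<le> real (card Z) * real D / 2 * ((\<Sum>j=1..L^5. \<omega> j * T \<kappa>1 j) + (\<Sum>j=1..L^5. \<omega> j * T \<kappa>2 j))" .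
    qed (use R in auto)
    also have "\<dots> \<le> 4 * (cM\<^sup>2 * D * cZ) * (R * R ^ (n - 2)) + 4 * (cZ * R ^ (n - 2) * real D / 2 * ((C1 + C2) * ((CL + 1) powr (1 + \<epsilon>) * R powr (1 + \<epsilon>))))"
    proof (intro add_mono)
      show "4 * (1 / R) * ((cM * R)\<^sup>2 * D * (cZ * R ^ (n - 2))) \<le> 4 * (cM\<^sup>2 * D * cZ) * (R * R ^ (n - 2))"
        using R by (simp add: power2_eq_square)
      have "(\<Sum>j=1..L^5. \<omega> j * T \<kappa>1 j) + (\<Sum>j=1..L^5. \<omega> j * T \<kappa>2 j) \<le> (C1 + C2) * real L powr (1 + \<epsilon>)"
        using wsum by (simp add: distrib_right)
      also have "\<dots> \<le> (C1 + C2) * ((CL + 1) powr (1 + \<epsilon>) * R powr (1 + \<epsilon>))" using powL C1 C2 by (intro mult_left_mono) auto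
      finally have 1: "(\<Sum>j=1..L^5. \<omega> j * T \<kappa>1 j) + (\<Sum>j=1..L^5. \<omega> j * T \<kappa>2 j) \<le> (C1 + C2) * ((CL + 1) powr (1 + \<epsilon>) * R powr (1 + \<epsilon>))" .
      have 2: "0 \<le> (\<Sum>j=1..L^5. \<omega> j * T \<kappa>1 j) + (\<Sum>j=1..L^5. \<omega> j * T \<kappa>2 j)"
        by (intro add_nonneg_nonneg sum_nonneg mult_nonneg_nonneg \<omega>0) (auto simp: T_def wt_nonneg intro!: add_nonneg_nonneg sum_nonneg)
      show "4 * (real (card Z) * real D / 2 * ((\<Sum>j=1..L^5. \<omega> j * T \<kappa>1 j) + (\<Sum>j=1..L^5. \<omega> j * T \<kappa>2 j)))
         \<le> 4 * (cZ * R ^ (n - 2) * real D / 2 * ((C1 + C2) * ((CL + 1) powr (1 + \<epsilon>) * R powr (1 + \<epsilon>))))"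
        using 1 2 cardZ cZ R by (intro mult_left_mono mult_mono divide_right_mono mult_right_mono) auto
    qed
    also have "\<dots> = 4 * (cM\<^sup>2 * D * cZ) * (R * R ^ (n - 2)) + 2 * D * cZ * (C1 + C2) * (CL + 1) powr (1 + \<epsilon>) * (R ^ (n - 2) * R powr (1 + \<epsilon>))"
      by (simp add: mult_ac)
    also have "\<dots> \<le> 4 * (cM\<^sup>2 * D * cZ) * R powr (real (n - 1) + \<epsilon>) + 2 * D * cZ * (C1 + C2) * (CL + 1) powr (1 + \<epsilon>) * R powr (real (n - 1) + \<epsilon>)"
      unfolding Rpow using R2 cZ by (intro add_right_mono mult_left_mono) auto
    also have "\<dots> \<le> C * R powr (real (n - 1) + \<epsilon>)" by (simp add: C_def distrib_right)
    finally have final: "\<bar>\<Sum>m\<in>B. saw L (height R m)\<bar> \<le> C * R powr (real (CARD('n) - 1) + \<epsilon>)" by (simp add: n_def)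
    have "\<forall>m\<in>B. - real L \<le> height R m \<and> height R m < real L" using heightB by (force simp: abs_less_iff)
    then show "\<exists>B L. finite B \<and> B \<subseteq> int_vecs \<and> {m \<in> int_vecs. height R m \<ge> 0} \<subseteq> B \<and>
       (\<forall>m\<in>B. - real L \<le> height R m \<and> height R m < real L) \<and>
       \<bar>\<Sum>m\<in>B. saw L (height R m)\<bar> \<le> C * R powr (real (CARD('n) - 1) + \<epsilon>)"
      using finB BI cover final by blast
  qed
qed


section \<open>The two bounds for the exponent\<close>

lemma lattice_count_error_bigo:
  fixes i1 i2 :: 'n
  assumes i12: "i1 \<noteq> i2" and rat: "A $ i1 $ i2 / A $ i1 $ i1 \<in> \<rat>" and \<epsilon>: "\<epsilon> > 0"
  shows "(\<lambda>R. real (lattice_count (double_paraboloid A \<beta> c) R) - measure lebesgue (double_paraboloid A \<beta> c) * R ^ DIM((real ^ 'n) \<times> real))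
     \<in> O(\<lambda>R. R powr (real (CARD('n) - 1) + \<epsilon>))"
proof -
  obtain C1 R0 where C1: "C1 > 0" "R0 \<ge> 1"
    "\<And>R B. R \<ge> R0 \<Longrightarrow> finite B \<Longrightarrow> B \<subseteq> int_vecs \<Longrightarrow> {m \<in> int_vecs. height R m \<ge> 0} \<subseteq> B \<Longrightarrow>
       \<bar>(\<integral>x. max (height R x) 0 \<partial>lborel) - (\<Sum>m\<in>B. max (height R m) 0)\<bar> \<le> C1 * R ^ (CARD('n) - 1)"
    using riemann_sum_height by blast
  obtain C2 where C2: "C2 > 0"
    "\<And>R. R \<ge> 1 \<Longrightarrow> \<exists>B L. finite B \<and> B \<subseteq> int_vecs \<and> {m \<in> int_vecs. height R m \<ge> 0} \<subseteq> B \<and>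
       (\<forall>m\<in>B. - real L \<le> height R m \<and> height R m < real L) \<and>
       \<bar>\<Sum>m\<in>B. saw L (height R m)\<bar> \<le> C2 * R powr (real (CARD('n) - 1) + \<epsilon>)"
    using saw_sum_height[OF i12 rat \<epsilon>] by blast
  show ?thesis
  proof (rule bigoI[where c = "2 * C1 + 2 * C2"])
    show "\<forall>\<^sub>F R in at_top. norm (real (lattice_count (double_paraboloid A \<beta> c) R) - measure lebesgue (double_paraboloid A \<beta> c) * R ^ DIM((real ^ 'n) \<times> real))
      \<le> (2 * C1 + 2 * C2) * norm (R powr (real (CARD('n) - 1) + \<epsilon>))"
      using eventually_ge_at_top[of R0]
    proof eventually_elim
      case (elim R)
      then have R: "R \<ge> 1" "R > 0" using C1(2) by auto
      obtain B L where B: "finite B" "B \<subseteq> int_vecs" "{m \<in> int_vecs. height R m \<ge> 0} \<subseteq> B"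
        and L: "\<And>m. m \<in> B \<Longrightarrow> - real L \<le> height R m" "\<And>m. m \<in> B \<Longrightarrow> height R m < real L"
        and S: "\<bar>\<Sum>m\<in>B. saw L (height R m)\<bar> \<le> C2 * R powr (real (CARD('n) - 1) + \<epsilon>)"
        using C2(2)[OF R(1)] by blast
      define X where "X = R powr (real (CARD('n) - 1) + \<epsilon>)"
      have "R ^ (CARD('n) - 1) \<le> X"
        unfolding X_def using R \<epsilon> by (subst powr_realpow[symmetric]) (auto intro!: powr_mono)
      then have "C1 * R ^ (CARD('n) - 1) \<le> C1 * X" using C1(1) by (intro mult_left_mono) auto
      then have I: "\<bar>(\<integral>x. max (height R x) 0 \<partial>lborel) - (\<Sum>m\<in>B. max (height R m) 0)\<bar> \<le> C1 * X"
        using C1(3)[OF elim B] by linarith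
      have "measure lebesgue (double_paraboloid A \<beta> c) * R ^ DIM((real ^ 'n) \<times> real) = 2 * (\<integral>x. max (height R x) 0 \<partial>lborel)"
        using volume_scaled[OF R(2)] by simp
      then have "\<bar>real (lattice_count (double_paraboloid A \<beta> c) R) - measure lebesgue (double_paraboloid A \<beta> c) * R ^ DIM((real ^ 'n) \<times> real)\<bar>
         \<le> 2 * (C1 * X) + 2 * (C2 * X)"
        using lattice_count_eq[OF R(2) B L] I S[folded X_def] by linarith
      then show ?case by (simp add: X_def distrib_right)
    qed
  qed
qed

text \<open>At \<open>R = \<kappa> * p\<close> the count jumps while the volume term is continuous.
  As \<open>r\<close> tends to \<open>R\<close> from below, the jump has to be absorbed by two error
  terms and is at most \<open>2 * C * R powr \<alpha>\<close>. For large \<open>p\<close> this is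
  incompatible with \<open>\<alpha>\<close> smaller than \<open>n - 1\<close>.\<close>

lemma exponent_ge_of_bigo:
  fixes i1 i2 :: 'n
  assumes \<beta>: "\<beta> = 0" and c: "c \<in> \<rat>" and rat: "\<And>i j. A $ i $ j \<in> \<rat>" and i12: "i1 \<noteq> i2" and \<alpha>: "\<alpha> > 0"
    and O: "(\<lambda>R. real (lattice_count (double_paraboloid A \<beta> c) R) - measure lebesgue (double_paraboloid A \<beta> c) * R ^ d) \<in> O(\<lambda>R. R powr \<alpha>)"
  shows "real (CARD('n) - 1) \<le> \<alpha>"
proof (rule ccontr)
  assume less: "\<not> real (CARD('n) - 1) \<le> \<alpha>"
  define e where "e = real (CARD('n) - 1) - \<alpha>"
  have e: "e > 0" using less by (simp add: e_def)
  define V where "V = measure lebesgue (double_paraboloid A \<beta> c)"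
  define N where "N R = real (lattice_count (double_paraboloid A \<beta> c) R)" for R
  obtain \<kappa> :: real where \<kappa>: "\<kappa> \<ge> 1"
    "\<And>N. \<exists>p>N. real p ^ (CARD('n) - 1) \<le> 2 * real (card {m \<in> int_vecs. height (\<kappa> * real p) m \<ge> 0 \<and> height (\<kappa> * real p) m \<in> \<int>})"
    using many_boundary_points[OF \<beta> c rat i12] by blast
  obtain C where C: "C > 0" "\<forall>\<^sub>F R in at_top. norm (N R - V * R ^ d) \<le> C * norm (R powr \<alpha>)"
    using landau_o.bigE[OF O] unfolding N_def V_def by blast
  then obtain R1 where R1: "\<And>R. R \<ge> R1 \<Longrightarrow> \<bar>N R - V * R ^ d\<bar> \<le> C * R powr \<alpha>"
    unfolding eventually_at_top_linorder by auto
  define R2 where "R2 = max 1 R1"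
  define C' where "C' = 2 * (1 + 2 * C * \<kappa> powr \<alpha>)"
  have C': "C' > 0" using C(1) by (simp add: C'_def add_pos_nonneg)
  \<comment> \<open>Places \<open>R\<close> and the radii just below it in the range of the
    asymptotic bound, and makes \<open>p powr e\<close> exceed \<open>C'\<close>.\<close>
  define N0 where "N0 = nat \<lceil>max (R2 + 1) (C' powr (1 / e))\<rceil>"
  obtain p where p: "p > N0" "real p ^ (CARD('n) - 1) \<le> 2 * real (card {m \<in> int_vecs. height (\<kappa> * real p) m \<ge> 0 \<and> height (\<kappa> * real p) m \<in> \<int>})"
    using \<kappa>(2) by blast
  have pb: "real p > R2 + 1" "real p > C' powr (1 / e)" using p(1) unfolding N0_def by linarith+
  have p1: "real p \<ge> 1" using pb(1) by (simp add: R2_def)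
  define R where "R = \<kappa> * real p"
  define E where "E = real (card {m \<in> int_vecs. height R m \<ge> 0 \<and> height R m \<in> \<int>})"
  have Rp: "R \<ge> real p" unfolding R_def using \<kappa>(1) p1 by (simp add: mult_le_cancel_right1)
  have RR: "R > R2" "R \<ge> 1" using Rp pb(1) p1 by auto
  have ev: "\<forall>\<^sub>F r in at_left R. E \<le> V * (R ^ d - r ^ d) + 2 * (C * R powr \<alpha>)"
  proof -
    have "\<forall>\<^sub>F r in at_left R. r \<in> {R2<..<R}" using RR(1) by (rule eventually_at_left_real)
    then show ?thesis
    proof eventually_elim
      case (elim r)
      then have r: "1 \<le> r" "r < R" "r \<ge> R1" "R \<ge> R1" using RR by (auto simp: R2_def)
      have "E + N r \<le> N R"
        using of_nat_mono[OF card_boundary_le_lattice_count_diff[OF \<beta> r(1,2)], where 'a = real] by (simp add: E_def N_def)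
      moreover have "C * r powr \<alpha> \<le> C * R powr \<alpha>" using C(1) r \<alpha> by (intro mult_left_mono powr_mono2) auto
      moreover have "V * (R ^ d - r ^ d) = V * R ^ d - V * r ^ d" by (rule right_diff_distrib)
      ultimately show ?case using R1[OF r(3)] R1[OF r(4)] by linarith
    qed
  qed
  have "((\<lambda>r. V * (R ^ d - r ^ d) + 2 * (C * R powr \<alpha>)) \<longlongrightarrow> V * (R ^ d - R ^ d) + 2 * (C * R powr \<alpha>)) (at_left R)"
    by (intro tendsto_intros)
  from tendsto_lowerbound[OF this ev] have "E \<le> 2 * (C * R powr \<alpha>)" by simp
  then have "real p ^ (CARD('n) - 1) \<le> 2 * (2 * (C * R powr \<alpha>))" using p(2) unfolding E_def R_def by linarith
  also have "R powr \<alpha> = \<kappa> powr \<alpha> * real p powr \<alpha>" unfolding R_def using \<kappa>(1) by (simp add: powr_mult)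
  also have "2 * (2 * (C * (\<kappa> powr \<alpha> * real p powr \<alpha>))) \<le> C' * real p powr \<alpha>" by (simp add: C'_def algebra_simps)
  also have "real p ^ (CARD('n) - 1) = real p powr e * real p powr \<alpha>"
    using p1 by (simp add: powr_realpow[symmetric] powr_add[symmetric] e_def)
  finally have "real p powr e \<le> C'" using p1 by simp
  then have "(real p powr e) powr (1 / e) \<le> C' powr (1 / e)" using e by (intro powr_mono2) auto
  then show False using pb(2) e p1 by (simp add: powr_powr)
qed

end

theorem theorem1:
  fixes d :: nat
    and A :: "real ^ 'n ^ 'n"
    and \<beta> :: "real ^ 'n"
    and c :: real
    and i1 i2 :: 'n
  assumes "d \<ge> 3" and "CARD('n) = d - 1"
    and "i1 \<noteq> i2"
    and "transpose A = A" and "positive_definite A"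
    and "c > 0"
    and "A $ i1 $ i2 / A $ i1 $ i1 \<in> \<rat>"
    and "A $ i2 $ i2 / A $ i1 $ i1 \<in> \<rat>"
  shows "lattice_exponent (double_paraboloid A \<beta> c) \<le> real d - 2 \<and>
    (\<beta> = 0 \<and> c \<in> \<rat> \<and> (\<forall>i j. A $ i $ j \<in> \<rat>) \<longrightarrow>
      lattice_exponent (double_paraboloid A \<beta> c) = real d - 2)"
proof -
  interpret paraboloid A \<beta> c by unfold_locales (use assms in auto)
  define S where "S = {\<alpha>::real. \<alpha> > 0 \<and>
     (\<lambda>R. real (lattice_count (double_paraboloid A \<beta> c) R) - measure lebesgue (double_paraboloid A \<beta> c) * R ^ DIM((real ^ 'n) \<times> real)) \<in> O(\<lambda>R. R powr \<alpha>)}"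
  have ex: "lattice_exponent (double_paraboloid A \<beta> c) = Inf S" by (simp only: lattice_exponent_def S_def)
  have n: "real (CARD('n) - 1) = real d - 2" using assms(1,2) by (simp add: of_nat_diff)
  have mem: "real d - 2 + \<epsilon> \<in> S" if "\<epsilon> > 0" for \<epsilon>
    using lattice_count_error_bigo[OF assms(3,7) that] that assms(1) unfolding S_def n by simp
  have bdd: "bdd_below S" by (rule bdd_belowI[of _ 0]) (auto simp: S_def)
  \<comment> \<open>Every exponent above \<open>d - 2\<close> has been shown admissible, and the
    infimum requires no more.\<close>
  have le: "Inf S \<le> real d - 2"
  proof (rule field_le_epsilon)
    fix \<epsilon> :: real assume "\<epsilon> > 0"
    then show "Inf S \<le> real d - 2 + \<epsilon>" using cInf_lower[OF mem bdd] by blast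
  qed
  have "real d - 2 \<le> Inf S" if rat: "\<beta> = 0" "c \<in> \<rat>" "\<forall>i j. A $ i $ j \<in> \<rat>"
  proof (rule cInf_greatest)
    show "S \<noteq> {}" using mem[of 1] by auto
    fix \<alpha> assume "\<alpha> \<in> S"
    then show "real d - 2 \<le> \<alpha>"
      using exponent_ge_of_bigo[OF rat(1,2) _ assms(3), of \<alpha>] rat(3) unfolding S_def n by blast
  qed
  then show ?thesis using le unfolding ex by force
qed

end
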